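(* There exist numerical constants $c>0$ and $C>0$ such that the following holds for all $M>1$ and all integers $p\ge q\ge2$. Let $K^*=\lfloor c\log(q)\rfloor$. If $\mathbf A\in\mathbb R^{p\times q}$ satisfies $\sigma_1(\mathbf A)\le M(pq)^{1/4}$, then $$\mathbb E\big[\,|G_1[P^*_{K^*};\mathbf Y]-\|\mathbf A\|_1|\,\big]\le C\,M\,\frac{q}{\log(q)}\,(pq)^{1/4}.$$
   Context: $\mathbf Y=\mathbf A+\mathbf E$, where $\mathbf A$ is a deterministic real $p\times q$ matrix and $\mathbf E$ is a $p\times q$ random matrix with independent standard normal entries. $\sigma_1(\mathbf A)\ge\dots\ge\sigma_q(\mathbf A)\ge0$ are the singular values; $\|\mathbf A\|_1=\sum_{i=1}^q\sigma_i(\mathbf A)$ is the nuclear norm. Hermite polynomials: with $\phi(y)=e^{-y^2/2}(2\pi)^{-1/2}$, $H_r$ is the degree-$r$ polynomial defined by $\frac{d^r}{dy^r}\phi(y)=(-1)^rH_r(y)\phi(y)$ ($H_0=1$). For a positive integer $k$ and sequences $i\in\{1,\dots,p\}^k$, $j\in\{1,\dots,q\}^k$, with the convention $j_{k+1}=j_1$, $N_{rs}(i,j)$ is the number of occurrences of the pair $(r,s)$ among the $2k$ pairs $(i_t,j_t)$ and $(i_t,j_{t+1})$, $t=1,\dots,k$, and $$U_k=\sum_{i_1,\dots,i_k=1}^p\ \sum_{j_1,\dots,j_k=1}^q\ \prod_{r=1}^p\prod_{s=1}^qH_{N_{rs}(i,j)}(\mathbf Y_{rs}).$$ For a real polynomial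 $P(x)=\sum_{k=0}^Ka_kx^k$ and $M>1$, $$G_1[P;\mathbf Y]=M(pq)^{1/4}\Big[a_0+\sum_{k=1}^Ka_k\frac{U_k}{(M(pq)^{1/4})^{2k}}\Big].$$ Let $L_k$ be the Chebyshev polynomial of the first kind of degree $k$, and $B_K(x)=\frac2\pi L_0(x)+\frac4\pi\sum_{k=1}^K(-1)^{k+1}\frac{L_{2k}(x)}{4k^2-1}$, an even polynomial of degree $2K$. Writing $B_K(x)=\sum_{k=0}^Ka_k^*x^{2k}$, set $P_K^*(x)=\sum_{k=0}^Ka_k^*x^k$, so that $P_K^*(x^2)=B_K(x)$. *)

theory Defs
  imports
    "HOL-Probability.Probability"
    "Jordan_Normal_Form.Char_Poly"
begin

text \<open>
  Matrices are the matrices with explicit dimensions of \<^theory>\<open>Jordan_Normal_Form.Matrix\<close>,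
  since the constants of the theorem have to be uniform in the dimensions. Their rows and columns,
  and hence the index sequences \<open>i\<close>, \<open>j\<close> below, are numbered from 0.
\<close>

section \<open>Singular values\<close>

text \<open>
  The square roots of the eigenvalues of the transpose of \<open>A\<close> times \<open>A\<close>, counted with algebraic
  multiplicity and listed in decreasing order. As that matrix is symmetric, its real characteristic
  polynomial splits, so the list has \<open>dim_col A\<close> entries.
\<close>

definition singular_values :: "real mat \<Rightarrow> real list" where
  "singular_values A =
     rev (sorted_list_of_multiset (image_mset sqrt (proots (char_poly (transpose_mat A * A)))))"

text \<open>\<open>i\<close> ranges over \<open>1, \<dots>, dim_col A\<close>.\<close>

definition singular_value :: "nat \<Rightarrow> real mat \<Rightarrow> real" where
  "singular_value i A = singular_values A ! (i - 1)"

definition nuclear_norm :: "real mat \<Rightarrow> real" where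
  "nuclear_norm A = (\<Sum>i = 1..dim_col A. singular_value i A)"


section \<open>Hermite polynomials\<close>

definition hermite :: "nat \<Rightarrow> real \<Rightarrow> real" where
  "hermite r y = (-1) ^ r * (deriv ^^ r) std_normal_density y / std_normal_density y"

lemma hermite_is_poly: "\<exists>P :: real poly. degree P = r \<and> hermite r = poly P"
proof -
  have "\<exists>P :: real poly. degree P = r \<and>
          (deriv ^^ r) std_normal_density = (\<lambda>y. (-1) ^ r * poly P y * std_normal_density y)"
  proof (induction r)
    case 0
    show ?case by (rule exI[of _ 1]) auto
  next
    case (Suc r)
    then obtain P :: "real poly" where P: "degree P = r"
      "(deriv ^^ r) std_normal_density = (\<lambda>y. (-1) ^ r * poly P y * std_normal_density y)"
      by blast
    define Q where "Q = pCons 0 P - pderiv P"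
    have D: "((\<lambda>y. (-1) ^ r * poly P y * std_normal_density y) has_real_derivative
            (-1) ^ Suc r * poly Q y * std_normal_density y) (at y)" for y
    proof -
      have "(std_normal_density has_real_derivative - y * std_normal_density y) (at y)"
        unfolding std_normal_density_def[abs_def]
        by (rule derivative_eq_intros refl | simp)+
      then show ?thesis
        unfolding Q_def
        by (auto intro!: derivative_eq_intros poly_DERIV simp: algebra_simps)
    qed
    have "(deriv ^^ Suc r) std_normal_density = (\<lambda>y. (-1) ^ Suc r * poly Q y * std_normal_density y)"
      using D by (auto simp: P(2) fun_eq_iff intro!: DERIV_imp_deriv)
    moreover have "degree Q = Suc r"
    proof (cases "P = 0")
      case True
      have "std_normal_density = (\<lambda>_. 0 :: real)" if "r = 0"
        using P(2) that True by simp
      moreover have "std_normal_density 0 \<noteq> (0 :: real)"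
        using normal_density_pos[of 1 0 0] by simp
      ultimately have "r \<noteq> 0" by metis
      with True P(1) show ?thesis by simp
    next
      case False
      have "degree (- pderiv P) < degree (pCons 0 P)"
        using False by (simp add: degree_pderiv)
      then have "degree (pCons 0 P + - pderiv P) = degree (pCons 0 P)"
        by (rule degree_add_eq_left)
      with False P(1) show ?thesis by (simp add: Q_def)
    qed
    ultimately show ?case by blast
  qed
  then obtain P :: "real poly" where "degree P = r"
    "(deriv ^^ r) std_normal_density = (\<lambda>y. (-1) ^ r * poly P y * std_normal_density y)"
    by blast
  moreover have "std_normal_density y \<noteq> (0 :: real)" for y
    using normal_density_pos[of 1 0 y] by simp
  ultimately show ?thesis
    by (intro exI[of _ P]) (auto simp: hermite_def fun_eq_iff simp flip: power_add mult_2)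
qed


section \<open>The statistics $U_k$ and the estimator\<close>

text \<open>\<open>Suc t mod k\<close> implements the cyclic convention for \<open>j\<close>.\<close>

definition pair_count :: "nat \<Rightarrow> (nat \<Rightarrow> nat) \<Rightarrow> (nat \<Rightarrow> nat) \<Rightarrow> nat \<Rightarrow> nat \<Rightarrow> nat" where
  "pair_count k i j r s =
     card {t. t < k \<and> (i t, j t) = (r, s)} + card {t. t < k \<and> (i t, j (Suc t mod k)) = (r, s)}"

definition U_stat :: "nat \<Rightarrow> real mat \<Rightarrow> real" where
  "U_stat k Y =
     (\<Sum>i \<in> {..<k} \<rightarrow>\<^sub>E {..<dim_row Y}. \<Sum>j \<in> {..<k} \<rightarrow>\<^sub>E {..<dim_col Y}.
        \<Prod>r<dim_row Y. \<Prod>s<dim_col Y. hermite (pair_count k i j r s) (Y $$ (r, s)))"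

definition G1 :: "real \<Rightarrow> real poly \<Rightarrow> real mat \<Rightarrow> real" where
  "G1 M P Y = (let T = M * real (dim_row Y * dim_col Y) powr (1 / 4) in
     T * (Polynomial.coeff P 0 + (\<Sum>k = 1..degree P. Polynomial.coeff P k * (U_stat k Y / T ^ (2 * k)))))"


section \<open>Polynomial approximation of the absolute value\<close>

text \<open>Chebyshev polynomials of the first kind.\<close>

fun cheb :: "nat \<Rightarrow> real poly" where
  "cheb 0 = 1"
| "cheb (Suc 0) = [:0, 1:]"
| "cheb (Suc (Suc n)) = [:0, 2:] * cheb (Suc n) - cheb n"

lemma cheb_cos: "poly (cheb n) (cos x) = cos (real n * x)"
proof (induction n rule: cheb.induct)
  case (3 n)
  have "cos (real (Suc (Suc n)) * x) + cos (real n * x) = 2 * cos x * cos (real (Suc n) * x)"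
    using cos_add[of "real (Suc n) * x" x] cos_diff[of "real (Suc n) * x" x]
    by (simp add: algebra_simps)
  with 3 show ?case by simp
qed auto

definition B_poly :: "nat \<Rightarrow> real poly" where
  "B_poly K = Polynomial.smult (2 / pi) (cheb 0) +
     Polynomial.smult (4 / pi)
       (\<Sum>k = 1..K. Polynomial.smult ((-1) ^ (k + 1) / (4 * real k ^ 2 - 1)) (cheb (2 * k)))"

definition P_star :: "nat \<Rightarrow> real poly" where
  "P_star K = (\<Sum>k\<le>K. Polynomial.monom (Polynomial.coeff (B_poly K) (2 * k)) k)"

lemma cheb_parity: "odd (n + m) \<Longrightarrow> Polynomial.coeff (cheb n) m = 0"
proof (induction n arbitrary: m rule: cheb.induct)
  case (1 m)
  then show ?case by (cases m) auto
next
  case (2 m)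
  then show ?case by (auto simp: coeff_pCons split: nat.splits)
next
  case (3 n m)
  then show ?case by (cases m) (auto simp: coeff_pCons)
qed

lemma degree_cheb_le: "degree (cheb n) \<le> n"
proof (induction n rule: cheb.induct)
  case (3 n)
  have "degree ([:0, 2:] * cheb (Suc n)) \<le> Suc (Suc n)"
    using 3 degree_mult_le[of "[:0, 2:]" "cheb (Suc n)"] by simp
  with 3 show ?case by (auto intro!: degree_diff_le)
qed auto

lemma degree_B_poly_le: "degree (B_poly K) \<le> 2 * K"
  unfolding B_poly_def
  by (intro degree_add_le order.trans[OF degree_smult_le] degree_sum_le
        order.trans[OF degree_cheb_le]) auto

lemma B_poly_even: "odd m \<Longrightarrow> Polynomial.coeff (B_poly K) m = 0"
  by (auto simp: B_poly_def coeff_sum cheb_parity simp del: cheb.simps intro!: sum.neutral)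

lemma P_star_square: "poly (P_star K) (x ^ 2) = poly (B_poly K) x"
proof -
  have "poly (B_poly K) x = (\<Sum>m\<le>2 * K. Polynomial.coeff (B_poly K) m * x ^ m)"
    unfolding poly_altdef
    by (rule sum.mono_neutral_left) (use degree_B_poly_le[of K] in \<open>auto simp: coeff_eq_0\<close>)
  also have "\<dots> = (\<Sum>m \<in> (\<lambda>k. 2 * k) ` {..K}. Polynomial.coeff (B_poly K) m * x ^ m)"
    by (rule sum.mono_neutral_right) (auto intro!: B_poly_even simp: image_iff elim!: evenE)
  also have "\<dots> = (\<Sum>k\<le>K. Polynomial.coeff (B_poly K) (2 * k) * x ^ (2 * k))"
    by (subst sum.reindex) (auto simp: inj_on_def)
  finally show ?thesis
    by (simp add: P_star_def poly_sum poly_monom power_mult)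
qed


section \<open>The noise\<close>

text \<open>
  The noise is represented by its joint law, a probability measure on the functions from index
  pairs to reals. Quantifying over all probability spaces instead would place the type of the sample
  space outside the quantifiers for the constants; by the lemma below nothing is lost.
\<close>

definition std_gaussian :: "nat \<Rightarrow> nat \<Rightarrow> (nat \<times> nat \<Rightarrow> real) measure" where
  "std_gaussian p q =
     (\<Pi>\<^sub>M rs \<in> {..<p} \<times> {..<q}. density lborel (\<lambda>x. ennreal (std_normal_density x)))"

lemma (in prob_space) distr_iid_std_normal:
  assumes pq: "p > 0" "q > 0"
    and indep: "indep_vars (\<lambda>_. borel) E ({..<p} \<times> {..<q})"
    and normal: "\<And>rs. rs \<in> {..<p} \<times> {..<q} \<Longrightarrow> distributed M lborel (E rs) std_normal_density"
  shows "distr M (\<Pi>\<^sub>M rs \<in> {..<p} \<times> {..<q}. borel) (\<lambda>\<omega>. \<lambda>rs \<in> {..<p} \<times> {..<q}. E rs \<omega>)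
           = std_gaussian p q"
proof -
  have "{..<p} \<times> {..<q} \<noteq> {}" using pq by auto
  moreover have "distr M borel (E rs) = density lborel std_normal_density"
    if "rs \<in> {..<p} \<times> {..<q}" for rs
    using distributed_distr_eq_density[OF normal[OF that]]
    by (metis distr_cong sets_lborel)
  moreover have "random_variable borel (E rs)" if "rs \<in> {..<p} \<times> {..<q}" for rs
    using distributed_measurable[OF normal[OF that]] by simp
  ultimately show ?thesis
    using indep_vars_iff_distr_eq_PiM'[where I = "{..<p} \<times> {..<q}" and M' = "\<lambda>_. borel" and X = E]
      indep
    unfolding std_gaussian_def by (simp cong: PiM_cong)
qed

end

theory Submission
  imports Defs "Jordan_Normal_Form.Schur_Decomposition"
begin

text \<open>
Write \<open>T = M (p q)\<^sup>1\<^sup>/\<^sup>4\<close>, so that all singular values \<open>\<sigma>\<^sub>i\<close> of \<open>A\<close> lie in \<open>[0, T]\<close> and \<open>T\<^sup>4 \<ge> p q\<close>. The error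
is split into a bias, controlled by the quality of the Chebyshev approximation of the absolute
value, and a fluctuation, controlled by the variance of the statistics \<open>U\<^sub>k\<close>.

\<^emph>\<open>Bias.\<close> Replacing every Hermite polynomial in \<open>U\<^sub>k\<close> by the corresponding power gives
\<open>tr (Y\<^sup>T Y)\<^sup>k\<close> (\<open>cycle_poly_eq_trace\<close>), and at \<open>Y = A\<close> this is \<open>\<Sum>\<^sub>i \<sigma>\<^sub>i\<^sup>2\<^sup>k\<close>
(\<open>singular_values_facts\<close>). With \<open>U\<^sub>k\<close> replaced by that value, the estimator is
\<open>T \<Sum>\<^sub>i P((\<sigma>\<^sub>i/T)\<^sup>2)\<close> up to the constant coefficient, which it counts once instead of \<open>q\<close> times.
Since \<open>P(x\<^sup>2) = B\<^sub>K(x)\<close> differs from \<open>\<bar>x\<bar>\<close> by \<open>O(1/K)\<close> on \<open>[-1, 1]\<close> (\<open>P_star_approx\<close>), and in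
particular \<open>P(0) = O(1/K)\<close>, the bias is \<open>O(q T / K)\<close>.

\<^emph>\<open>Fluctuation.\<close> The combinatorics of \<open>U\<^sub>k\<close> is avoided by the formula
\<open>H\<^sub>n(x) = \<integral> (x + \<i> y)\<^sup>n d\<gamma>(y)\<close> with \<open>\<gamma>\<close> the standard normal law (\<open>hermite_integral\<close>): the statistic
\<open>U\<^sub>k\<close> at \<open>A + E\<close> is the average over an independent copy \<open>Z\<close> of the noise of the analytic polynomial
\<open>f(A + E + \<i> Z)\<close>, where \<open>f(Y) = tr (Y\<^sup>T Y)\<^sup>k\<close> (\<open>U_noisy_eq_integral\<close>). Hence
\<open>\<E>\<bar>U\<^sub>k - f(A)\<bar> \<le> \<E>\<bar>f(A + W) - f(A)\<bar>\<close> for a matrix \<open>W\<close> of independent complex Gaussian entries.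

Because \<open>f\<close> is analytic, \<open>f(A)\<close> is the mean of \<open>f(A + W)\<close>, and a Poincare inequality bounds the
variance by the mean squared norm of the gradient \<open>2k Y (Y\<^sup>T Y)\<^sup>k\<^sup>-\<^sup>1\<close> (\<open>cgauss_PiM_Poincare\<close>,
\<open>pderiv_fmat_trace_gram\<close>). The squared Frobenius norm of the gradient is at most
\<open>4k\<^sup>2 \<parallel>Y\<parallel>\<^sub>F\<^sup>2 \<parallel>Y\<^sup>T Y\<parallel>\<^sup>2\<^sup>k\<^sup>-\<^sup>2\<close>. It matters that the transpose is not conjugated: the noise part \<open>W\<^sup>T W\<close>
has mean zero, and its operator norm is of order \<open>(p q)\<^sup>1\<^sup>/\<^sup>2\<close> rather than \<open>p\<close>. This is shown by
exponential moments of the quadratic forms \<open>v\<^sup>T Y\<^sup>T Y v\<close> for real \<open>v\<close> (\<open>quad_form_mgf\<close>), summed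
over a net of \<open>exp(O(q))\<close> lattice vectors (\<open>complex_operator_bound\<close>, \<open>card_lattice_net\<close>); the
norm then has moments \<open>O(T\<^sup>2)\<^sup>n\<close> for all \<open>n \<le> 31 q\<close> (\<open>grad_sq_integral\<close>).

Altogether \<open>\<E>\<bar>U\<^sub>k - f(A)\<bar> \<le> 2000\<^sup>k T\<^sup>2\<^sup>k\<close> without any power of \<open>q\<close> (\<open>U_noisy_deviation\<close>). The
coefficients of \<open>P\<close> add up to at most \<open>3 \<cdot> 9\<^sup>K\<close> in absolute value, so the fluctuation of the
estimator is at most \<open>3 T \<cdot> 18000\<^sup>K\<close>. For \<open>K \<le> c log q\<close> with \<open>c\<close> small this is \<open>O(T \<surd>q)\<close>, which is
of smaller order than the bound \<open>O(T q / log q)\<close> on the bias.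
\<close>

section \<open>Chebyshev approximation of the absolute value\<close>

text \<open>
The truncated Fourier series of \<open>\<bar>cos t\<bar>\<close>, which is \<open>B\<^sub>K (cos t)\<close>.
\<close>

definition abs_cos_series :: "nat \<Rightarrow> real \<Rightarrow> real" where
  "abs_cos_series K t = 2 / pi + 4 / pi * (\<Sum>k = 1..K. (-1) ^ (k + 1) / (4 * real k ^ 2 - 1) * cos (real (2 * k) * t))"

lemma poly_B_poly_cos: "poly (B_poly K) (cos t) = abs_cos_series K t"
  by (simp add: B_poly_def abs_cos_series_def poly_sum cheb_cos del: cheb.simps) 

definition abs_cos_series' :: "nat \<Rightarrow> real \<Rightarrow> real" where
  "abs_cos_series' K t = 4 / pi * (\<Sum>k = 1..K. (-1) ^ (k + 1) / (4 * real k ^ 2 - 1) * (- (real (2 * k) * sin (real (2 * k) * t))))"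

lemma abs_cos_series_deriv: "(abs_cos_series K has_real_derivative abs_cos_series' K t) (at t)"
proof -
  have "4 * (real n)^2 \<noteq> 1" for n :: nat
  proof -
    have "4 * n^2 \<noteq> 1" by presburger
    then have "real (4 * n^2) \<noteq> real 1" by (simp only: of_nat_eq_iff not_False_eq_True)
    then show ?thesis by simp
  qed
  then show ?thesis
    unfolding abs_cos_series_def abs_cos_series'_def
    by (auto intro!: derivative_eq_intros sum.cong simp: mult_ac)
qed

lemma cross_fraction: "a \<noteq> 0 \<Longrightarrow> b \<noteq> 0 \<Longrightarrow>
    4/pi * c / (a * b) * (- (1/2) * (a * u + b * v)) = - (2/pi * c * (u / b + v / (a::real)))"
  by (simp add: field_simps)

text \<open>
The left-hand side is the Wronskian of the partial sum and the cosine, so it measures how far the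
partial sum is from being a multiple of \<open>cos t\<close>. Each term of the series contributes two
consecutive odd frequencies, and the sum telescopes.
\<close>

lemma abs_cos_series_Wronskian:
  "abs_cos_series' K t * cos t + abs_cos_series K t * sin t = 2 / pi * (-1) ^ K * sin (real (2 * K + 1) * t) / real (2 * K + 1)"
proof (induction K)
  case 0
  then show ?case by (simp add: abs_cos_series_def abs_cos_series'_def)
next
  case (Suc K)
  define m where "m = real (Suc K)"
  have m1: "m \<ge> 1" by (simp add: m_def)
  have "abs_cos_series' (Suc K) t * cos t + abs_cos_series (Suc K) t * sin t = 
     (abs_cos_series' K t * cos t + abs_cos_series K t * sin t) + 4/pi * (-1)^K / (4 * m^2 - 1) * 
       (- (2 * m * sin (2*m*t)) * cos t + cos (2*m*t) * sin t)"
    by (simp add: abs_cos_series_def abs_cos_series'_def algebra_simps m_def del: of_nat_Suc)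
  also have "- (2 * m * sin (2*m*t)) * cos t + cos (2*m*t) * sin t = 
     - (1/2) * ((2*m-1) * sin ((2*m+1)*t) + (2*m+1) * sin ((2*m-1)*t))"
    by (simp add: algebra_simps sin_add sin_diff)
  also have "4/pi * (-1)^K / (4 * m^2 - 1) * (- (1/2) * ((2*m-1) * sin ((2*m+1)*t) + (2*m+1) * sin ((2*m-1)*t)))
     = - (2/pi * (-1)^K * (sin ((2*m+1)*t) / (2*m+1) + sin ((2*m-1)*t)/(2*m-1)))"
  proof -
    have e: "4 * m^2 - 1 = (2*m-1)*(2*m+1)" by (simp add: algebra_simps power2_eq_square)
    show ?thesis unfolding e using m1 by (intro cross_fraction) auto
  qed
  also note Suc.IH
  finally have *: "abs_cos_series' (Suc K) t * cos t + abs_cos_series (Suc K) t * sin t =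
    2 / pi * (- 1) ^ K * sin (real (2 * K + 1) * t) / real (2 * K + 1) +
    - (2 / pi * (- 1) ^ K * (sin ((2 * m + 1) * t) / (2 * m + 1) + sin ((2 * m - 1) * t) / (2 * m - 1)))" .
  have "2 * m - 1 = real (2*K+1)" "2*m+1 = real (2 * Suc K + 1)" by (simp_all add: m_def)
  then show ?case unfolding * by (simp only:) (simp add: algebra_simps)
qed

lemma Leibniz_series_bound: "\<bar>(\<Sum>j\<le>K. (-1) ^ j / real (2 * j + 1)) - pi / 4\<bar> \<le> 1 / real (2 * K + 1)"
proof -
  define a where "a = (\<lambda>j::nat. 1 / real (j*2+1))"
  have "(\<lambda>n::nat. 1 / (of_nat n :: real)) \<longlonglongrightarrow> 0" by (rule lim_1_over_n)
  moreover have "strict_mono (\<lambda>j::nat. j*2+1)" by (auto simp: strict_mono_def)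
  ultimately have a0: "a \<longlonglongrightarrow> 0" unfolding a_def
    using LIMSEQ_subseq_LIMSEQ by (fastforce simp: o_def)
  have mono: "monoseq a" unfolding a_def by (intro monoI2) (auto simp: field_simps)
  have s: "pi / 4 = (\<Sum>j. (-1) ^ j * a j)" using pi_series by (simp add: a_def)
  have pos: "0 < a 0" by (simp add: a_def)
  note L = summable_Leibniz(2)[OF a0 mono, rule_format, OF pos]
  have nn: "a j \<ge> 0" for j by (simp add: a_def)
  have L1: "(\<Sum>i<2*n. (-1)^i * a i) \<le> pi / 4" "pi/4 \<le> (\<Sum>i<2*n+1. (-1)^i * a i)" for n
    using L[of n] by (auto simp: s)
  have e: "(\<Sum>j\<le>K. (-1) ^ j / real (2 * j + 1)) = (\<Sum>i<Suc K. (-1)^i * a i)"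
    by (simp add: a_def lessThan_Suc_atMost mult.commute)
  have "\<bar>(\<Sum>i<Suc K. (-1)^i * a i) - pi / 4\<bar> \<le> a K"
  proof (cases "even K")
    case True
    then obtain n where n: "K = 2 * n" by blast
    have "(\<Sum>i<Suc K. (-1)^i * a i) = (\<Sum>i<2*n. (-1)^i * a i) + a K" using n by simp
    then show ?thesis using L1(1)[of n] L1(2)[of n] n by simp
  next
    case False
    then obtain n where n: "K = 2 * n + 1" by (metis oddE)
    have "(\<Sum>i<Suc K. (-1)^i * a i) = (\<Sum>i<2*n+1. (-1)^i * a i) - a K" using n by simp
    then show ?thesis using L1(1)[of "Suc n"] L1(2)[of n] n by simp
  qed
  then show ?thesis unfolding e by (simp add: a_def mult.commute)
qed

text \<open>
At \<open>t = 0\<close> the series telescopes into the Leibniz series, which identifies the multiple of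
\<open>cos t\<close> that the partial sums approach.
\<close>

lemma abs_cos_series_0: "abs_cos_series K 0 = 4 / pi * (\<Sum>j\<le>K. (-1) ^ j / real (2 * j + 1)) - 2 / pi * (-1) ^ K / real (2 * K + 1)"
proof (induction K)
  case 0 then show ?case by (simp add: abs_cos_series_def)
next
  case (Suc K)
  define m where "m = real (Suc K)"
  have m1: "m \<ge> 1" by (simp add: m_def)
  have "abs_cos_series (Suc K) 0 = abs_cos_series K 0 + 4/pi * (-1)^K / (4 * m^2 - 1)"
    by (simp add: abs_cos_series_def algebra_simps m_def del: of_nat_Suc)
  also have "4/pi * (-1)^K / (4 * m^2 - 1) = 2/pi * (-1)^K * (1/(2*m-1) - 1/(2*m+1))"
  proof -
    have e: "4 * m^2 - 1 = (2*m-1)*(2*m+1)" by (simp add: algebra_simps power2_eq_square)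
    show ?thesis unfolding e using m1 by (simp add: field_simps)
  qed
  finally have *: "abs_cos_series (Suc K) 0 = abs_cos_series K 0 + 2 / pi * (-1) ^ K * (1 / (2 * m - 1) - 1 / (2 * m + 1))" .
  have "2 * m - 1 = real (2*K+1)" "2*m+1 = real (2 * Suc K + 1)" by (simp_all add: m_def)
  then show ?case unfolding * Suc.IH by (simp only:) (simp add: algebra_simps)
qed

lemma abs_cos_series_0_bound: "\<bar>abs_cos_series K 0 - 1\<bar> \<le> 6 / pi / real (2 * K + 1)"
proof -
  have "abs_cos_series K 0 - 1 = 4 / pi * ((\<Sum>j\<le>K. (-1) ^ j / real (2 * j + 1)) - pi/4) - 2 / pi * (-1) ^ K / real (2 * K + 1)"
    by (simp add: abs_cos_series_0 algebra_simps)
  also have "\<bar>\<dots>\<bar> \<le> \<bar>4 / pi * ((\<Sum>j\<le>K. (-1) ^ j / real (2 * j + 1)) - pi/4)\<bar> + \<bar>2 / pi * (-1) ^ K / real (2 * K + 1)\<bar>"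
    by (rule abs_triangle_ineq4)
  also have "\<dots> \<le> 4/pi * (1 / real (2*K+1)) + 2/pi/real (2*K+1)"
  proof (rule add_mono)
    show "\<bar>4 / pi * ((\<Sum>j\<le>K. (-1) ^ j / real (2 * j + 1)) - pi/4)\<bar> \<le> 4/pi * (1 / real (2*K+1))"
      unfolding abs_mult using mult_left_mono[OF Leibniz_series_bound[of K], of "4/pi"] by simp
  qed (simp add: abs_mult power_abs)
  finally show ?thesis by simp
qed

text \<open>
The derivative of the quotient by \<open>cos t\<close> is the Wronskian divided by \<open>cos\<^sup>2 t\<close>, hence at most
the derivative of \<open>e tan t\<close> with \<open>e = O(1/K)\<close>; integrate from \<open>0\<close> and multiply by \<open>cos t\<close>.
\<close>

lemma abs_cos_series_bound:
  assumes "0 \<le> t" "t < pi / 2"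
  shows "\<bar>abs_cos_series K t - abs_cos_series K 0 * cos t\<bar> \<le> 2 / pi / real (2 * K + 1) * sin t"
proof -
  define e where "e = 2 / pi / real (2 * K + 1)"
  have e0: "e \<ge> 0" by (simp add: e_def)
  have cpos: "cos x > 0" if "0 \<le> x" "x \<le> t" for x
    using that assms by (intro cos_gt_zero_pi) auto
  have D: "((\<lambda>x. abs_cos_series K x / cos x) has_real_derivative 
      (2 / pi * (-1) ^ K * sin (real (2 * K + 1) * x) / real (2 * K + 1)) / (cos x)^2) (at x)" 
    if "0 \<le> x" "x \<le> t" for x
  proof -
    have "((\<lambda>x. abs_cos_series K x / cos x) has_real_derivative (abs_cos_series' K x * cos x + abs_cos_series K x * sin x) / (cos x)^2) (at x)"
      using cpos[OF that] by (auto intro!: derivative_eq_intros abs_cos_series_deriv simp: power2_eq_square)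
    then show ?thesis by (simp only: abs_cos_series_Wronskian)
  qed
  have B: "\<bar>(2 / pi * (-1) ^ K * sin (real (2 * K + 1) * x) / real (2 * K + 1)) / (cos x)^2\<bar> \<le> e / (cos x)^2" for x
    unfolding e_def by (auto simp: abs_mult power_abs intro!: divide_right_mono mult_left_le)
  have T: "((\<lambda>x. e * tan x) has_real_derivative e / (cos x)^2) (at x)" if "0 \<le> x" "x \<le> t" for x
    using cpos[OF that] by (auto intro!: derivative_eq_intros simp: field_simps)
  have 1: "e * tan 0 - abs_cos_series K 0 / cos 0 \<le> e * tan t - abs_cos_series K t / cos t"
  proof (rule deriv_nonneg_imp_mono[where g = "\<lambda>x. e * tan x - abs_cos_series K x / cos x"])
    fix x assume "x \<in> {0..t}"
    then show "((\<lambda>x. e * tan x - abs_cos_series K x / cos x) has_real_derivative 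
       e / (cos x)^2 - (2 / pi * (-1) ^ K * sin (real (2 * K + 1) * x) / real (2 * K + 1)) / (cos x)^2) (at x)"
      using D T by (intro derivative_intros) auto
    show "0 \<le> e / (cos x)^2 - (2 / pi * (-1) ^ K * sin (real (2 * K + 1) * x) / real (2 * K + 1)) / (cos x)^2"
      using B[of x] by linarith
  qed (use assms in auto)
  have 2: "e * tan 0 + abs_cos_series K 0 / cos 0 \<le> e * tan t + abs_cos_series K t / cos t"
  proof (rule deriv_nonneg_imp_mono[where g = "\<lambda>x. e * tan x + abs_cos_series K x / cos x"])
    fix x assume "x \<in> {0..t}"
    then show "((\<lambda>x. e * tan x + abs_cos_series K x / cos x) has_real_derivative 
       e / (cos x)^2 + (2 / pi * (-1) ^ K * sin (real (2 * K + 1) * x) / real (2 * K + 1)) / (cos x)^2) (at x)"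
      using D T by (intro derivative_intros) auto
    show "0 \<le> e / (cos x)^2 + (2 / pi * (-1) ^ K * sin (real (2 * K + 1) * x) / real (2 * K + 1)) / (cos x)^2"
      using B[of x] by linarith
  qed (use assms in auto)
  have "\<bar>abs_cos_series K t / cos t - abs_cos_series K 0\<bar> \<le> e * tan t"
    using 1 2 unfolding tan_zero cos_zero by (simp add: abs_le_iff)
  then have "\<bar>abs_cos_series K t / cos t - abs_cos_series K 0\<bar> * cos t \<le> e * tan t * cos t"
    using cpos[of t] assms by (intro mult_right_mono) auto
  also have "e * tan t * cos t = e * sin t" using cpos[of t] assms by (simp add: tan_def)
  also have "\<bar>abs_cos_series K t / cos t - abs_cos_series K 0\<bar> * cos t = \<bar>(abs_cos_series K t / cos t - abs_cos_series K 0) * cos t\<bar>"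
    using cpos[of t] assms by (simp add: abs_mult)
  also have "(abs_cos_series K t / cos t - abs_cos_series K 0) * cos t = abs_cos_series K t - abs_cos_series K 0 * cos t"
    using cpos[of t] assms by (simp add: field_simps)
  finally show ?thesis unfolding e_def .
qed

text \<open>
The value at \<open>0\<close> is the limit of the values at small positive arguments, where the substitution
\<open>x = cos t\<close> with \<open>t < pi / 2\<close> is available.
\<close>

lemma B_poly_0: "\<bar>poly (B_poly K) 0\<bar> \<le> 8 / pi / real (2 * K + 1)"
  and B_poly_approx_pos: "0 < x \<Longrightarrow> x \<le> 1 \<Longrightarrow> \<bar>poly (B_poly K) x - x\<bar> \<le> 8 / pi / real (2 * K + 1)"
proof -
  have pos: "\<bar>poly (B_poly K) x - x\<bar> \<le> 8 / pi / real (2 * K + 1)" if x: "0 < x" "x \<le> 1" for x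
  proof -
    define t where "t = arccos x"
    have t: "0 \<le> t" "t < pi/2" "cos t = x"
      using x arccos_less_arccos[of 0 x] arccos_lbound[of x] by (auto simp: t_def)
    have "poly (B_poly K) x - x = (abs_cos_series K t - abs_cos_series K 0 * cos t) + (abs_cos_series K 0 - 1) * x"
      by (simp add: poly_B_poly_cos flip: t(3)) (simp add: algebra_simps)
    also have "\<bar>\<dots>\<bar> \<le> 2 / pi / real (2 * K + 1) * sin t + \<bar>abs_cos_series K 0 - 1\<bar> * \<bar>x\<bar>"
      using abs_cos_series_bound[OF t(1,2), of K] by (intro order.trans[OF abs_triangle_ineq] add_mono) (auto simp: abs_mult)
    also have "\<dots> \<le> 2 / pi / real (2 * K + 1) * 1 + 6 / pi / real (2 * K + 1) * 1"
      using abs_cos_series_0_bound[of K] x t sin_ge_zero[of t] pi_gt_zero by (intro add_mono mult_mono) auto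
    finally show ?thesis by (simp add: algebra_simps)
  qed
  then show "0 < x \<Longrightarrow> x \<le> 1 \<Longrightarrow> \<bar>poly (B_poly K) x - x\<bar> \<le> 8 / pi / real (2 * K + 1)" .
  have "((\<lambda>x. \<bar>poly (B_poly K) x - x\<bar>) \<longlongrightarrow> \<bar>poly (B_poly K) 0 - 0\<bar>) (at_right 0)"
    by (intro tendsto_intros)
  moreover have "\<forall>\<^sub>F x in at_right 0. \<bar>poly (B_poly K) x - x\<bar> \<le> 8 / pi / real (2 * K + 1)"
    by (rule eventually_at_rightI[of 0 1]) (use pos in auto)
  ultimately show "\<bar>poly (B_poly K) 0\<bar> \<le> 8 / pi / real (2 * K + 1)"
    using tendsto_upperbound by fastforce
qed

lemma P_star_approx:
  assumes "0 \<le> x" "x \<le> 1"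
  shows "\<bar>poly (P_star K) (x^2) - x\<bar> \<le> 8 / pi / real (2 * K + 1)"
  unfolding P_star_square
  using B_poly_0[of K] B_poly_approx_pos[of x K] assms by (cases "x = 0") auto

definition coeff_l1 :: "real poly \<Rightarrow> real" where "coeff_l1 P = (\<Sum>i\<le>degree P. \<bar>Polynomial.coeff P i\<bar>)"

lemma coeff_l1_extend: "degree P \<le> n \<Longrightarrow> coeff_l1 P = (\<Sum>i\<le>n. \<bar>Polynomial.coeff P i\<bar>)"
  unfolding coeff_l1_def by (rule sum.mono_neutral_left) (auto simp: coeff_eq_0)

lemma coeff_l1_add: "coeff_l1 (P + Q) \<le> coeff_l1 P + coeff_l1 Q"
proof -
  define n where "n = max (degree P) (degree Q)"
  have "degree (P + Q) \<le> n" unfolding n_def by (rule degree_add_le_max)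
  then have "coeff_l1 (P + Q) = (\<Sum>i\<le>n. \<bar>Polynomial.coeff (P + Q) i\<bar>)" by (rule coeff_l1_extend)
  also have "\<dots> \<le> (\<Sum>i\<le>n. \<bar>Polynomial.coeff P i\<bar> + \<bar>Polynomial.coeff Q i\<bar>)"
    unfolding coeff_add by (intro sum_mono abs_triangle_ineq)
  also have "\<dots> = coeff_l1 P + coeff_l1 Q"
    unfolding sum.distrib using coeff_l1_extend[of P n] coeff_l1_extend[of Q n] by (simp add: n_def)
  finally show ?thesis .
qed

lemma coeff_l1_smult: "coeff_l1 (Polynomial.smult c P) = \<bar>c\<bar> * coeff_l1 P"
  by (subst (1 2) coeff_l1_extend[of _ "degree P"]) (auto simp: degree_smult_le abs_mult sum_distrib_left)

lemma coeff_l1_pCons: "coeff_l1 (pCons 0 P) = coeff_l1 P"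
  by (subst coeff_l1_extend[of _ "Suc (degree P)"])
     (auto simp: degree_pCons_le coeff_l1_def sum.atMost_Suc_shift simp del: sum.atMost_Suc)

text \<open>
The three-term recursion of the Chebyshev polynomials gives
\<open>\<ell>\<^sub>n\<^sub>+\<^sub>2 \<le> 2 \<ell>\<^sub>n\<^sub>+\<^sub>1 + \<ell>\<^sub>n\<close> for the coefficient sums, and \<open>2 \<cdot> 3 + 1 \<le> 9\<close>.
\<close>

lemma coeff_l1_cheb: "coeff_l1 (cheb n) \<le> 3 ^ n"
proof (induction n rule: cheb.induct)
  case (3 n)
  have e: "cheb (Suc (Suc n)) = Polynomial.smult 2 (pCons 0 (cheb (Suc n))) + Polynomial.smult (-1) (cheb n)"
    by simp
  have "coeff_l1 (cheb (Suc (Suc n))) \<le> 2 * coeff_l1 (cheb (Suc n)) + coeff_l1 (cheb n)"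
    unfolding e by (rule order.trans[OF coeff_l1_add]) (unfold coeff_l1_smult coeff_l1_pCons, simp)
  also have "\<dots> \<le> 2 * 3 ^ Suc n + 3 ^ n" using 3 by (intro add_mono mult_left_mono) auto
  also have "\<dots> \<le> 3 ^ Suc (Suc n)" by simp
  finally show ?case .
qed (auto simp: coeff_l1_def)

lemma coeff_l1_sum: "coeff_l1 (\<Sum>i\<in>A. f i) \<le> (\<Sum>i\<in>A. coeff_l1 (f i))"
  by (induction A rule: infinite_finite_induct) (auto simp: coeff_l1_def[of 0] intro: order.trans[OF coeff_l1_add])

lemma coeff_l1_B_poly: "coeff_l1 (B_poly K) \<le> 3 * 9 ^ K"
proof -
  have "coeff_l1 (B_poly K) \<le> 2/pi * coeff_l1 (cheb 0) + 4/pi * 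
     (\<Sum>k = 1..K. \<bar>(-1) ^ (k + 1) / (4 * real k ^ 2 - 1)\<bar> * coeff_l1 (cheb (2 * k)))"
  proof -
    let ?S = "\<Sum>k = 1..K. Polynomial.smult ((-1) ^ (k + 1) / (4 * real k ^ 2 - 1)) (cheb (2 * k))"
    have "coeff_l1 (B_poly K) \<le> 2/pi * coeff_l1 (cheb 0) + 4/pi * coeff_l1 ?S"
      unfolding B_poly_def
      by (rule order.trans[OF coeff_l1_add]) (simp only: coeff_l1_smult, simp)
    also have "4/pi * coeff_l1 ?S \<le> 4/pi * (\<Sum>k = 1..K. \<bar>(-1) ^ (k + 1) / (4 * real k ^ 2 - 1)\<bar> * coeff_l1 (cheb (2 * k)))"
      unfolding coeff_l1_smult[symmetric] by (intro mult_left_mono coeff_l1_sum) auto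
    finally show ?thesis by simp
  qed
  also have "\<dots> \<le> 1 * 1 + 2 * (\<Sum>k = 1..K. 1 * 9 ^ k)"
  proof (intro add_mono mult_mono sum_mono)
    show "2/pi \<le> 1" "4/pi \<le> 2" using pi_ge_two by (auto simp: field_simps)
    show "coeff_l1 (cheb 0) \<le> 1" using coeff_l1_cheb[of 0] by simp
    fix k assume "k \<in> {1..K}"
    then have "1 \<le> real k" by auto
    then have "1 \<le> real k ^ 2" by simp
    then have "1 \<le> 4 * real k ^ 2 - 1" by simp
    then show "\<bar>(-1) ^ (k + 1) / (4 * real k ^ 2 - 1)\<bar> \<le> 1" by (simp add: power_abs abs_divide)
    show "coeff_l1 (cheb (2 * k)) \<le> 9 ^ k" using coeff_l1_cheb[of "2*k"] by (simp add: power_mult)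
  qed (auto simp: coeff_l1_def intro!: sum_nonneg mult_nonneg_nonneg)
  also have "\<dots> \<le> 3 * 9 ^ K"
  proof (induction K)
    case (Suc K)
    have "(0::real) \<le> 9 ^ K" by simp
    with Suc show ?case by (simp, linarith)
  qed auto
  finally show ?thesis .
qed

lemma coeff_P_star: "Polynomial.coeff (P_star K) k = (if k \<le> K then Polynomial.coeff (B_poly K) (2 * k) else 0)"
  by (simp add: P_star_def coeff_sum)

lemma degree_P_star: "degree (P_star K) \<le> K"
  by (rule degree_le) (auto simp: coeff_P_star)

lemma P_star_coeff_sum: "(\<Sum>k\<le>K. \<bar>Polynomial.coeff (P_star K) k\<bar>) \<le> 3 * 9 ^ K"
proof -
  have "(\<Sum>k\<le>K. \<bar>Polynomial.coeff (P_star K) k\<bar>) = (\<Sum>m\<in>(\<lambda>k. 2*k) ` {..K}. \<bar>Polynomial.coeff (B_poly K) m\<bar>)"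
    by (subst sum.reindex) (auto simp: inj_on_def coeff_P_star)
  also have "\<dots> \<le> (\<Sum>m\<le>2*K. \<bar>Polynomial.coeff (B_poly K) m\<bar>)"
    by (rule sum_mono2) auto
  also have "\<dots> = coeff_l1 (B_poly K)"
    by (rule coeff_l1_extend[symmetric, OF degree_B_poly_le])
  finally show ?thesis using coeff_l1_B_poly[of K] by linarith
qed


section \<open>Powers and traces of matrices given by their entries\<close>

text \<open>
Matrices are represented here by their entry functions, with the dimension as a parameter, because
the same algebra is needed for real and complex entries and for entries in a polynomial ring. The
entries outside the range are irrelevant, so some of the laws below hold only inside it.
\<close>

definition fmat_mult :: "nat \<Rightarrow> (nat \<Rightarrow> nat \<Rightarrow> 'a::comm_ring_1) \<Rightarrow> (nat \<Rightarrow> nat \<Rightarrow> 'a) \<Rightarrow> nat \<Rightarrow> nat \<Rightarrow> 'a" where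
  "fmat_mult n A B i j = (\<Sum>k<n. A i k * B k j)"

fun fmat_pow :: "nat \<Rightarrow> (nat \<Rightarrow> nat \<Rightarrow> 'a::comm_ring_1) \<Rightarrow> nat \<Rightarrow> nat \<Rightarrow> nat \<Rightarrow> 'a" where
  "fmat_pow n G 0 = (\<lambda>i j. if i = j then 1 else 0)"
| "fmat_pow n G (Suc k) = fmat_mult n G (fmat_pow n G k)"

definition gram :: "nat \<Rightarrow> (nat \<Rightarrow> nat \<Rightarrow> 'a::comm_ring_1) \<Rightarrow> nat \<Rightarrow> nat \<Rightarrow> 'a" where
  "gram p Y i j = (\<Sum>a<p. Y a i * Y a j)"

definition fmat_trace :: "nat \<Rightarrow> (nat \<Rightarrow> nat \<Rightarrow> 'a::comm_ring_1) \<Rightarrow> 'a" where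
  "fmat_trace n G = (\<Sum>i<n. G i i)"

lemma fmat_mult_assoc: "fmat_mult n (fmat_mult n A B) C = fmat_mult n A (fmat_mult n B C)"
proof (intro ext)
  fix i j
  have "fmat_mult n (fmat_mult n A B) C i j = (\<Sum>k<n. \<Sum>l<n. A i l * B l k * C k j)"
    by (simp add: fmat_mult_def sum_distrib_right)
  also have "\<dots> = (\<Sum>l<n. \<Sum>k<n. A i l * B l k * C k j)" by (rule sum.swap)
  also have "\<dots> = fmat_mult n A (fmat_mult n B C) i j" by (simp add: fmat_mult_def sum_distrib_left mult.assoc)
  finally show "fmat_mult n (fmat_mult n A B) C i j = fmat_mult n A (fmat_mult n B C) i j" .
qed

lemma fmat_trace_mult_commute: "fmat_trace n (fmat_mult n A B) = fmat_trace n (fmat_mult n B A)"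
  unfolding fmat_trace_def fmat_mult_def by (subst sum.swap) (simp add: mult.commute)

lemma fmat_mult_cong: "(\<And>k. k < n \<Longrightarrow> A i k = A' i k) \<Longrightarrow> (\<And>k. k < n \<Longrightarrow> B k j = B' k j) \<Longrightarrow> fmat_mult n A B i j = fmat_mult n A' B' i j"
  by (auto simp: fmat_mult_def intro!: sum.cong)

lemma fmat_pow_add: "i < n \<Longrightarrow> fmat_mult n (fmat_pow n G a) (fmat_pow n G b) i j = fmat_pow n G (a + b) i j"
proof (induction a arbitrary: i)
  case 0
  then show ?case by (simp add: fmat_mult_def if_distrib[of "\<lambda>x. x * _"] cong: if_cong)
next
  case (Suc a)
  then show ?case by (simp add: fmat_mult_assoc) (rule fmat_mult_cong, auto)
qed

lemma fmat_pow_1: "j < n \<Longrightarrow> fmat_pow n G (Suc 0) i j = G i j"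
  by (simp add: fmat_mult_def if_distrib[of "\<lambda>x. _ * x"] cong: if_cong)

lemma fmat_pow_Suc_right: "i < n \<Longrightarrow> j < n \<Longrightarrow> fmat_mult n (fmat_pow n G a) G i j = fmat_pow n G (Suc a) i j"
  using fmat_pow_add[of i n G a 1 j] fmat_pow_1[of j n G] fmat_mult_cong[of n "fmat_pow n G a" i "fmat_pow n G a" G j "fmat_pow n G 1"]
  by auto

lemma fmat_pow_cong:
  assumes "\<And>i j. i < n \<Longrightarrow> j < n \<Longrightarrow> G i j = G' i j" "i < n" "j < n"
  shows "fmat_pow n G k i j = fmat_pow n G' k i j"
  using assms(2,3) by (induction k arbitrary: i j) (auto intro!: fmat_mult_cong assms(1))

lemma fmat_pow_sym:
  assumes "\<And>i j. G i j = G j i" "i < n" "j < n"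
  shows "fmat_pow n G k i j = fmat_pow n G k j i"
  using assms(2,3)
proof (induction k arbitrary: i j)
  case (Suc k)
  have "fmat_pow n G (Suc k) i j = (\<Sum>l<n. G i l * fmat_pow n G k l j)" by (simp add: fmat_mult_def)
  also have "\<dots> = (\<Sum>l<n. fmat_pow n G k j l * G l i)"
    using Suc assms(1) by (intro sum.cong) (auto simp: mult.commute)
  also have "\<dots> = fmat_pow n G (Suc k) j i" using Suc.prems fmat_pow_Suc_right[of j n i G k] by (simp add: fmat_mult_def)
  finally show ?case .
qed auto

lemma gram_sym: "gram p Y i j = gram p Y j i"
  by (simp add: gram_def mult.commute)


lemma poly_fmat_mult: "poly (fmat_mult n A B i j) z = fmat_mult n (\<lambda>i j. poly (A i j) z) (\<lambda>i j. poly (B i j) z) i j"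
  by (simp add: fmat_mult_def poly_sum)

lemma poly_fmat_pow: "poly (fmat_pow n G k i j) z = fmat_pow n (\<lambda>i j. poly (G i j) z) k i j"
  by (induction k arbitrary: i j) (auto simp: poly_fmat_mult)

lemma poly_gram: "poly (gram p Y i j) z = gram p (\<lambda>i j. poly (Y i j) z) i j"
  by (simp add: gram_def poly_sum)

lemma poly_fmat_trace: "poly (fmat_trace n G) z = fmat_trace n (\<lambda>i j. poly (G i j) z)"
  by (simp add: fmat_trace_def poly_sum)

definition fmat_deriv :: "(nat \<Rightarrow> nat \<Rightarrow> 'a::{comm_ring_1,semiring_no_zero_divisors} poly) \<Rightarrow> nat \<Rightarrow> nat \<Rightarrow> 'a poly" where
  "fmat_deriv G i j = pderiv (G i j)"

lemma fmat_deriv_mult: "fmat_deriv (fmat_mult n A B) i j = fmat_mult n (fmat_deriv A) B i j + fmat_mult n A (fmat_deriv B) i j"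
  by (simp add: fmat_deriv_def fmat_mult_def pderiv_sum pderiv_mult sum.distrib algebra_simps)

lemma fmat_trace_add: "fmat_trace n (\<lambda>i j. A i j + B i j) = fmat_trace n A + fmat_trace n B"
  by (simp add: fmat_trace_def sum.distrib)

lemma fmat_trace_cong: "(\<And>i. i < n \<Longrightarrow> A i i = B i i) \<Longrightarrow> fmat_trace n A = fmat_trace n B"
  by (simp add: fmat_trace_def)

lemma fmat_mult_add_left: "fmat_mult n (\<lambda>i j. A i j + B i j) C i j = fmat_mult n A C i j + fmat_mult n B C i j"
  by (simp add: fmat_mult_def sum.distrib distrib_right)

text \<open>
The factor \<open>G\<^sup>l\<close> makes the induction on \<open>k\<close> go through: after the product rule, cyclicity
of the trace moves one factor \<open>G\<close> to the other side of the differentiated power.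
\<close>

lemma fmat_trace_deriv_pow:
  "fmat_trace n (fmat_mult n (fmat_deriv (fmat_pow n G k)) (fmat_pow n G l)) = of_nat k * fmat_trace n (fmat_mult n (fmat_deriv G) (fmat_pow n G (k - 1 + l)))"
proof (induction k arbitrary: l)
  case 0
  show ?case by (auto simp: fmat_trace_def fmat_mult_def fmat_deriv_def pderiv_1 intro!: sum.neutral)
next
  case (Suc k)
  have D: "fmat_deriv (fmat_pow n G (Suc k)) = (\<lambda>i j. fmat_mult n (fmat_deriv G) (fmat_pow n G k) i j + fmat_mult n G (fmat_deriv (fmat_pow n G k)) i j)"
    by (intro ext) (simp add: fmat_deriv_mult)
  have "fmat_trace n (fmat_mult n (fmat_deriv (fmat_pow n G (Suc k))) (fmat_pow n G l)) = 
     fmat_trace n (fmat_mult n (fmat_mult n (fmat_deriv G) (fmat_pow n G k)) (fmat_pow n G l)) + fmat_trace n (fmat_mult n (fmat_mult n G (fmat_deriv (fmat_pow n G k))) (fmat_pow n G l))"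
    unfolding D fmat_trace_add[symmetric] by (rule fmat_trace_cong) (simp add: fmat_mult_add_left)
  also have "fmat_trace n (fmat_mult n (fmat_mult n (fmat_deriv G) (fmat_pow n G k)) (fmat_pow n G l)) = fmat_trace n (fmat_mult n (fmat_deriv G) (fmat_pow n G (k + l)))"
    unfolding fmat_mult_assoc by (intro fmat_trace_cong fmat_mult_cong) (auto simp: fmat_pow_add)
  also have "fmat_trace n (fmat_mult n (fmat_mult n G (fmat_deriv (fmat_pow n G k))) (fmat_pow n G l)) = fmat_trace n (fmat_mult n (fmat_deriv (fmat_pow n G k)) (fmat_mult n (fmat_pow n G l) G))"
    unfolding fmat_mult_assoc by (subst fmat_trace_mult_commute) (simp add: fmat_mult_assoc)
  also have "\<dots> = fmat_trace n (fmat_mult n (fmat_deriv (fmat_pow n G k)) (fmat_pow n G (Suc l)))"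
    by (intro fmat_trace_cong fmat_mult_cong) (auto simp: fmat_pow_Suc_right simp del: fmat_pow.simps)
  also have "\<dots> = of_nat k * fmat_trace n (fmat_mult n (fmat_deriv G) (fmat_pow n G (k + l)))"
    unfolding Suc.IH by (cases k) auto
  finally show ?case by (simp add: distrib_right)
qed

lemma pderiv_fmat_trace_pow: "pderiv (fmat_trace n (fmat_pow n G k)) = of_nat k * fmat_trace n (fmat_mult n (fmat_deriv G) (fmat_pow n G (k - 1)))"
proof -
  have "pderiv (fmat_trace n (fmat_pow n G k)) = fmat_trace n (fmat_deriv (fmat_pow n G k))"
    by (simp add: fmat_trace_def fmat_deriv_def pderiv_sum)
  also have "\<dots> = fmat_trace n (fmat_mult n (fmat_deriv (fmat_pow n G k)) (fmat_pow n G 0))"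
    by (auto simp: fmat_trace_def fmat_mult_def if_distrib[of "\<lambda>x. _ * x"] cong: if_cong)
  finally show ?thesis by (simp add: fmat_trace_deriv_pow del: fmat_pow.simps)
qed

text \<open>
A matrix of polynomials in one variable \<open>z\<close>: the entry \<open>(r, s)\<close> of \<open>Y\<close> is replaced by \<open>c + z\<close>.
Differentiating with respect to one entry thus becomes the formal derivative of polynomials.
\<close>

definition perturb :: "nat \<Rightarrow> nat \<Rightarrow> 'a::comm_ring_1 \<Rightarrow> (nat \<Rightarrow> nat \<Rightarrow> 'a) \<Rightarrow> nat \<Rightarrow> nat \<Rightarrow> 'a poly" where
  "perturb r s c Y a b = (if a = r \<and> b = s then [:c, 1:] else [:Y a b:])"

lemma of_nat_double: "of_nat k * (2 * x) = of_nat (2 * k) * (x::'a::comm_ring_1)"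
  by (simp add: algebra_simps)

text \<open>
The partial derivative of \<open>tr (Y\<^sup>T Y)\<^sup>k\<close> with respect to the entry \<open>(r, s)\<close> is
\<open>2k (Y (Y\<^sup>T Y)\<^sup>k\<^sup>-\<^sup>1)\<^sub>r\<^sub>s\<close>; the two terms of the product rule agree because powers of a Gram matrix are
symmetric.
\<close>

lemma pderiv_fmat_trace_gram:
  fixes Y :: "nat \<Rightarrow> nat \<Rightarrow> 'a::{comm_ring_1,semiring_no_zero_divisors} poly"
  assumes rs: "r < p" "s < q" and DY: "\<And>a b. pderiv (Y a b) = (if a = r \<and> b = s then 1 else 0)"
  shows "pderiv (fmat_trace q (fmat_pow q (gram p Y) k)) = of_nat (2 * k) * fmat_mult q Y (fmat_pow q (gram p Y) (k - 1)) r s"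
proof -
  define H where "H = fmat_pow q (gram p Y) (k - 1)"
  have H: "H i j = H j i" if "i < q" "j < q" for i j
    unfolding H_def using that by (intro fmat_pow_sym gram_sym)
  have DG: "fmat_deriv (gram p Y) b c = (if b = s then Y r c else 0) + (if c = s then Y r b else 0)" for b c
  proof -
    have "fmat_deriv (gram p Y) b c = (\<Sum>a<p. (if a = r then (if b = s then Y r c else 0) else 0)) + (\<Sum>a<p. (if a = r then (if c = s then Y r b else 0) else 0))"
      unfolding fmat_deriv_def gram_def pderiv_sum pderiv_mult DY sum.distrib[symmetric]
      by (intro sum.cong refl) (auto split: if_splits)
    then show ?thesis using rs by (simp only: sum.delta) auto
  qed
  have "fmat_trace q (fmat_mult q (fmat_deriv (gram p Y)) H) = 
    (\<Sum>b<q. \<Sum>c<q. (if b = s then Y r c * H c b else 0)) + (\<Sum>b<q. \<Sum>c<q. if c = s then Y r b * H c b else 0)"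
    unfolding fmat_trace_def fmat_mult_def DG sum.distrib[symmetric] by (intro sum.cong refl) (auto simp: algebra_simps)
  also have "(\<Sum>b<q. \<Sum>c<q. (if b = s then Y r c * H c b else 0)) = (\<Sum>c<q. Y r c * H c s)"
    using rs by (subst sum.swap) simp
  also have "(\<Sum>b<q. \<Sum>c<q. if c = s then Y r b * H c b else 0) = (\<Sum>b<q. Y r b * H s b)"
    using rs by simp
  also have "(\<Sum>b<q. Y r b * H s b) = (\<Sum>b<q. Y r b * H b s)" using H rs by (intro sum.cong) auto
  also have "(\<Sum>c<q. Y r c * H c s) + (\<Sum>b<q. Y r b * H b s) = 2 * fmat_mult q Y H r s"
    unfolding fmat_mult_def by (rule mult_2[symmetric])
  finally have "fmat_trace q (fmat_mult q (fmat_deriv (gram p Y)) H) = 2 * fmat_mult q Y H r s" .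
  then show ?thesis unfolding pderiv_fmat_trace_pow H_def[symmetric]
    by (simp only: of_nat_double)
qed


lemma sum_PiE_insert:
  assumes "x \<notin> S"
  shows "(\<Sum>g\<in>PiE (insert x S) T. f g) = (\<Sum>y\<in>T x. \<Sum>g\<in>PiE S T. f (g(x := y)))"
  unfolding PiE_insert_eq
  by (subst sum.reindex[OF inj_combinator[OF assms]]) (simp add: sum.cartesian_product case_prod_beta')

text \<open>
Sums over index sequences are powers of the matrix. The weight \<open>h\<close> of the two end points is
arbitrary, so that the last step of a path can be absorbed into it; for \<open>h a b = G b a\<close> it closes
the path to a cycle.
\<close>

lemma path_sum:
  "(\<Sum>j\<in>{..<Suc k} \<rightarrow>\<^sub>E {..<n}. (\<Prod>t<k. G (j t) (j (Suc t))) * h (j 0) (j k)) = 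
   (\<Sum>a<n. \<Sum>b<n. fmat_pow n G k a b * h a b)"
proof (induction k arbitrary: h)
  case 0
  have "{..<Suc 0} = insert 0 {}" by auto
  then show ?case
    by (simp only: sum_PiE_insert PiE_empty_domain empty_iff not_False_eq_True) (simp add: if_distrib[of "\<lambda>x. x * _"] cong: if_cong)
next
  case (Suc k)
  have e: "{..<Suc (Suc k)} = insert (Suc k) {..<Suc k}" by auto
  have "(\<Sum>j\<in>{..<Suc (Suc k)} \<rightarrow>\<^sub>E {..<n}. (\<Prod>t<Suc k. G (j t) (j (Suc t))) * h (j 0) (j (Suc k))) =
    (\<Sum>c<n. \<Sum>j\<in>{..<Suc k} \<rightarrow>\<^sub>E {..<n}. (\<Prod>t<k. G (j t) (j (Suc t))) * (G (j k) c * h (j 0) c))"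
    unfolding e by (subst sum_PiE_insert) (auto simp: mult_ac intro!: sum.cong prod.cong)
  also have "\<dots> = (\<Sum>j\<in>{..<Suc k} \<rightarrow>\<^sub>E {..<n}. (\<Prod>t<k. G (j t) (j (Suc t))) * (\<Sum>c<n. G (j k) c * h (j 0) c))"
    by (subst sum.swap) (simp add: sum_distrib_left)
  also have "\<dots> = (\<Sum>a<n. \<Sum>b<n. fmat_pow n G k a b * (\<Sum>c<n. G b c * h a c))"
    by (rule Suc.IH)
  also have "\<dots> = (\<Sum>a<n. \<Sum>c<n. fmat_mult n (fmat_pow n G k) G a c * h a c)"
    unfolding fmat_mult_def sum_distrib_left sum_distrib_right by (subst (2) sum.swap) (simp add: mult.assoc)
  also have "\<dots> = (\<Sum>a<n. \<Sum>c<n. fmat_pow n G (Suc k) a c * h a c)"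
    by (intro sum.cong refl) (auto simp: fmat_pow_Suc_right simp del: fmat_pow.simps)
  finally show ?case .
qed

lemma closed_walk_sum:
  assumes "k > 0"
  shows "(\<Sum>j\<in>{..<k} \<rightarrow>\<^sub>E {..<n}. \<Prod>t<k. G (j t) (j (Suc t mod k))) = fmat_trace n (fmat_pow n G k)"
proof -
  obtain m where k: "k = Suc m" using assms by (cases k) auto
  have "(\<Prod>t<k. G (j t) (j (Suc t mod k))) = (\<Prod>t<m. G (j t) (j (Suc t))) * G (j m) (j 0)" for j
    unfolding k by simp
  then have "(\<Sum>j\<in>{..<k} \<rightarrow>\<^sub>E {..<n}. \<Prod>t<k. G (j t) (j (Suc t mod k))) = (\<Sum>a<n. \<Sum>b<n. fmat_pow n G m a b * G b a)"
    unfolding k by (simp only: path_sum[where h = "\<lambda>a b. G b a"])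
  also have "\<dots> = (\<Sum>a<n. fmat_mult n (fmat_pow n G m) G a a)" by (simp add: fmat_mult_def)
  also have "\<dots> = fmat_trace n (fmat_pow n G k)" 
    unfolding fmat_trace_def k by (intro sum.cong) (auto simp: fmat_pow_Suc_right simp del: fmat_pow.simps)
  finally show ?thesis .
qed

text \<open>
The statistic \<open>U\<^sub>k\<close> with every Hermite polynomial replaced by the power of the same degree.
\<close>

definition cycle_poly :: "nat \<Rightarrow> nat \<Rightarrow> nat \<Rightarrow> (nat \<Rightarrow> nat \<Rightarrow> 'a::comm_ring_1) \<Rightarrow> 'a" where
  "cycle_poly k p q Y = (\<Sum>i \<in> {..<k} \<rightarrow>\<^sub>E {..<p}. \<Sum>j \<in> {..<k} \<rightarrow>\<^sub>E {..<q}. 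
      \<Prod>r<p. \<Prod>s<q. Y r s ^ pair_count k i j r s)"

lemma prod_power_card:
  fixes Y :: "nat \<Rightarrow> nat \<Rightarrow> 'a::comm_ring_1" and k :: nat and u v :: "nat \<Rightarrow> nat"
  assumes "\<And>t. t < k \<Longrightarrow> u t < p" "\<And>t. t < k \<Longrightarrow> v t < q"
  shows "(\<Prod>r<p. \<Prod>s<q. Y r s ^ card {t. t < k \<and> (u t, v t) = (r, s)}) = (\<Prod>t<k. Y (u t) (v t))"
proof -
  have "(\<Prod>t<k. Y (u t) (v t)) = (\<Prod>x\<in>{..<p}\<times>{..<q}. \<Prod>t\<in>{t\<in>{..<k}. (u t, v t) = x}. Y (u t) (v t))"
    using assms by (intro prod.group[symmetric] finite_cartesian_product finite_lessThan image_subsetI SigmaI) auto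
  also have "\<dots> = (\<Prod>(r, s)\<in>{..<p}\<times>{..<q}. Y r s ^ card {t. t < k \<and> (u t, v t) = (r, s)})"
  proof (rule prod.cong[OF refl], clarify)
    fix r s
    have "(\<Prod>t\<in>{t\<in>{..<k}. (u t, v t) = (r, s)}. Y (u t) (v t)) = (\<Prod>t\<in>{t\<in>{..<k}. (u t, v t) = (r, s)}. Y r s)"
      by (rule prod.cong) (simp_all only: mem_Collect_eq prod.inject)
    then show "(\<Prod>t\<in>{t\<in>{..<k}. (u t, v t) = (r, s)}. Y (u t) (v t)) = Y r s ^ card {t. t < k \<and> (u t, v t) = (r, s)}"
      by (simp only: prod_constant lessThan_iff)
  qed
  also have "\<dots> = (\<Prod>r<p. \<Prod>s<q. Y r s ^ card {t. t < k \<and> (u t, v t) = (r, s)})"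
    by (rule prod.cartesian_product[symmetric])
  finally show ?thesis by (rule sym)
qed

text \<open>
Regrouping the product over matrix positions as a product over the \<open>2k\<close> steps of the walk
\<open>j\<^sub>1, i\<^sub>1, j\<^sub>2, i\<^sub>2, \<dots>\<close>, the sum over \<open>i\<close> produces entries of the Gram matrix and the sum over
\<open>j\<close> runs over closed walks.
\<close>

lemma cycle_poly_eq_trace:
  assumes "k > 0"
  shows "cycle_poly k p q Y = fmat_trace q (fmat_pow q (gram p Y) k)"
proof -
  have "cycle_poly k p q Y = (\<Sum>i \<in> {..<k} \<rightarrow>\<^sub>E {..<p}. \<Sum>j \<in> {..<k} \<rightarrow>\<^sub>E {..<q}. 
      \<Prod>t<k. Y (i t) (j t) * Y (i t) (j (Suc t mod k)))"
    unfolding cycle_poly_def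
  proof (intro sum.cong refl)
    fix i j assume ij: "i \<in> {..<k} \<rightarrow>\<^sub>E {..<p}" "j \<in> {..<k} \<rightarrow>\<^sub>E {..<q}"
    then have i: "i t < p" if "t < k" for t using that by (auto simp: PiE_iff)
    have j: "j t < q" if "t < k" for t using that ij by (auto simp: PiE_iff)
    have j': "j (Suc t mod k) < q" for t using j[of "Suc t mod k"] assms by simp
    show "(\<Prod>r<p. \<Prod>s<q. Y r s ^ pair_count k i j r s) = (\<Prod>t<k. Y (i t) (j t) * Y (i t) (j (Suc t mod k)))"
      unfolding pair_count_def power_add prod.distrib
      by (rule arg_cong2[where f = "(*)"]) (rule prod_power_card; use i j j' in blast)+
  qed
  also have "\<dots> = (\<Sum>j \<in> {..<k} \<rightarrow>\<^sub>E {..<q}. \<Sum>i \<in> {..<k} \<rightarrow>\<^sub>E {..<p}. 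
      \<Prod>t<k. Y (i t) (j t) * Y (i t) (j (Suc t mod k)))"
    by (rule sum.swap)
  also have "\<dots> = (\<Sum>j \<in> {..<k} \<rightarrow>\<^sub>E {..<q}. \<Prod>t<k. gram p Y (j t) (j (Suc t mod k)))"
    unfolding gram_def by (intro sum.cong refl prod_sum_PiE[symmetric] finite_lessThan)
  also have "\<dots> = fmat_trace q (fmat_pow q (gram p Y) k)"
    by (rule closed_walk_sum[OF assms])
  finally show ?thesis .
qed


section \<open>Singular values, traces of powers and the operator norm\<close>

lemma index_mult_mat_fmat:
  "M \<in> carrier_mat n n \<Longrightarrow> N \<in> carrier_mat n n \<Longrightarrow> i < n \<Longrightarrow> j < n \<Longrightarrow>
    (M * N) $$ (i, j) = fmat_mult n (\<lambda>i j. M $$ (i, j)) (\<lambda>i j. N $$ (i, j)) i j"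
  by (auto simp: fmat_mult_def scalar_prod_def lessThan_atLeast0 intro!: sum.cong)

lemma index_pow_mat:
  assumes "S \<in> carrier_mat n n" "i < n" "j < n"
  shows "(S ^\<^sub>m k) $$ (i, j) = fmat_pow n (\<lambda>i j. S $$ (i, j)) k i j"
  using assms(2,3)
proof (induction k arbitrary: i j)
  case 0
  then show ?case using assms(1) by simp
next
  case (Suc k)
  have "(S ^\<^sub>m Suc k) $$ (i, j) = fmat_mult n (\<lambda>i j. (S ^\<^sub>m k) $$ (i, j)) (\<lambda>i j. S $$ (i, j)) i j"
    using Suc.prems assms(1) by (subst pow_mat.simps, subst index_mult_mat_fmat[where n = n]) auto
  also have "\<dots> = fmat_mult n (fmat_pow n (\<lambda>i j. S $$ (i, j)) k) (\<lambda>i j. S $$ (i, j)) i j"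
    using Suc by (intro fmat_mult_cong) auto
  finally show ?case using Suc.prems by (simp only: fmat_pow_Suc_right)
qed

lemma fmat_pow_upper_triangular:
  assumes "\<And>i j. j < i \<Longrightarrow> i < n \<Longrightarrow> B i j = 0"
  shows "j < i \<Longrightarrow> i < n \<Longrightarrow> fmat_pow n B k i j = 0" and "i < n \<Longrightarrow> fmat_pow n B k i i = B i i ^ k"
proof -
  have tri: "fmat_pow n B k i j = 0" if "j < i" "i < n" for i j k
    using that
  proof (induction k arbitrary: i j)
    case (Suc k)
    have "B i l * fmat_pow n B k l j = 0" if "l < n" for l
      using Suc assms[of l i] that by (cases "l < i") auto
    then show ?case by (auto simp: fmat_mult_def intro!: sum.neutral)
  qed auto
  then show "j < i \<Longrightarrow> i < n \<Longrightarrow> fmat_pow n B k i j = 0" .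
  show "i < n \<Longrightarrow> fmat_pow n B k i i = B i i ^ k"
  proof (induction k)
    case (Suc k)
    have "(\<Sum>l<n. B i l * fmat_pow n B k l i) = (\<Sum>l\<in>{i}. B i l * fmat_pow n B k l i)"
    proof (rule sum.mono_neutral_right)
      show "\<forall>l\<in>{..<n} - {i}. B i l * fmat_pow n B k l i = 0"
      proof
        fix l assume "l \<in> {..<n} - {i}"
        then show "B i l * fmat_pow n B k l i = 0"
          using Suc.prems assms[of l i] tri[of i l k] by (cases "l < i") auto
      qed
    qed (use Suc.prems in auto)
    then show ?case using Suc by (simp add: fmat_mult_def)
  qed auto
qed

text \<open>
By the Schur decomposition the matrix is similar to an upper triangular one, whose powers have the
powers of the eigenvalues on the diagonal.
\<close>

lemma fmat_trace_pow_roots: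
  fixes S :: "real mat"
  assumes S: "S \<in> carrier_mat n n" and c: "char_poly S = (\<Prod>e\<leftarrow>es. [:- e, 1:])"
  shows "fmat_trace n (fmat_pow n (\<lambda>i j. S $$ (i, j)) k) = (\<Sum>e\<leftarrow>es. e ^ k)"
proof -
  obtain B P Q where "schur_decomposition S es = (B, P, Q)" by (cases "schur_decomposition S es") auto
  from schur_decomposition[OF S c this]
  have sim: "similar_mat_wit S B P Q" and B: "upper_triangular B" "diag_mat B = es" by auto
  from similar_mat_witD2[OF S sim] have car: "B \<in> carrier_mat n n" "P \<in> carrier_mat n n" "Q \<in> carrier_mat n n"
    and QP: "Q * P = 1\<^sub>m n" by auto
  let ?f = "\<lambda>M i j. M $$ (i, j) :: real"
  define Bk where "Bk = B ^\<^sub>m k"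
  have Bk: "Bk \<in> carrier_mat n n" using car by (simp add: Bk_def)
  have "S ^\<^sub>m k = P * Bk * Q" unfolding Bk_def by (rule similar_mat_wit_pow_id[OF sim])
  then have "fmat_trace n (fmat_pow n (?f S) k) = fmat_trace n (?f (P * Bk * Q))"
    using S by (intro fmat_trace_cong) (auto simp flip: index_pow_mat)
  also have "\<dots> = fmat_trace n (fmat_mult n (?f (P * Bk)) (?f Q))"
    using car Bk by (intro fmat_trace_cong index_mult_mat_fmat) auto
  also have "\<dots> = fmat_trace n (fmat_mult n (?f Q) (?f (P * Bk)))" by (rule fmat_trace_mult_commute)
  also have "\<dots> = fmat_trace n (?f (Q * (P * Bk)))"
    using car Bk by (intro fmat_trace_cong index_mult_mat_fmat[symmetric]) auto
  also have "Q * (P * Bk) = (Q * P) * Bk" using car Bk by (intro assoc_mult_mat[symmetric]) auto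
  also have "\<dots> = Bk" using Bk by (simp add: QP)
  also have "fmat_trace n (?f Bk) = (\<Sum>i<n. fmat_pow n (?f B) k i i)"
    using car by (auto simp: fmat_trace_def Bk_def index_pow_mat)
  also have "\<dots> = (\<Sum>i<n. B $$ (i, i) ^ k)"
    using B(1) car by (intro sum.cong refl fmat_pow_upper_triangular(2)) (auto simp: upper_triangular_def)
  also have "\<dots> = (\<Sum>e\<leftarrow>es. e ^ k)"
    using car by (auto simp: B(2)[symmetric] diag_mat_def o_def sum_list_sum_nth lessThan_atLeast0)
  finally show ?thesis .
qed

text \<open>
The complex characteristic polynomial splits. If \<open>v\<close> is an eigenvector for the eigenvalue \<open>e\<close>, then
\<open>e \<parallel>v\<parallel>\<^sup>2 = \<parallel>A v\<parallel>\<^sup>2\<close>, so \<open>e\<close> is real and nonnegative, and the splitting takes place over the reals.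
\<close>

lemma gram_mat_char_poly:
  fixes A :: "real mat"
  assumes A: "A \<in> carrier_mat p q"
  shows "\<exists>es. char_poly (transpose_mat A * A) = (\<Prod>e\<leftarrow>es. [:- e, 1:]) \<and> length es = q \<and> (\<forall>e\<in>set es. e \<ge> 0)"
proof -
  define S where "S = transpose_mat A * A"
  have S: "S \<in> carrier_mat q q" using A by (simp add: S_def)
  let ?h = "complex_of_real"
  interpret h: map_poly_inj_idom_hom ?h ..
  define C where "C = map_mat ?h S"
  have C: "C \<in> carrier_mat q q" using S by (simp add: C_def)
  obtain as where as: "char_poly C = (\<Prod>a\<leftarrow>as. [:- a, 1:])" "length as = q"
    using char_poly_factorized[OF C] by auto
  have real: "Im a = 0 \<and> Re a \<ge> 0" if "a \<in> set as" for a
  proof -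
    have "poly (char_poly C) a = 0" using that unfolding as by (auto simp: poly_prod_list_zero_iff)
    then have "eigenvalue C a" using eigenvalue_root_char_poly[OF C] by auto
    then obtain v where v: "v \<in> carrier_vec q" "v \<noteq> 0\<^sub>v q" "C *\<^sub>v v = a \<cdot>\<^sub>v v"
      using C by (auto simp: eigenvalue_def eigenvector_def)
    have Cv: "(\<Sum>j<q. (\<Sum>r<p. ?h (A $$ (r, i)) * ?h (A $$ (r, j))) * v $ j) = a * v $ i" if "i < q" for i
    proof -
      have "(C *\<^sub>v v) $ i = (\<Sum>j<q. C $$ (i, j) * v $ j)"
        using that C v(1) by (auto simp: scalar_prod_def lessThan_atLeast0 intro!: sum.cong)
      also have "\<dots> = (\<Sum>j<q. (\<Sum>r<p. ?h (A $$ (r, i)) * ?h (A $$ (r, j))) * v $ j)"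
        using that A by (auto simp: C_def S_def scalar_prod_def lessThan_atLeast0 intro!: sum.cong)
      finally show ?thesis using v(3,1) that by simp
    qed
    have "a * ?h (\<Sum>i<q. norm (v $ i) ^ 2) = (\<Sum>i<q. cnj (v $ i) * (a * v $ i))"
      by (simp only: of_real_sum complex_norm_square sum_distrib_left) (simp add: mult_ac)
    also have "\<dots> = (\<Sum>i<q. \<Sum>j<q. \<Sum>r<p. (?h (A $$ (r, i)) * cnj (v $ i)) * (?h (A $$ (r, j)) * v $ j))"
      by (intro sum.cong refl) (auto simp flip: Cv simp: sum_distrib_left sum_distrib_right mult_ac)
    also have "\<dots> = (\<Sum>i<q. \<Sum>r<p. \<Sum>j<q. (?h (A $$ (r, i)) * cnj (v $ i)) * (?h (A $$ (r, j)) * v $ j))"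
      by (intro sum.cong refl sum.swap)
    also have "\<dots> = (\<Sum>r<p. \<Sum>i<q. \<Sum>j<q. (?h (A $$ (r, i)) * cnj (v $ i)) * (?h (A $$ (r, j)) * v $ j))"
      by (rule sum.swap)
    also have "\<dots> = (\<Sum>r<p. cnj (\<Sum>i<q. ?h (A $$ (r, i)) * v $ i) * (\<Sum>j<q. ?h (A $$ (r, j)) * v $ j))"
      by (simp add: sum_product)
    also have "\<dots> = ?h (\<Sum>r<p. norm (\<Sum>i<q. ?h (A $$ (r, i)) * v $ i) ^ 2)"
      by (simp only: of_real_sum complex_norm_square) (simp add: mult.commute)
    finally have e: "a * ?h (\<Sum>i<q. norm (v $ i) ^ 2) = ?h (\<Sum>r<p. norm (\<Sum>i<q. ?h (A $$ (r, i)) * v $ i) ^ 2)" .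
    obtain i where "i < q" "v $ i \<noteq> 0" using v(1,2) by (metis eq_vecI carrier_vecD index_zero_vec)
    then have pos: "(\<Sum>i<q. norm (v $ i) ^ 2) > 0" by (intro sum_pos2[of _ i]) auto
    have "z = ?h (r / t)" if "z * ?h t = ?h r" "t > 0" for z r t
      using that by (simp add: field_simps)
    from this[OF e pos] have "a = ?h ((\<Sum>r<p. norm (\<Sum>i<q. ?h (A $$ (r, i)) * v $ i) ^ 2) / (\<Sum>i<q. norm (v $ i) ^ 2))" .
    then show ?thesis using pos by (auto intro!: divide_nonneg_pos sum_nonneg)
  qed
  define es where "es = map Re as"
  have as_es: "as = map ?h es"
    using real by (auto simp: es_def o_def complex_eq_iff intro!: nth_equalityI)
  have "map_poly ?h (char_poly S) = map_poly ?h (\<Prod>e\<leftarrow>es. [:- e, 1:])"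
    unfolding of_real_hom.char_poly_hom[OF S, symmetric] C_def[symmetric] as as_es
    by (simp add: h.hom_prod_list o_def)
  then have "char_poly S = (\<Prod>e\<leftarrow>es. [:- e, 1:])"
    by (rule h.injectivity)
  moreover have "length es = q" using as by (simp add: es_def)
  moreover have "\<forall>e\<in>set es. e \<ge> 0" using real by (auto simp: es_def)
  ultimately show ?thesis unfolding S_def by blast
qed

lemma singular_values_facts:
  fixes A :: "real mat"
  assumes A: "A \<in> carrier_mat p q" and q: "q > 0"
  defines "s \<equiv> singular_values A"
  shows "length s = q" "\<And>i. i < q \<Longrightarrow> 0 \<le> s ! i" "\<And>i. i < q \<Longrightarrow> s ! i \<le> singular_value 1 A"
    "nuclear_norm A = (\<Sum>i<q. s ! i)"
    "fmat_trace q (fmat_pow q (gram p (\<lambda>i j. A $$ (i, j))) k) = (\<Sum>i<q. (s ! i) ^ (2 * k))"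
proof -
  define S where "S = transpose_mat A * A"
  have S: "S \<in> carrier_mat q q" using A by (simp add: S_def)
  obtain es where es: "char_poly S = (\<Prod>e\<leftarrow>es. [:- e, 1:])" "length es = q" "\<And>e. e \<in> set es \<Longrightarrow> e \<ge> 0"
    using gram_mat_char_poly[OF A] unfolding S_def by blast
  have "proots (char_poly S) = (\<Sum>p\<leftarrow>map (\<lambda>e. [:- e, 1:]) es. proots p)"
    unfolding es by (subst proots_prod_list[of "map (\<lambda>e. [:- e, 1:]) es", simplified]) auto
  also have "\<dots> = mset es" by (induction es) auto
  finally have s: "s = rev (sorted_list_of_multiset (image_mset sqrt (mset es)))"
    by (simp add: s_def singular_values_def S_def)
  then have ms: "mset s = image_mset sqrt (mset es)" by simp
  then show len: "length s = q" using es(2) by (metis size_image_mset size_mset)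
  have set: "set s = sqrt ` set es" using ms by (metis set_image_mset set_mset_mset)
  show "0 \<le> s ! i" if "i < q" for i
    using nth_mem[of i s] that len set es(3) by auto
  have "sorted (rev s)" by (simp add: s)
  then show "s ! i \<le> singular_value 1 A" if "i < q" for i
    using that len sorted_rev_nth_mono[of s 0 i] unfolding singular_value_def s_def[symmetric] by simp
  show "nuclear_norm A = (\<Sum>i<q. s ! i)"
    using A unfolding nuclear_norm_def singular_value_def s_def[symmetric]
    by (intro sum.reindex_bij_witness[of _ Suc "\<lambda>i. i - 1"]) auto
  have "(\<Sum>i<q. (s ! i) ^ (2 * k)) = (\<Sum>x\<leftarrow>s. x ^ (2 * k))"
    by (simp add: sum_list_sum_nth len lessThan_atLeast0)
  also have "\<dots> = (\<Sum>x\<in>#mset s. x ^ (2 * k))" by (metis mset_map sum_mset_sum_list)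
  also have "\<dots> = (\<Sum>e\<in>#mset es. sqrt e ^ (2 * k))" unfolding ms by (simp add: image_mset.compositionality o_def)
  also have "\<dots> = (\<Sum>e\<in>#mset es. e ^ k)"
    using es(3) by (intro arg_cong[where f = sum_mset] image_mset_cong) (auto simp: power_mult)
  also have "\<dots> = (\<Sum>e\<leftarrow>es. e ^ k)" by (metis mset_map sum_mset_sum_list)
  also have "\<dots> = fmat_trace q (fmat_pow q (\<lambda>i j. S $$ (i, j)) k)"
    by (rule fmat_trace_pow_roots[OF S es(1), symmetric])
  also have "\<dots> = fmat_trace q (fmat_pow q (gram p (\<lambda>i j. A $$ (i, j))) k)"
  proof -
    have "S $$ (i, j) = gram p (\<lambda>i j. A $$ (i, j)) i j" if "i < q" "j < q" for i j
      using A that by (auto simp: S_def gram_def scalar_prod_def lessThan_atLeast0 intro!: sum.cong)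
    then have "fmat_pow q (\<lambda>i j. S $$ (i, j)) k i j = fmat_pow q (gram p (\<lambda>i j. A $$ (i, j))) k i j" if "i < q" "j < q" for i j
      using that by (induction k arbitrary: i j) (auto intro!: fmat_mult_cong)
    then show ?thesis by (intro fmat_trace_cong)
  qed
  finally show "fmat_trace q (fmat_pow q (gram p (\<lambda>i j. A $$ (i, j))) k) = (\<Sum>i<q. (s ! i) ^ (2 * k))" ..
qed

text \<open>
An operator norm bound without a spectral theorem. With \<open>G = Y\<^sup>T Y\<close>, Cauchy-Schwarz gives
\<open>(x \<bullet> G\<^sup>m x)\<^sup>2 \<le> \<parallel>x\<parallel>\<^sup>2 (x \<bullet> G\<^sup>2\<^sup>m x)\<close>; iterating it bounds a high power of \<open>x \<bullet> G x\<close> by the trace of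
the same power of \<open>G\<close>. The dimension \<open>q\<close> enters only through its root of that high order, which
is at most \<open>2\<close>.
\<close>

lemma gram_operator_bound:
  fixes Y :: "nat \<Rightarrow> nat \<Rightarrow> real"
  assumes traces: "\<And>n. fmat_trace q (fmat_pow q (gram p Y) n) \<le> real q * L ^ n" and L: "L \<ge> 0"
  shows "(\<Sum>a<p. (\<Sum>b<q. Y a b * x b)^2) \<le> 2 * L * (\<Sum>b<q. x b ^ 2)"
proof -
  define M where "M = fmat_pow q (gram p Y)"
  define X where "X = (\<Sum>b<q. x b ^ 2)"
  define y where "y m i = (\<Sum>j<q. M m i j * x j)" for m i
  define qv where "qv m = (\<Sum>i<q. x i * y m i)" for m
  have X0: "X \<ge> 0" by (simp add: X_def sum_nonneg)
  have sym: "M m i j = M m j i" if "i < q" "j < q" for m i j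
    unfolding M_def using that by (intro fmat_pow_sym gram_sym)
  have dbl: "(\<Sum>l<q. M m i l * M m l j) = M (2 * m) i j" if "i < q" for i j m
    using fmat_pow_add[OF that, of "gram p Y" m m j] by (simp add: M_def fmat_mult_def mult_2)
  have qv2: "qv (2 * m) = (\<Sum>i<q. (y m i)^2)" for m
  proof -
    have "(\<Sum>l<q. (y m l)^2) = (\<Sum>l<q. \<Sum>i<q. \<Sum>j<q. M m i l * M m l j * x i * x j)"
      unfolding y_def power2_eq_square sum_product
      by (intro sum.cong refl) (auto simp: sym mult_ac)
    also have "\<dots> = (\<Sum>i<q. \<Sum>l<q. \<Sum>j<q. M m i l * M m l j * x i * x j)" by (rule sum.swap)
    also have "\<dots> = (\<Sum>i<q. \<Sum>j<q. \<Sum>l<q. M m i l * M m l j * x i * x j)" by (intro sum.cong refl sum.swap)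
    also have "\<dots> = (\<Sum>i<q. \<Sum>j<q. M (2 * m) i j * x i * x j)"
      by (intro sum.cong refl) (auto simp: dbl simp flip: sum_distrib_right)
    also have "\<dots> = qv (2 * m)" by (simp add: qv_def y_def sum_distrib_left mult_ac)
    finally show ?thesis ..
  qed
  have step: "(qv m)^2 \<le> X * qv (2 * m)" for m
    unfolding qv2 X_def unfolding qv_def by (rule Cauchy_Schwarz_ineq_sum)
  have qv_nonneg: "qv (2 * m) \<ge> 0" for m unfolding qv2 by (simp add: sum_nonneg)
  have qv_trace: "qv (2 * m) \<le> X * (real q * L ^ (2 * m))" for m
  proof -
    have "qv (2 * m) \<le> (\<Sum>i<q. (\<Sum>j<q. (M m i j)^2) * X)"
      unfolding qv2 y_def X_def by (intro sum_mono Cauchy_Schwarz_ineq_sum)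
    also have "\<dots> = X * (\<Sum>i<q. \<Sum>j<q. M m i j * M m j i)"
      unfolding sum_distrib_right[symmetric] power2_eq_square by (subst mult.commute) (intro arg_cong2[where f = "(*)"] refl sum.cong, auto simp: sym)
    also have "(\<Sum>i<q. \<Sum>j<q. M m i j * M m j i) = fmat_trace q (M (2 * m))"
      by (simp add: fmat_trace_def dbl)
    also have "X * \<dots> \<le> X * (real q * L ^ (2 * m))"
      unfolding M_def by (intro mult_left_mono traces X0)
    finally show ?thesis .
  qed
  have qv1: "qv 1 = (\<Sum>a<p. (\<Sum>b<q. Y a b * x b)^2)"
  proof -
    have "qv 1 = (\<Sum>i<q. \<Sum>j<q. gram p Y i j * x j * x i)"
      by (simp add: qv_def y_def M_def sum_distrib_left mult_ac fmat_pow_1[unfolded fmat_pow.simps] del: fmat_pow.simps(2) cong: sum.cong)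
         (auto intro!: sum.cong simp: fmat_pow_1 simp del: fmat_pow.simps)
    also have "\<dots> = (\<Sum>i<q. \<Sum>j<q. \<Sum>a<p. (Y a i * x i) * (Y a j * x j))"
      by (simp add: gram_def sum_distrib_left sum_distrib_right mult_ac)
    also have "\<dots> = (\<Sum>i<q. \<Sum>a<p. \<Sum>j<q. (Y a i * x i) * (Y a j * x j))" by (intro sum.cong refl sum.swap)
    also have "\<dots> = (\<Sum>a<p. \<Sum>i<q. \<Sum>j<q. (Y a i * x i) * (Y a j * x j))" by (rule sum.swap)
    finally show ?thesis by (simp add: power2_eq_square sum_product)
  qed
  have q1: "qv 1 \<ge> 0" unfolding qv1 by (simp add: sum_nonneg)
  have iter: "qv 1 ^ (2 ^ Suc j) \<le> X ^ (2 ^ Suc j - 1) * qv (2 ^ Suc j)" for j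
  proof (induction j)
    case 0 then show ?case using step[of 1] by (simp add: power2_eq_square)
  next
    case (Suc j)
    have "qv 1 ^ (2 ^ Suc (Suc j)) = (qv 1 ^ (2 ^ Suc j))^2" by (simp add: power_mult[symmetric] mult.commute)
    also have "\<dots> \<le> (X ^ (2 ^ Suc j - 1) * qv (2 ^ Suc j))^2" using q1 by (intro power_mono Suc.IH) auto
    also have "\<dots> = X ^ (2 * (2 ^ Suc j - 1)) * (qv (2 ^ Suc j))^2"
      by (simp add: power_mult_distrib power_mult[symmetric] mult.commute)
    also have "\<dots> \<le> X ^ (2 * (2 ^ Suc j - 1)) * (X * qv (2 * 2 ^ Suc j))"
      using X0 by (intro mult_left_mono step) auto
    also have "\<dots> = X ^ Suc (2 * (2 ^ Suc j - 1)) * qv (2 ^ Suc (Suc j))" by simp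
    also have "Suc (2 * (2 ^ Suc j - 1)) = 2 ^ Suc (Suc j) - (1::nat)"
      using one_le_power[of "2::nat" "Suc j"] power_Suc[of "2::nat" "Suc j"] by linarith
    finally show ?case .
  qed
  \<comment> \<open>Any power of two that is large enough for \<open>q \<le> 2\<^sup>n\<close> will do.\<close>
  define n :: nat where "n = 2 ^ Suc q"
  have n: "real q \<le> 2 ^ n" "n > 0"
  proof -
    have "q < 2 ^ q" by (rule less_exp)
    also have "2 ^ q < n" unfolding n_def by simp
    also have "n < 2 ^ n" by (rule less_exp)
    finally have "real q < real (2 ^ n)" by (simp only: of_nat_less_iff)
    then show "real q \<le> 2 ^ n" by simp
  qed (simp add: n_def)
  have "qv 1 ^ n \<le> X ^ (n - 1) * qv n" unfolding n_def by (rule iter)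
  also have "\<dots> \<le> X ^ (n - 1) * (X * (real q * L ^ n))"
    using qv_trace[of "2 ^ q"] X0 by (intro mult_left_mono) (auto simp: n_def)
  also have "\<dots> = X ^ n * (real q * L ^ n)" using n by (cases n) auto
  also have "\<dots> \<le> X ^ n * (2 ^ n * L ^ n)" using n X0 L by (intro mult_left_mono mult_right_mono) auto
  also have "\<dots> = (2 * L * X) ^ n" by (simp add: power_mult_distrib mult_ac)
  finally have "qv 1 \<le> 2 * L * X" using n X0 L q1 by (subst (asm) power_mono_iff) auto
  then show ?thesis unfolding qv1 X_def .
qed


section \<open>Gaussian integrals in one variable\<close>

abbreviation std_gauss :: "real measure" where
  "std_gauss \<equiv> density lborel (\<lambda>x. ennreal (std_normal_density x))"

lemma prob_space_std_gauss: "prob_space std_gauss"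
  using prob_space_normal_density[of 1 0] by simp

interpretation std_gauss: prob_space std_gauss
  by (rule prob_space_std_gauss)

lemma integrable_std_gauss_monomial: "integrable std_gauss (\<lambda>x. x ^ n)"
  using integrable_std_normal_moment[of n] by (subst integrable_density) (auto simp: less_imp_le[OF normal_density_pos])

lemma integrable_std_gauss_poly:
  fixes P :: "complex poly"
  shows "integrable std_gauss (\<lambda>x. poly P (of_real x))"
  unfolding poly_altdef
  by (intro Bochner_Integration.integrable_sum integrable_mult_right)
     (simp add: integrable_std_gauss_monomial flip: of_real_power)

lemma std_gauss_moment: "(\<integral>x. x ^ n \<partial>std_gauss) = (\<integral>x. std_normal_density x * x ^ n \<partial>lborel)"
  by (subst integral_density) (auto simp: less_imp_le[OF normal_density_pos])

lemma std_gauss_moment_rec: "(\<integral>x. x ^ (n + 2) \<partial>std_gauss) = real (n + 1) * (\<integral>x. x ^ n \<partial>std_gauss)"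
proof (cases "even n")
  case True
  then obtain k where k: "n = 2 * k" by blast
  have e: "n + 2 = 2 * Suc k" using k by simp
  have f: "fact (2 * Suc k) = (2 * (real k + 1)) * ((2 * real k + 1) * fact (2 * k))" "fact (Suc k) = (real k + 1) * fact k"
    by (simp_all add: algebra_simps)
  have g: "c \<noteq> 0 \<Longrightarrow> (2 * c * (d * g)) / ((2 * h) * (c * l)) = d * (g / (h * l))" for c d g h l :: real
    by simp
  show ?thesis
    unfolding std_gauss_moment e unfolding k integral_std_normal_moment_even f power_Suc
    by (subst g; simp)
next
  case False
  then obtain k where k: "n = 2 * k + 1" by (metis oddE)
  have "n + 2 = 2 * Suc k + 1" using k by simp
  then show ?thesis
    unfolding std_gauss_moment by (simp only: k integral_std_normal_moment_odd)
qed

lemma std_gauss_Stein_monomial: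
  "(\<integral>x. x * x ^ n \<partial>std_gauss) = real n * (\<integral>x. x ^ (n - 1) \<partial>std_gauss)"
proof (cases n)
  case 0
  have "(\<integral>x. x ^ (2 * 0 + 1) \<partial>std_gauss) = 0"
    unfolding std_gauss_moment by (rule integral_std_normal_moment_odd)
  with 0 show ?thesis by simp
next
  case (Suc m)
  then show ?thesis using std_gauss_moment_rec[of m] by (simp add: algebra_simps)
qed

text \<open>
Gaussian integration by parts, deduced from the recursion of the moments. It drives both the
recursion of the Hermite polynomials and the complex moments below.
\<close>

lemma std_gauss_Stein:
  fixes P :: "complex poly"
  shows "(\<integral>x. of_real x * poly P (of_real x) \<partial>std_gauss) = (\<integral>x. poly (pderiv P) (of_real x) \<partial>std_gauss)"
proof -
  define d where "d = degree P"
  have int: "integrable std_gauss (\<lambda>x. (of_real x :: complex) ^ n)" for n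
    by (simp add: integrable_std_gauss_monomial flip: of_real_power)
  have "(\<integral>x. of_real x * poly P (of_real x) \<partial>std_gauss) = 
    (\<integral>x. (\<Sum>i\<le>d. Polynomial.coeff P i * of_real x ^ Suc i) \<partial>std_gauss)"
    unfolding d_def by (simp add: poly_altdef sum_distrib_left mult_ac)
  also have "\<dots> = (\<Sum>i\<le>d. Polynomial.coeff P i * (\<integral>x. of_real x ^ Suc i \<partial>std_gauss))"
    by (simp only: Bochner_Integration.integral_sum[OF integrable_mult_right[OF int]] integral_mult_right_zero)
  also have "\<dots> = (\<Sum>i\<le>d. Polynomial.coeff P i * (of_nat i * (\<integral>x. of_real x ^ (i - 1) \<partial>std_gauss)))"
  proof (intro sum.cong refl)
    fix i
    have "(\<integral>x. (of_real x :: complex) ^ Suc i \<partial>std_gauss) = of_real (\<integral>x. x * x ^ i \<partial>std_gauss)"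
      by (simp flip: of_real_power of_real_mult)
    also have "\<dots> = of_nat i * of_real (\<integral>x. x ^ (i - 1) \<partial>std_gauss)"
      by (simp add: std_gauss_Stein_monomial)
    finally show "Polynomial.coeff P i * (\<integral>x. of_real x ^ Suc i \<partial>std_gauss) =
      Polynomial.coeff P i * (of_nat i * (\<integral>x. of_real x ^ (i - 1) \<partial>std_gauss))"
      by (simp flip: of_real_power)
  qed
  also have "\<dots> = (\<integral>x. (\<Sum>i\<le>d. Polynomial.coeff P i * (of_nat i * of_real x ^ (i - 1))) \<partial>std_gauss)"
    by (subst Bochner_Integration.integral_sum) (auto intro!: int integrable_mult_right)
  also have "(\<lambda>x. (\<Sum>i\<le>d. Polynomial.coeff P i * (of_nat i * of_real x ^ (i - 1)))) = (\<lambda>x. poly (pderiv P) (of_real x :: complex))"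
  proof
    fix x :: real
    have "poly (pderiv P) (of_real x :: complex) = (\<Sum>i\<le>d. Polynomial.coeff (pderiv P) i * of_real x ^ i)"
      unfolding poly_altdef d_def
      by (rule sum.mono_neutral_left) (auto simp: degree_pderiv coeff_eq_0)
    also have "\<dots> = (\<Sum>i<Suc d. Polynomial.coeff P (Suc i) * (of_nat (Suc i) * of_real x ^ i))"
      by (simp add: coeff_pderiv lessThan_Suc_atMost mult_ac)
    also have "\<dots> = (\<Sum>i<Suc (Suc d). Polynomial.coeff P i * (of_nat i * of_real x ^ (i - 1)))"
      by (subst (2) sum.lessThan_Suc_shift) simp
    also have "\<dots> = (\<Sum>i\<le>d. Polynomial.coeff P i * (of_nat i * of_real x ^ (i - 1)))"
      by (simp add: lessThan_Suc_atMost d_def coeff_eq_0)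
    finally show "(\<Sum>i\<le>d. Polynomial.coeff P i * (of_nat i * of_real x ^ (i - 1))) = poly (pderiv P) (of_real x :: complex)" ..
  qed
  finally show ?thesis .
qed


fun hermite_poly :: "nat \<Rightarrow> real poly" where
  "hermite_poly 0 = 1"
| "hermite_poly (Suc n) = pCons 0 (hermite_poly n) - pderiv (hermite_poly n)"

lemma hermite_eq_poly: "hermite n = poly (hermite_poly n)"
proof -
  have ne: "std_normal_density y \<noteq> (0 :: real)" for y
    using normal_density_pos[of 1 0 y] by simp
  have "(deriv ^^ n) std_normal_density = (\<lambda>y. (-1) ^ n * poly (hermite_poly n) y * std_normal_density y)"
  proof (induction n)
    case (Suc n)
    have D: "((\<lambda>y. (-1) ^ n * poly (hermite_poly n) y * std_normal_density y) has_real_derivative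
            (-1) ^ Suc n * poly (hermite_poly (Suc n)) y * std_normal_density y) (at y)" for y
    proof -
      have "(std_normal_density has_real_derivative - y * std_normal_density y) (at y)"
        unfolding std_normal_density_def[abs_def]
        by (rule derivative_eq_intros refl | simp)+
      then show ?thesis
        by (auto intro!: derivative_eq_intros poly_DERIV simp: algebra_simps)
    qed
    then show ?case by (auto simp: Suc.IH fun_eq_iff intro!: DERIV_imp_deriv)
  qed auto
  then show ?thesis using ne by (auto simp: hermite_def fun_eq_iff simp flip: power_add mult_2)
qed

lemma pderiv_hermite_poly: "pderiv (hermite_poly (Suc n)) = Polynomial.smult (of_nat (Suc n)) (hermite_poly n)"
proof (induction n)
  case (Suc n)
  have "pderiv (hermite_poly (Suc (Suc n))) = 
     hermite_poly (Suc n) + pCons 0 (pderiv (hermite_poly (Suc n))) - pderiv (pderiv (hermite_poly (Suc n)))"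
    by (simp add: pderiv_diff pderiv_pCons)
  also have "\<dots> = hermite_poly (Suc n) + Polynomial.smult (of_nat (Suc n)) (hermite_poly (Suc n))"
    unfolding Suc.IH by (simp add: pderiv_smult smult_diff_right)
  also have "\<dots> = Polynomial.smult (of_nat (Suc (Suc n))) (hermite_poly (Suc n))"
    by (metis smult_add_left smult_1_left of_nat_Suc)
  finally show ?case .
qed (simp add: pderiv_pCons)

lemma hermite_Suc_Suc: "hermite (Suc (Suc n)) x = x * hermite (Suc n) x - real (Suc n) * hermite n x"
  unfolding hermite_eq_poly by (subst hermite_poly.simps(2)) (simp only: pderiv_hermite_poly, simp)

text \<open>
By integration by parts the right-hand side satisfies the three-term recursion of the Hermite
polynomials.
\<close>

lemma hermite_integral: "complex_of_real (hermite n x) = (\<integral>y. (of_real x + \<i> * of_real y) ^ n \<partial>std_gauss)"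
proof -
  define h where "h n = (\<integral>y. (of_real x + \<i> * of_real y) ^ n \<partial>std_gauss)" for n
  define P where "P = [:complex_of_real x, \<i>:]"
  have P: "(of_real x + \<i> * of_real y) ^ n = poly (P ^ n) (of_real y)" for n y
    by (simp add: P_def mult.commute)
  have rec: "h (Suc n) = of_real x * h n - of_nat n * h (n - 1)" for n
  proof -
    have "h (Suc n) = (\<integral>y. of_real x * poly (P ^ n) (of_real y) + \<i> * (of_real y * poly (P ^ n) (of_real y)) \<partial>std_gauss)"
      unfolding h_def P power_Suc poly_mult by (simp add: P_def algebra_simps)
    also have "\<dots> = of_real x * h n + \<i> * (\<integral>y. of_real y * poly (P ^ n) (of_real y) \<partial>std_gauss)"
    proof (subst Bochner_Integration.integral_add)
      show "integrable std_gauss (\<lambda>y. of_real x * poly (P ^ n) (of_real y))"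
        by (intro integrable_mult_right integrable_std_gauss_poly)
      show "integrable std_gauss (\<lambda>y. \<i> * (of_real y * poly (P ^ n) (of_real y)))"
        using integrable_std_gauss_poly[of "pCons 0 (P ^ n)"] by (intro integrable_mult_right) simp
    qed (simp add: h_def P)
    also have "(\<integral>y. of_real y * poly (P ^ n) (of_real y) \<partial>std_gauss) = (\<integral>y. \<i> * of_nat n * poly (P ^ (n - 1)) (of_real y) \<partial>std_gauss)"
    proof -
      have "pderiv P = [:\<i>:]" by (simp add: P_def pderiv_pCons)
      then show ?thesis unfolding std_gauss_Stein by (simp add: pderiv_power mult_ac)
    qed
    also have "\<dots> = \<i> * of_nat n * h (n - 1)" by (simp add: h_def P)
    finally show ?thesis by (simp add: algebra_simps)
  qed
  have "complex_of_real (hermite n x) = h n \<and> complex_of_real (hermite (Suc n) x) = h (Suc n)"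
  proof (induction n)
    case 0
    have "h 0 = 1" using std_gauss.prob_space by (simp add: h_def)
    then show ?case using rec[of 0] by (simp add: hermite_eq_poly)
  next
    case (Suc n)
    then show ?case using rec[of "Suc n"] by (simp add: hermite_Suc_Suc)
  qed
  then show ?thesis by (simp add: h_def)
qed


lemma measurable_cnj [measurable]: "cnj \<in> borel_measurable borel"
  by (intro borel_measurable_continuous_onI continuous_intros)

text \<open>
The law of \<open>x + \<i> y\<close> for independent standard normal \<open>x\<close> and \<open>y\<close>; the mean of \<open>\<bar>w\<bar>\<^sup>2\<close> is \<open>2\<close>.
\<close>

definition cgauss :: "complex measure" where
  "cgauss = distr (std_gauss \<Otimes>\<^sub>M std_gauss) borel (\<lambda>(x, y). Complex x y)"

lemma measurable_Complex [measurable]: "(\<lambda>(x, y). Complex x y) \<in> borel_measurable (std_gauss \<Otimes>\<^sub>M std_gauss)"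
proof -
  have "(\<lambda>z::real\<times>real. Complex (fst z) (snd z)) = (\<lambda>z. of_real (fst z) + \<i> * of_real (snd z))"
    by (auto simp: complex_eq_iff)
  moreover have "(\<lambda>z::real\<times>real. of_real (fst z) + \<i> * of_real (snd z) :: complex) \<in> borel_measurable (std_gauss \<Otimes>\<^sub>M std_gauss)"
    by measurable
  ultimately show ?thesis by (simp add: case_prod_beta')
qed

lemma sets_cgauss [measurable_cong, simp]: "sets cgauss = sets borel" by (simp add: cgauss_def)

lemma space_cgauss [simp]: "space cgauss = UNIV" by (simp add: cgauss_def)

interpretation std_gauss2: pair_prob_space std_gauss std_gauss
  by unfold_locales

lemma prob_space_cgauss: "prob_space cgauss"
  unfolding cgauss_def by (rule std_gauss2.prob_space_distr) measurable

interpretation cgauss: prob_space cgauss by (rule prob_space_cgauss)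

lemma nn_integral_cgauss:
  assumes [measurable]: "f \<in> borel_measurable borel"
  shows "(\<integral>\<^sup>+w. f w \<partial>cgauss) = (\<integral>\<^sup>+x. \<integral>\<^sup>+y. f (Complex x y) \<partial>std_gauss \<partial>std_gauss)"
proof -
  have [measurable]: "(\<lambda>(x,y). f (Complex x y)) \<in> borel_measurable (std_gauss \<Otimes>\<^sub>M std_gauss)"
    using measurable_compose[OF measurable_Complex assms] by (simp add: case_prod_beta')
  show ?thesis unfolding cgauss_def
    by (subst nn_integral_distr) (auto simp: case_prod_beta' std_gauss.nn_integral_fst[symmetric])
qed

lemma nn_integral_std_gauss_even_finite: "(\<integral>\<^sup>+x. ennreal (x ^ (2*n)) \<partial>std_gauss) < \<infinity>"
proof -
  have "(\<integral>\<^sup>+x. ennreal (x ^ (2*n)) \<partial>std_gauss) = ennreal (\<integral>x. x ^ (2*n) \<partial>std_gauss)"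
    by (rule nn_integral_eq_integral) (auto intro: integrable_std_gauss_monomial)
  then show ?thesis by simp
qed

lemma integrable_cgauss_norm_pow: "integrable cgauss (\<lambda>w. norm w ^ n)"
proof -
  have b: "norm (Complex x y) ^ n \<le> 1 + 2 ^ n * (x ^ (2 * n) + y ^ (2 * n))" for x y
  proof -
    have "norm (Complex x y) ^ n \<le> 1 + (norm (Complex x y) ^ n)^2"
      using sum_squares_bound[of "norm (Complex x y) ^ n" 1] zero_le_power[of "norm (Complex x y)" n]
      by (smt (verit) norm_ge_zero one_power2 power2_eq_square mult_1_right)
    also have "(norm (Complex x y) ^ n)^2 = (x^2 + y^2) ^ n"
      by (simp add: complex_norm flip: power_mult) (metis mult.commute power_mult real_sqrt_pow2 sum_power2_ge_zero)
    also have "\<dots> \<le> (2 * max (x^2) (y^2)) ^ n" by (intro power_mono) auto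
    also have "\<dots> = 2 ^ n * max (x^2) (y^2) ^ n" by (simp add: power_mult_distrib)
    also have "max (x^2) (y^2) ^ n \<le> x ^ (2 * n) + y ^ (2 * n)"
      by (auto simp: max_def power_mult)
    finally show ?thesis by simp
  qed
  have "(\<integral>\<^sup>+w. ennreal (norm w ^ n) \<partial>cgauss) = (\<integral>\<^sup>+x. \<integral>\<^sup>+y. ennreal (norm (Complex x y) ^ n) \<partial>std_gauss \<partial>std_gauss)"
    by (rule nn_integral_cgauss) measurable
  also have "\<dots> \<le> (\<integral>\<^sup>+x. \<integral>\<^sup>+y. ennreal (1 + 2 ^ n * (x ^ (2 * n) + y ^ (2 * n))) \<partial>std_gauss \<partial>std_gauss)"
    by (intro nn_integral_mono ennreal_leI b)
  also have "\<dots> = 1 + 2 ^ n * ((\<integral>\<^sup>+x. ennreal (x ^ (2*n)) \<partial>std_gauss) + (\<integral>\<^sup>+x. ennreal (x ^ (2*n)) \<partial>std_gauss))"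
    using std_gauss.emeasure_space_1
    by (simp add: ennreal_plus ennreal_mult' nn_integral_add nn_integral_cmult flip: ennreal_power)
  also have "\<dots> < \<infinity>" using nn_integral_std_gauss_even_finite[of n]
    by (simp add: ennreal_mult_less_top power_less_top_ennreal)
  finally show ?thesis
    by (intro integrableI_nonneg) auto
qed

lemma integral_cgauss_fst:
  fixes f :: "complex \<Rightarrow> complex"
  assumes "integrable cgauss f"
  shows "(\<integral>w. f w \<partial>cgauss) = (\<integral>x. \<integral>y. f (Complex x y) \<partial>std_gauss \<partial>std_gauss)"
    and "(\<integral>w. f w \<partial>cgauss) = (\<integral>y. \<integral>x. f (Complex x y) \<partial>std_gauss \<partial>std_gauss)"
proof -
  have [measurable]: "f \<in> borel_measurable borel" using assms by (simp add: cgauss_def)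
  have int: "integrable (std_gauss \<Otimes>\<^sub>M std_gauss) (\<lambda>z. f (Complex (fst z) (snd z)))"
    using assms unfolding cgauss_def by (subst (asm) integrable_distr_eq) (auto simp: case_prod_beta')
  have int': "integrable (std_gauss \<Otimes>\<^sub>M std_gauss) (\<lambda>(x, y). f (Complex x y))"
    using int by (simp add: case_prod_beta')
  have e: "(\<integral>w. f w \<partial>cgauss) = (\<integral>z. f (Complex (fst z) (snd z)) \<partial>(std_gauss \<Otimes>\<^sub>M std_gauss))"
    unfolding cgauss_def by (subst integral_distr) (auto simp: case_prod_beta')
  show "(\<integral>w. f w \<partial>cgauss) = (\<integral>x. \<integral>y. f (Complex x y) \<partial>std_gauss \<partial>std_gauss)"
    unfolding e using std_gauss2.integral_fst'[OF int] by simp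
  show "(\<integral>w. f w \<partial>cgauss) = (\<integral>y. \<integral>x. f (Complex x y) \<partial>std_gauss \<partial>std_gauss)"
    unfolding e using std_gauss2.integral_snd[OF int'] by (simp add: case_prod_beta')
qed

lemma integrable_cgauss_monomial: "integrable cgauss (\<lambda>w. w ^ m * cnj w ^ n)"
  by (rule Bochner_Integration.integrable_bound[OF integrable_cgauss_norm_pow[of "m + n"]])
     (auto simp: norm_mult norm_power power_add measurable_def[of cgauss] cong: measurable_cong_sets)

text \<open>
Integration by parts in both real coordinates: the operator \<open>\<partial>\<^sub>x + \<i> \<partial>\<^sub>y\<close> that corresponds to
multiplication by \<open>w = x + \<i> y\<close> annihilates the powers of \<open>w\<close> and differentiates those of the
conjugate.
\<close>

lemma cgauss_moments:
  "(\<integral>w. w ^ m * cnj w ^ n \<partial>cgauss) = (if m = n then 2 ^ n * fact n else 0)"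
proof -
  define M where "M m n = (\<integral>w. w ^ m * cnj w ^ n \<partial>cgauss)" for m n
  have rec: "M (Suc m) n = 2 * of_nat n * M m (n - 1)" for m n
  proof -
    define F where "F w = w ^ m * cnj w ^ n" for w
    define F1 where "F1 w = of_nat m * (w ^ (m - 1) * cnj w ^ n)" for w
    define F2 where "F2 w = of_nat n * (w ^ m * cnj w ^ (n - 1))" for w
    have intF: "integrable cgauss F1" "integrable cgauss F2"
      unfolding F1_def F2_def by (intro integrable_mult_right integrable_cgauss_monomial)+
    have ri: "of_real (Re w) = (w + cnj w) / 2" "of_real (Im w) = (w - cnj w) / (2 * \<i>)" for w
      by (auto simp: complex_eq_iff)
    have intR: "integrable cgauss (\<lambda>w. of_real (Re w) * F w)" 
    proof -
      have "(\<lambda>w. of_real (Re w) * F w) = (\<lambda>w. (w ^ Suc m * cnj w ^ n + w ^ m * cnj w ^ Suc n) / 2)"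
        by (auto simp: F_def ri algebra_simps)
      then show ?thesis
        by (simp only:) (intro integrable_divide_zero Bochner_Integration.integrable_add integrable_cgauss_monomial)
    qed
    have intI: "integrable cgauss (\<lambda>w. of_real (Im w) * F w)" 
    proof -
      have "(\<lambda>w. of_real (Im w) * F w) = (\<lambda>w. (w ^ Suc m * cnj w ^ n - w ^ m * cnj w ^ Suc n) / (2 * \<i>))"
        by (auto simp: F_def ri algebra_simps)
      then show ?thesis
        by (simp only:) (intro integrable_divide_zero Bochner_Integration.integrable_diff integrable_cgauss_monomial)
    qed
    have X: "(\<integral>w. of_real (Re w) * F w \<partial>cgauss) = (\<integral>w. F1 w + F2 w \<partial>cgauss)"
    proof -
      define P where "P y = [:\<i> * of_real y, 1:] ^ m * [:- \<i> * of_real y, 1:] ^ n" for y :: real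
      have 1: "F (Complex x y) = poly (P y) (of_real x)" for x y
        by (simp add: F_def P_def Complex_eq algebra_simps)
      have 2: "F1 (Complex x y) + F2 (Complex x y) = poly (pderiv (P y)) (of_real x)" for x y
        by (simp add: F1_def F2_def P_def pderiv_mult pderiv_power pderiv_pCons Complex_eq algebra_simps)
      have "(\<integral>w. of_real (Re w) * F w \<partial>cgauss) = (\<integral>y. \<integral>x. of_real x * poly (P y) (of_real x) \<partial>std_gauss \<partial>std_gauss)"
        by (subst integral_cgauss_fst(2)[OF intR]) (simp add: 1)
      also have "\<dots> = (\<integral>y. \<integral>x. F1 (Complex x y) + F2 (Complex x y) \<partial>std_gauss \<partial>std_gauss)"
        unfolding std_gauss_Stein 2 ..
      also have "\<dots> = (\<integral>w. F1 w + F2 w \<partial>cgauss)"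
        using intF by (subst integral_cgauss_fst(2)) auto
      finally show ?thesis .
    qed
    have Y: "(\<integral>w. of_real (Im w) * F w \<partial>cgauss) = (\<integral>w. \<i> * F1 w - \<i> * F2 w \<partial>cgauss)"
    proof -
      define P where "P x = [:of_real x, \<i>:] ^ m * [:of_real x, - \<i>:] ^ n" for x :: real
      have 1: "F (Complex x y) = poly (P x) (of_real y)" for x y
        by (simp add: F_def P_def Complex_eq algebra_simps)
      have 2: "\<i> * F1 (Complex x y) - \<i> * F2 (Complex x y) = poly (pderiv (P x)) (of_real y)" for x y
        by (simp add: F1_def F2_def P_def pderiv_mult pderiv_power pderiv_pCons Complex_eq algebra_simps)
      have "(\<integral>w. of_real (Im w) * F w \<partial>cgauss) = (\<integral>x. \<integral>y. of_real y * poly (P x) (of_real y) \<partial>std_gauss \<partial>std_gauss)"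
        by (subst integral_cgauss_fst(1)[OF intI]) (simp add: 1)
      also have "\<dots> = (\<integral>x. \<integral>y. \<i> * F1 (Complex x y) - \<i> * F2 (Complex x y) \<partial>std_gauss \<partial>std_gauss)"
        unfolding std_gauss_Stein 2 ..
      also have "\<dots> = (\<integral>w. \<i> * F1 w - \<i> * F2 w \<partial>cgauss)"
        using intF by (subst integral_cgauss_fst(1)) auto
      finally show ?thesis .
    qed
    have "M (Suc m) n = (\<integral>w. of_real (Re w) * F w + \<i> * (of_real (Im w) * F w) \<partial>cgauss)"
    proof -
      have "w ^ Suc m * cnj w ^ n = of_real (Re w) * F w + \<i> * (of_real (Im w) * F w)" for w
      proof -
        have "w ^ Suc m * cnj w ^ n = (of_real (Re w) + \<i> * of_real (Im w)) * F w"
          by (simp add: F_def flip: complex_eq)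
        then show ?thesis by (simp add: algebra_simps)
      qed
      then show ?thesis by (simp add: M_def)
    qed
    also have "\<dots> = (\<integral>w. F1 w + F2 w \<partial>cgauss) + \<i> * (\<integral>w. \<i> * F1 w - \<i> * F2 w \<partial>cgauss)"
      using intR intI by (subst Bochner_Integration.integral_add) (auto simp: X Y)
    also have "\<dots> = 2 * (\<integral>w. F2 w \<partial>cgauss)"
      using intF by (simp add: algebra_simps)
    finally show ?thesis by (simp add: F2_def M_def)
  qed
  have cnj_M: "M m n = cnj (M n m)" for m n
    using Bochner_Integration.integral_cnj[of cgauss "\<lambda>w. w ^ n * cnj w ^ m"] by (simp add: M_def mult.commute)
  have "M m n = (if m = n then 2 ^ n * fact n else 0)"
  proof (induction m arbitrary: n)
    case 0
    show ?case
    proof (cases n)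
      case 0
      then show ?thesis using cgauss.prob_space by (simp add: M_def)
    next
      case (Suc k)
      then show ?thesis using rec[of k 0] by (subst cnj_M) simp
    qed
  next
    case (Suc m)
    then show ?case by (cases n) (auto simp: rec algebra_simps)
  qed
  then show ?thesis by (simp add: M_def)
qed

text \<open>
The monomials are orthogonal, so the squared norm of an analytic polynomial is diagonal in its
coefficients.
\<close>

lemma nn_integral_cgauss_poly:
  "(\<integral>\<^sup>+w. ennreal (norm (poly g w) ^ 2) \<partial>cgauss) = 
   ennreal (\<Sum>n\<le>degree g. norm (Polynomial.coeff g n) ^ 2 * (2 ^ n * fact n))"
proof -
  define d where "d = degree g"
  define c where "c = Polynomial.coeff g"
  have e: "of_real (norm (poly g w) ^ 2) = (\<Sum>m\<le>d. \<Sum>n\<le>d. (c m * cnj (c n)) * (w ^ m * cnj w ^ n))" for w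
    unfolding complex_norm_square poly_altdef d_def[symmetric] c_def[symmetric]
    by (simp add: sum_product mult_ac)
  have int: "integrable cgauss (\<lambda>w. complex_of_real (norm (poly g w) ^ 2))"
    unfolding e by (intro Bochner_Integration.integrable_sum integrable_mult_right integrable_cgauss_monomial)
  have "complex_of_real (\<integral>w. norm (poly g w) ^ 2 \<partial>cgauss) = (\<integral>w. of_real (norm (poly g w) ^ 2) \<partial>cgauss)"
    by (rule integral_complex_of_real[symmetric])
  also have "\<dots> = (\<Sum>m\<le>d. \<Sum>n\<le>d. (c m * cnj (c n)) * (\<integral>w. w ^ m * cnj w ^ n \<partial>cgauss))"
    unfolding e by (simp add: Bochner_Integration.integral_sum Bochner_Integration.integrable_sum integrable_mult_right integrable_cgauss_monomial)
  also have "\<dots> = (\<Sum>m\<le>d. (c m * cnj (c m)) * (2 ^ m * fact m))"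
    unfolding cgauss_moments by (simp add: if_distrib[of "\<lambda>x. _ * x"] sum.delta' cong: if_cong)
  also have "\<dots> = of_real (\<Sum>m\<le>d. norm (c m) ^ 2 * (2 ^ m * fact m))"
    by (simp only: of_real_sum of_real_mult complex_norm_square) simp
  finally have "(\<integral>w. norm (poly g w) ^ 2 \<partial>cgauss) = (\<Sum>m\<le>d. norm (c m) ^ 2 * (2 ^ m * fact m))"
    by (simp only: of_real_eq_iff)
  moreover have "(\<integral>\<^sup>+w. ennreal (norm (poly g w) ^ 2) \<partial>cgauss) = ennreal (\<integral>w. norm (poly g w) ^ 2 \<partial>cgauss)"
    using int by (intro nn_integral_eq_integral) (auto simp only: complex_of_real_integrable_eq, auto)
  ultimately show ?thesis by (simp add: c_def d_def)
qed

text \<open>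
The constant term is one of the orthogonal components.
\<close>

lemma cgauss_mean_value:
  "ennreal (norm (poly g 0) ^ 2) \<le> (\<integral>\<^sup>+w. ennreal (norm (poly g w) ^ 2) \<partial>cgauss)"
proof -
  have "norm (poly g 0) ^ 2 = (\<Sum>n\<in>{0}. norm (Polynomial.coeff g n) ^ 2 * (2 ^ n * fact n))"
    by (simp add: poly_0_coeff_0)
  also have "\<dots> \<le> (\<Sum>n\<le>degree g. norm (Polynomial.coeff g n) ^ 2 * (2 ^ n * fact n))"
    by (rule sum_mono2) auto
  finally show ?thesis unfolding nn_integral_cgauss_poly by (rule ennreal_leI)
qed

text \<open>
In terms of the coefficients, differentiation multiplies the weight of the term of degree \<open>n\<close> by
\<open>n / 2\<close>, which is at least \<open>1 / 2\<close> for every nonconstant term.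
\<close>

lemma cgauss_Poincare:
  "(\<integral>\<^sup>+w. ennreal (norm (poly g w) ^ 2) \<partial>cgauss) \<le> 
    ennreal (norm (poly g 0) ^ 2) + 2 * (\<integral>\<^sup>+w. ennreal (norm (poly (pderiv g) w) ^ 2) \<partial>cgauss)"
proof -
  define d where "d = degree g"
  define c where "c = Polynomial.coeff g"
  have "(\<Sum>n\<le>d. norm (c n) ^ 2 * (2 ^ n * fact n)) = norm (c 0) ^ 2 + (\<Sum>n<d. norm (c (Suc n)) ^ 2 * (2 ^ Suc n * fact (Suc n)))"
    by (simp add: lessThan_Suc_atMost[symmetric] sum.lessThan_Suc_shift del: sum.lessThan_Suc)
  also have "(\<Sum>n<d. norm (c (Suc n)) ^ 2 * (2 ^ Suc n * fact (Suc n))) \<le> 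
      (\<Sum>n<d. 2 * (norm (of_nat (Suc n) * c (Suc n)) ^ 2 * (2 ^ n * fact n)))"
  proof (rule sum_mono)
    fix n
    have "norm (c (Suc n)) ^ 2 * (2 ^ Suc n * fact (Suc n)) = (2 * norm (c (Suc n)) ^ 2 * (2 ^ n * fact n)) * real (Suc n)"
      by (simp add: algebra_simps)
    also have "\<dots> \<le> (2 * norm (c (Suc n)) ^ 2 * (2 ^ n * fact n)) * (real (Suc n))^2"
      by (intro mult_left_mono) (auto simp: power2_eq_square)
    also have "\<dots> = 2 * (norm (of_nat (Suc n) * c (Suc n)) ^ 2 * (2 ^ n * fact n))"
      by (simp only: norm_mult norm_of_nat power_mult_distrib) (simp add: algebra_simps)
    finally show "norm (c (Suc n)) ^ 2 * (2 ^ Suc n * fact (Suc n)) \<le> 2 * (norm (of_nat (Suc n) * c (Suc n)) ^ 2 * (2 ^ n * fact n))" .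
  qed
  also have "(\<Sum>n<d. 2 * (norm (of_nat (Suc n) * c (Suc n)) ^ 2 * (2 ^ n * fact n))) = 
     2 * (\<Sum>n\<le>degree (pderiv g). norm (Polynomial.coeff (pderiv g) n) ^ 2 * (2 ^ n * fact n))"
    unfolding sum_distrib_left coeff_pderiv c_def
    by (rule sum.mono_neutral_cong) (auto simp: d_def degree_pderiv coeff_eq_0)
  finally have le: "(\<Sum>n\<le>d. norm (c n) ^ 2 * (2 ^ n * fact n)) \<le> norm (poly g 0) ^ 2 + 
     2 * (\<Sum>n\<le>degree (pderiv g). norm (Polynomial.coeff (pderiv g) n) ^ 2 * (2 ^ n * fact n))"
    by (simp add: c_def poly_0_coeff_0)
  have "ennreal (\<Sum>n\<le>d. norm (c n) ^ 2 * (2 ^ n * fact n)) \<le> ennreal (norm (poly g 0) ^ 2 + 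
     2 * (\<Sum>n\<le>degree (pderiv g). norm (Polynomial.coeff (pderiv g) n) ^ 2 * (2 ^ n * fact n)))"
    using le by (rule ennreal_leI)
  also have "\<dots> = ennreal (norm (poly g 0) ^ 2) + 2 * ennreal (\<Sum>n\<le>degree (pderiv g). norm (Polynomial.coeff (pderiv g) n) ^ 2 * (2 ^ n * fact n))"
    by (subst ennreal_plus) (auto intro!: sum_nonneg simp: ennreal_mult')
  finally show ?thesis unfolding nn_integral_cgauss_poly d_def c_def .
qed


section \<open>A Poincare inequality for analytic polynomials\<close>

interpretation Pcg: product_sigma_finite "\<lambda>_. cgauss" 
  by standard
interpretation Psg: product_sigma_finite "\<lambda>_. std_gauss"
  by standard

text \<open>
One coordinate is integrated out at a time. The one-dimensional inequality replaces it by \<open>0\<close> at the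
cost of its own derivative; the derivatives with respect to the remaining coordinates are then taken
at \<open>0\<close> in that coordinate, and since they are analytic in it, the mean value property returns them to
the full integral. The value \<open>undefined\<close> outside \<open>I\<close> is the convention of product spaces.
\<close>

lemma cgauss_PiM_Poincare:
  fixes F :: "('i \<Rightarrow> complex) \<Rightarrow> complex"
  assumes "finite I"
    and "F \<in> borel_measurable (\<Pi>\<^sub>M i\<in>I. cgauss)" "\<And>i. i \<in> I \<Longrightarrow> F' i \<in> borel_measurable (\<Pi>\<^sub>M i\<in>I. cgauss)"
    and "\<And>i w. i \<in> I \<Longrightarrow> \<exists>g. \<forall>z. F (w(i := z)) = poly g z \<and> F' i (w(i := z)) = poly (pderiv g) z"
    and "\<And>i j w. i \<in> I \<Longrightarrow> j \<in> I \<Longrightarrow> \<exists>g. \<forall>z. F' i (w(j := z)) = poly g z"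
  shows "(\<integral>\<^sup>+w. ennreal (norm (F w) ^ 2) \<partial>(\<Pi>\<^sub>M i\<in>I. cgauss)) \<le>
    ennreal (norm (F (\<lambda>i. if i \<in> I then 0 else undefined)) ^ 2) + 
     2 * (\<Sum>i\<in>I. \<integral>\<^sup>+w. ennreal (norm (F' i w) ^ 2) \<partial>(\<Pi>\<^sub>M i\<in>I. cgauss))"
  using assms
proof (induction I arbitrary: F F' rule: finite_induct)
  case empty
  show ?case by (simp add: Pcg.nn_integral_empty)
next
  case (insert j I)
  note mF[measurable] = insert.prems(1)
  note mF'[measurable] = insert.prems(2)
  define P where "P = (\<Pi>\<^sub>M i\<in>I. cgauss)"
  define P' where "P' = (\<Pi>\<^sub>M i\<in>insert j I. cgauss)"
  define F0 where "F0 w = F (w(j := 0))" for w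
  define F0' where "F0' i w = F' i (w(j := 0))" for i w
  have upd: "(\<lambda>w. w(j := 0)) \<in> measurable P P'"
    unfolding P_def P'_def
    by (rule measurable_PiM_single') (auto simp: space_PiM PiE_iff extensional_def)
  have mF0: "F0 \<in> borel_measurable P" "\<And>i. i \<in> I \<Longrightarrow> F0' i \<in> borel_measurable P"
    unfolding F0_def F0'_def using upd mF mF'
    by (auto simp: P'_def intro: measurable_compose)
  have IH: "(\<integral>\<^sup>+w. ennreal (norm (F0 w) ^ 2) \<partial>P) \<le> ennreal (norm (F0 (\<lambda>i. if i \<in> I then 0 else undefined)) ^ 2) + 
     2 * (\<Sum>i\<in>I. \<integral>\<^sup>+w. ennreal (norm (F0' i w) ^ 2) \<partial>P)"
    unfolding P_def
  proof (rule insert.IH)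
    fix i w assume i: "i \<in> I"
    then have "i \<noteq> j" using insert.hyps by auto
    then have tw: "w(i := z, j := 0) = w(j := 0, i := z)" for z :: complex by (rule fun_upd_twist)
    show "\<exists>g. \<forall>z. F0 (w(i := z)) = poly g z \<and> F0' i (w(i := z)) = poly (pderiv g) z"
      unfolding F0_def F0'_def tw by (rule insert.prems(3)) (use i in simp)
  next
    fix i k w assume i: "i \<in> I" "k \<in> I"
    then have "k \<noteq> j" using insert.hyps by auto
    then have tw: "w(k := z, j := 0) = w(j := 0, k := z)" for z :: complex by (rule fun_upd_twist)
    show "\<exists>g. \<forall>z. F0' i (w(k := z)) = poly g z"
      unfolding F0'_def tw by (rule insert.prems(4)) (use i in simp_all)
  qed (use mF0 in \<open>auto simp: P_def\<close>)
  have e: "(\<integral>\<^sup>+w. f w \<partial>P') = (\<integral>\<^sup>+w. \<integral>\<^sup>+z. f (w(j := z)) \<partial>cgauss \<partial>P)" if "f \<in> borel_measurable P'" for f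
    using that unfolding P_def P'_def by (intro Pcg.product_nn_integral_insert insert.hyps)
  have mz: "(\<lambda>w. \<integral>\<^sup>+z. ennreal (norm (F' i (w(j := z))) ^ 2) \<partial>cgauss) \<in> borel_measurable P" if "i \<in> insert j I" for i
  proof (rule cgauss.borel_measurable_nn_integral)
    have "(\<lambda>x. (fst x)(j := snd x)) \<in> measurable (P \<Otimes>\<^sub>M cgauss) P'"
      unfolding P_def P'_def using measurable_add_dim[of j I "\<lambda>_. cgauss"] by (simp add: case_prod_beta')
    from measurable_compose[OF this mF'[OF that, folded P'_def]]
    have [measurable]: "(\<lambda>x. F' i ((fst x)(j := snd x))) \<in> borel_measurable (P \<Otimes>\<^sub>M cgauss)" .
    show "(\<lambda>(w, z). ennreal (norm (F' i (w(j := z))) ^ 2)) \<in> borel_measurable (P \<Otimes>\<^sub>M cgauss)"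
      by (simp add: case_prod_beta')
  qed
  have "(\<integral>\<^sup>+w. ennreal (norm (F w) ^ 2) \<partial>P') = (\<integral>\<^sup>+w. \<integral>\<^sup>+z. ennreal (norm (F (w(j := z))) ^ 2) \<partial>cgauss \<partial>P)"
    by (rule e) (simp add: P'_def)
  also have "\<dots> \<le> (\<integral>\<^sup>+w. ennreal (norm (F0 w) ^ 2) + 2 * (\<integral>\<^sup>+z. ennreal (norm (F' j (w(j := z))) ^ 2) \<partial>cgauss) \<partial>P)"
  proof (rule nn_integral_mono)
    fix w
    obtain g where g: "\<And>z. F (w(j := z)) = poly g z" "\<And>z. F' j (w(j := z)) = poly (pderiv g) z"
      using insert.prems(3)[of j w, OF insertI1] by blast
    show "(\<integral>\<^sup>+z. ennreal (norm (F (w(j := z))) ^ 2) \<partial>cgauss) \<le> 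
       ennreal (norm (F0 w) ^ 2) + 2 * (\<integral>\<^sup>+z. ennreal (norm (F' j (w(j := z))) ^ 2) \<partial>cgauss)"
      unfolding F0_def g by (rule cgauss_Poincare)
  qed
  also have "\<dots> = (\<integral>\<^sup>+w. ennreal (norm (F0 w) ^ 2) \<partial>P) + 2 * (\<integral>\<^sup>+w. \<integral>\<^sup>+z. ennreal (norm (F' j (w(j := z))) ^ 2) \<partial>cgauss \<partial>P)"
    using mF0 mz by (subst nn_integral_add) (auto simp: nn_integral_cmult)
  also have "(\<integral>\<^sup>+w. \<integral>\<^sup>+z. ennreal (norm (F' j (w(j := z))) ^ 2) \<partial>cgauss \<partial>P) = (\<integral>\<^sup>+w. ennreal (norm (F' j w) ^ 2) \<partial>P')"
    by (rule e[symmetric]) (simp add: P'_def)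
  finally have L: "(\<integral>\<^sup>+w. ennreal (norm (F w) ^ 2) \<partial>P') \<le> (\<integral>\<^sup>+w. ennreal (norm (F0 w) ^ 2) \<partial>P) + 2 * (\<integral>\<^sup>+w. ennreal (norm (F' j w) ^ 2) \<partial>P')" .
  have S: "(\<Sum>i\<in>I. \<integral>\<^sup>+w. ennreal (norm (F0' i w) ^ 2) \<partial>P) \<le> (\<Sum>i\<in>I. \<integral>\<^sup>+w. ennreal (norm (F' i w) ^ 2) \<partial>P')"
  proof (rule sum_mono)
    fix i assume i: "i \<in> I"
    have "(\<integral>\<^sup>+w. ennreal (norm (F0' i w) ^ 2) \<partial>P) \<le> (\<integral>\<^sup>+w. \<integral>\<^sup>+z. ennreal (norm (F' i (w(j := z))) ^ 2) \<partial>cgauss \<partial>P)"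
    proof (rule nn_integral_mono)
      fix w
      obtain g where g: "\<And>z. F' i (w(j := z)) = poly g z"
        using insert.prems(4)[of i j w, OF insertI2[OF i] insertI1] by blast
      show "ennreal (norm (F0' i w) ^ 2) \<le> (\<integral>\<^sup>+z. ennreal (norm (F' i (w(j := z))) ^ 2) \<partial>cgauss)"
        unfolding F0'_def g by (rule cgauss_mean_value)
    qed
    also have "\<dots> = (\<integral>\<^sup>+w. ennreal (norm (F' i w) ^ 2) \<partial>P')"
      using i by (intro e[symmetric]) (simp add: P'_def)
    finally show "(\<integral>\<^sup>+w. ennreal (norm (F0' i w) ^ 2) \<partial>P) \<le> (\<integral>\<^sup>+w. ennreal (norm (F' i w) ^ 2) \<partial>P')" .
  qed
  have "(\<integral>\<^sup>+w. ennreal (norm (F w) ^ 2) \<partial>P') \<le> 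
     ennreal (norm (F0 (\<lambda>i. if i \<in> I then 0 else undefined)) ^ 2) + 
     2 * (\<Sum>i\<in>I. \<integral>\<^sup>+w. ennreal (norm (F' i w) ^ 2) \<partial>P') + 2 * (\<integral>\<^sup>+w. ennreal (norm (F' j w) ^ 2) \<partial>P')"
    by (rule order.trans[OF L add_right_mono[OF order.trans[OF IH add_left_mono[OF mult_left_mono[OF S]]]]]) simp
  also have "(\<lambda>i. if i \<in> I then 0 else undefined)(j := 0) = (\<lambda>i. if i \<in> insert j I then 0 else undefined :: complex)"
    by auto
  then have "F0 (\<lambda>i. if i \<in> I then 0 else undefined) = F (\<lambda>i. if i \<in> insert j I then 0 else undefined)"
    unfolding F0_def by (rule arg_cong)
  finally show ?case
    unfolding P'_def[symmetric] using insert.hyps by (simp add: distrib_left add_ac)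
qed

lemma measurable_Complex_component:
  assumes "i \<in> I"
  shows "(\<lambda>xy. Complex (fst xy i) (snd xy i)) \<in> 
    borel_measurable ((\<Pi>\<^sub>M i\<in>I. std_gauss) \<Otimes>\<^sub>M (\<Pi>\<^sub>M i\<in>I. std_gauss))"
proof -
  let ?P = "\<Pi>\<^sub>M i\<in>I. std_gauss"
  have "(\<lambda>xy. (fst xy i, snd xy i)) \<in> measurable (?P \<Otimes>\<^sub>M ?P) (std_gauss \<Otimes>\<^sub>M std_gauss)"
    using assms by measurable
  from measurable_compose[OF this measurable_Complex] show ?thesis by simp
qed

lemma measurable_Complex_PiM:
  "(\<lambda>(x, y). \<lambda>i\<in>I. Complex (x i) (y i)) \<in> 
     measurable ((\<Pi>\<^sub>M i\<in>I. std_gauss) \<Otimes>\<^sub>M (\<Pi>\<^sub>M i\<in>I. std_gauss)) (\<Pi>\<^sub>M i\<in>I. cgauss)"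
  using measurable_Complex_component[of _ I]
  by (intro measurable_PiM_single') (auto simp: case_prod_beta' PiE_iff cong: measurable_cong_sets)

text \<open>
A complex Gaussian vector is a pair of independent real Gaussian vectors; both measures agree on
boxes.
\<close>

lemma cgauss_PiM_pair:
  assumes "finite I"
  shows "(\<Pi>\<^sub>M i\<in>I. cgauss) = distr ((\<Pi>\<^sub>M i\<in>I. std_gauss) \<Otimes>\<^sub>M (\<Pi>\<^sub>M i\<in>I. std_gauss)) (\<Pi>\<^sub>M i\<in>I. cgauss)
     (\<lambda>(x, y). \<lambda>i\<in>I. Complex (x i) (y i))"
proof (rule Pcg.PiM_eqI[symmetric])
  interpret X: prob_space "\<Pi>\<^sub>M i\<in>I. std_gauss" by (rule prob_space_PiM) (rule prob_space_std_gauss)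
  let ?P = "\<Pi>\<^sub>M i\<in>I. std_gauss"
  let ?T = "\<lambda>(x, y). \<lambda>i\<in>I. Complex (x i) (y i)"
  note CM = measurable_Complex_component[of _ I] and T = measurable_Complex_PiM[of I]
  fix A assume A: "\<And>i. i \<in> I \<Longrightarrow> A i \<in> sets cgauss"
  then have A': "A i \<in> sets borel" if "i \<in> I" for i using that by simp
  have PA: "PiE I A \<in> sets (\<Pi>\<^sub>M i\<in>I. cgauss)" using A assms by (intro sets_PiM_I_finite) auto
  have "emeasure (distr (?P \<Otimes>\<^sub>M ?P) (\<Pi>\<^sub>M i\<in>I. cgauss) ?T) (PiE I A) = 
     (\<integral>\<^sup>+xy. indicator (PiE I A) (?T xy) \<partial>(?P \<Otimes>\<^sub>M ?P))"
    using T PA by (subst nn_integral_indicator[symmetric], simp) (subst nn_integral_distr, auto)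
  also have "\<dots> = (\<integral>\<^sup>+xy. (\<Prod>i\<in>I. indicator (A i) (Complex (fst xy i) (snd xy i))) \<partial>(?P \<Otimes>\<^sub>M ?P))"
    by (intro nn_integral_cong) (auto simp: indicator_def PiE_iff assms split: if_splits)
  also have "\<dots> = (\<integral>\<^sup>+x. \<integral>\<^sup>+y. (\<Prod>i\<in>I. indicator (A i) (Complex (x i) (y i))) \<partial>?P \<partial>?P)"
  proof (subst X.nn_integral_fst[symmetric])
    show "(\<lambda>xy. \<Prod>i\<in>I. indicator (A i) (Complex (fst xy i) (snd xy i)) :: ennreal) \<in> borel_measurable (?P \<Otimes>\<^sub>M ?P)"
      using A' CM by (intro borel_measurable_prod_ennreal) (auto intro!: measurable_compose[OF CM] borel_measurable_indicator)
  qed simp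
  also have "\<dots> = (\<integral>\<^sup>+x. (\<Prod>i\<in>I. \<integral>\<^sup>+y. indicator (A i) (Complex (x i) y) \<partial>std_gauss) \<partial>?P)"
  proof (intro nn_integral_cong, subst Psg.product_nn_integral_prod[OF assms, symmetric])
    fix x i assume "i \<in> I"
    have "(\<lambda>y. (x i, y)) \<in> measurable std_gauss (std_gauss \<Otimes>\<^sub>M std_gauss)" by simp
    from measurable_compose[OF this measurable_Complex]
    have "(\<lambda>y. Complex (x i) y) \<in> borel_measurable std_gauss" by simp
    then show "(\<lambda>y. indicator (A i) (Complex (x i) y) :: ennreal) \<in> borel_measurable std_gauss"
      by (rule measurable_compose) (use A'[OF \<open>i \<in> I\<close>] in simp)
  qed simp
  also have "\<dots> = (\<Prod>i\<in>I. \<integral>\<^sup>+x. \<integral>\<^sup>+y. indicator (A i) (Complex x y) \<partial>std_gauss \<partial>std_gauss)"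
  proof (rule Psg.product_nn_integral_prod[OF assms])
    fix i assume "i \<in> I"
    show "(\<lambda>x. \<integral>\<^sup>+y. indicator (A i) (Complex x y) \<partial>std_gauss) \<in> borel_measurable std_gauss"
    proof (rule std_gauss.borel_measurable_nn_integral)
      show "(\<lambda>(x, y). indicator (A i) (Complex x y)) \<in> borel_measurable (std_gauss \<Otimes>\<^sub>M std_gauss)"
        using measurable_compose[OF measurable_Complex, of "indicator (A i)" "borel :: ennreal measure"] A'[OF \<open>i \<in> I\<close>]
        by (simp add: case_prod_beta')
    qed
  qed
  also have "\<dots> = (\<Prod>i\<in>I. emeasure cgauss (A i))"
    using A' by (intro prod.cong refl) (subst nn_integral_cgauss[symmetric], auto)
  finally show "emeasure (distr (?P \<Otimes>\<^sub>M ?P) (\<Pi>\<^sub>M i\<in>I. cgauss) ?T) (PiE I A) = (\<Prod>i\<in>I. emeasure cgauss (A i))" .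
qed (use assms in auto)

lemma nn_integral_cgauss_PiM:
  assumes "finite I" "f \<in> borel_measurable (\<Pi>\<^sub>M i\<in>I. cgauss)"
  shows "(\<integral>\<^sup>+w. f w \<partial>(\<Pi>\<^sub>M i\<in>I. cgauss)) = 
    (\<integral>\<^sup>+x. \<integral>\<^sup>+y. f (\<lambda>i\<in>I. Complex (x i) (y i)) \<partial>(\<Pi>\<^sub>M i\<in>I. std_gauss) \<partial>(\<Pi>\<^sub>M i\<in>I. std_gauss))"
proof -
  interpret X: prob_space "\<Pi>\<^sub>M i\<in>I. std_gauss" by (rule prob_space_PiM) (rule prob_space_std_gauss)
  let ?P = "\<Pi>\<^sub>M i\<in>I. std_gauss"
  have "(\<integral>\<^sup>+w. f w \<partial>(\<Pi>\<^sub>M i\<in>I. cgauss)) = (\<integral>\<^sup>+xy. f (\<lambda>i\<in>I. Complex (fst xy i) (snd xy i)) \<partial>(?P \<Otimes>\<^sub>M ?P))"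
    using assms(2) by (subst cgauss_PiM_pair[OF assms(1)]) (subst nn_integral_distr[OF measurable_Complex_PiM], auto simp: case_prod_beta')
  also have "\<dots> = (\<integral>\<^sup>+x. \<integral>\<^sup>+y. f (\<lambda>i\<in>I. Complex (x i) (y i)) \<partial>?P \<partial>?P)"
    using measurable_compose[OF measurable_Complex_PiM assms(2)]
    by (subst X.nn_integral_fst[symmetric]) (auto simp: case_prod_beta')
  finally show ?thesis .
qed


section \<open>Exponential moments of Gaussian quadratic forms\<close>

lemma nn_integral_std_gauss:
  "f \<in> borel_measurable borel \<Longrightarrow> (\<integral>\<^sup>+x. f x \<partial>std_gauss) = (\<integral>\<^sup>+x. ennreal (std_normal_density x) * f x \<partial>lborel)"
  by (subst nn_integral_density) auto

lemma nn_integral_normal_density: "\<sigma> > 0 \<Longrightarrow> (\<integral>\<^sup>+x. ennreal (normal_density \<mu> \<sigma> x) \<partial>lborel) = 1"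
  using prob_space.emeasure_space_1[OF prob_space_normal_density[of \<sigma> \<mu>]]
  by (simp add: emeasure_density)

text \<open>
Completing the square turns the integrand into a multiple of another normal density.
\<close>

lemma gauss_quadratic:
  assumes D: "2 * t * v^2 < 1"
  shows "(\<integral>\<^sup>+x. ennreal (exp (t * (u + v * x)^2)) \<partial>std_gauss) =
    ennreal (exp (t * u^2 / (1 - 2 * t * v^2)) / sqrt (1 - 2 * t * v^2))"
proof -
  define E where "E = 1 - 2 * t * v^2"
  have E: "E > 0" using D by (simp add: E_def)
  have s: "(1 / sqrt E)^2 = 1 / E" using E by (simp add: power_divide)
  have id: "std_normal_density x * exp (t * (u + v * x)^2) = 
      (exp (t * u^2 / E) / sqrt E) * normal_density (2 * t * u * v / E) (1 / sqrt E) x" for x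
  proof -
    have ex: "- (x^2) / 2 + t * (u + v * x)^2 = t * u^2 / E + - ((x - 2 * t * u * v / E)^2) / (2 * (1 / sqrt E)^2)"
    proof -
      have "t * u^2 / E + - ((x - 2 * t * u * v / E)^2) / (2 * (1 / sqrt E)^2) = 
         (t * u^2 - 2 * t^2 * u^2 * v^2) / E + 2 * t * u * v * x - E * x^2 / 2"
        unfolding s using E by (simp add: field_simps power2_eq_square)
      also have "t * u^2 - 2 * t^2 * u^2 * v^2 = t * u^2 * E" by (simp add: E_def algebra_simps power2_eq_square)
      also have "t * u^2 * E / E + 2 * t * u * v * x - E * x^2 / 2 = - (x^2) / 2 + t * (u + v * x)^2"
        using E by (simp, simp add: E_def field_simps power2_eq_square)
      finally show ?thesis ..
    qed
    have "std_normal_density x * exp (t * (u + v * x)^2) = 1 / sqrt (2 * pi) * exp (- (x^2) / 2 + t * (u + v * x)^2)"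
      by (simp only: std_normal_density_def exp_add mult.assoc)
    also have "\<dots> = exp (t * u^2 / E) * (1 / sqrt (2 * pi) * exp (- ((x - 2 * t * u * v / E)^2) / (2 * (1 / sqrt E)^2)))"
      unfolding ex exp_add by simp
    also have "1 / sqrt (2 * pi) = (1 / sqrt E) * (1 / sqrt (2 * pi * (1 / sqrt E)^2))"
      unfolding s using E by (simp add: real_sqrt_mult real_sqrt_divide)
    finally show ?thesis by (simp add: normal_density_def mult_ac)
  qed
  have "(\<integral>\<^sup>+x. ennreal (exp (t * (u + v * x)^2)) \<partial>std_gauss) = 
     (\<integral>\<^sup>+x. ennreal (exp (t * u^2 / E) / sqrt E) * ennreal (normal_density (2 * t * u * v / E) (1 / sqrt E) x) \<partial>lborel)"
    by (subst nn_integral_std_gauss) (use E in \<open>auto simp flip: ennreal_mult' simp: id intro!: nn_integral_cong\<close>)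
  also have "\<dots> = ennreal (exp (t * u^2 / E) / sqrt E)"
    using E by (subst nn_integral_cmult) (auto simp: nn_integral_normal_density)
  finally show ?thesis unfolding E_def .
qed

lemma gauss_linear: "(\<integral>\<^sup>+x. ennreal (exp (c * x)) \<partial>std_gauss) = ennreal (exp (c^2 / 2))"
proof -
  have id: "std_normal_density x * exp (c * x) = exp (c^2 / 2) * normal_density c 1 x" for x
  proof -
    have "- (x^2) / 2 + c * x = c^2 / 2 + - ((x - c)^2) / 2" by (simp add: field_simps power2_eq_square)
    then have "exp (- (x^2) / 2) * exp (c * x) = exp (c^2 / 2) * exp (- ((x - c)^2) / 2)" by (simp only: exp_add[symmetric])
    then show ?thesis by (simp add: normal_density_def)
  qed
  have "(\<integral>\<^sup>+x. ennreal (exp (c * x)) \<partial>std_gauss) = (\<integral>\<^sup>+x. ennreal (exp (c^2/2)) * ennreal (normal_density c 1 x) \<partial>lborel)"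
    by (subst nn_integral_std_gauss) (auto simp flip: ennreal_mult' simp: id intro!: nn_integral_cong)
  also have "\<dots> = ennreal (exp (c^2/2))"
    by (subst nn_integral_cmult) (auto simp: nn_integral_normal_density)
  finally show ?thesis .
qed

text \<open>
Only the linear form \<open>\<Sum>\<^sub>i v\<^sub>i x\<^sub>i\<close> matters, and it is normal with variance \<open>\<Sum>\<^sub>i v\<^sub>i\<^sup>2\<close>. Integrating out one
coordinate leaves an integral of the same form with \<open>t\<close> replaced by \<open>t / D\<close>, and the factors telescope.
\<close>

lemma gauss_quadratic_PiM:
  fixes v :: "'i \<Rightarrow> real"
  assumes "finite J" "2 * t * (\<Sum>i\<in>J. (v i)^2) < 1"
  shows "(\<integral>\<^sup>+x. ennreal (exp (t * (u + (\<Sum>i\<in>J. v i * x i))^2)) \<partial>(\<Pi>\<^sub>M i\<in>J. std_gauss)) =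
    ennreal (exp (t * u^2 / (1 - 2 * t * (\<Sum>i\<in>J. (v i)^2))) / sqrt (1 - 2 * t * (\<Sum>i\<in>J. (v i)^2)))"
  using assms
proof (induction J arbitrary: t rule: finite_induct)
  case empty
  show ?case by (subst Psg.nn_integral_empty) auto
next
  case (insert j J)
  define S where "S = (\<Sum>i\<in>J. (v i)^2)"
  have S0: "S \<ge> 0" by (simp add: S_def sum_nonneg)
  have c: "2 * t * ((v j)^2 + S) < 1" using insert by (simp add: S_def)
  define D where "D = 1 - 2 * t * (v j)^2"
  have D: "D > 0" "2 * t * S < D"
  proof -
    show "2 * t * S < D" using c by (simp add: D_def algebra_simps)
    show "D > 0"
    proof (cases "t \<ge> 0")
      case True
      then have "2 * t * S \<ge> 0" using S0 by simp
      then show ?thesis using c by (simp add: D_def algebra_simps)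
    next
      case False
      then have "2 * t * (v j)^2 \<le> 0" by (intro mult_nonpos_nonneg[of "2 * t"]) auto
      then show ?thesis by (simp add: D_def)
    qed
  qed
  have sum_upd: "(\<Sum>i\<in>insert j J. v i * (x(j := y)) i) = v j * y + (\<Sum>i\<in>J. v i * x i)" for x :: "'i \<Rightarrow> real" and y
    using insert.hyps by (subst sum.insert) (auto intro!: sum.cong)
  have "(\<integral>\<^sup>+x. ennreal (exp (t * (u + (\<Sum>i\<in>insert j J. v i * x i))^2)) \<partial>(\<Pi>\<^sub>M i\<in>insert j J. std_gauss)) = 
     (\<integral>\<^sup>+x. \<integral>\<^sup>+y. ennreal (exp (t * (u + (\<Sum>i\<in>insert j J. v i * (x(j := y)) i))^2)) \<partial>std_gauss \<partial>(\<Pi>\<^sub>M i\<in>J. std_gauss))"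
    by (rule Psg.product_nn_integral_insert) (use insert.hyps in auto)
  also have "\<dots> = (\<integral>\<^sup>+x. ennreal (exp ((t / D) * (u + (\<Sum>i\<in>J. v i * x i))^2)) * ennreal (1 / sqrt D) \<partial>(\<Pi>\<^sub>M i\<in>J. std_gauss))"
  proof (rule nn_integral_cong)
    fix x :: "'i \<Rightarrow> real"
    have "(\<integral>\<^sup>+y. ennreal (exp (t * (u + (\<Sum>i\<in>insert j J. v i * (x(j := y)) i))^2)) \<partial>std_gauss) = 
       (\<integral>\<^sup>+y. ennreal (exp (t * ((u + (\<Sum>i\<in>J. v i * x i)) + v j * y)^2)) \<partial>std_gauss)"
      unfolding sum_upd by (simp add: add_ac)
    also have "\<dots> = ennreal (exp ((t / D) * (u + (\<Sum>i\<in>J. v i * x i))^2)) * ennreal (1 / sqrt D)"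
      using D by (subst gauss_quadratic) (auto simp: D_def simp flip: ennreal_mult')
    finally show "(\<integral>\<^sup>+y. ennreal (exp (t * (u + (\<Sum>i\<in>insert j J. v i * (x(j := y)) i))^2)) \<partial>std_gauss) = 
       ennreal (exp ((t / D) * (u + (\<Sum>i\<in>J. v i * x i))^2)) * ennreal (1 / sqrt D)" .
  qed
  also have "\<dots> = (\<integral>\<^sup>+x. ennreal (exp ((t / D) * (u + (\<Sum>i\<in>J. v i * x i))^2)) \<partial>(\<Pi>\<^sub>M i\<in>J. std_gauss)) * ennreal (1 / sqrt D)"
    by (rule nn_integral_multc) auto
  also have "\<dots> = ennreal (exp ((t / D) * u^2 / (1 - 2 * (t / D) * S)) / sqrt (1 - 2 * (t / D) * S)) * ennreal (1 / sqrt D)"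
    unfolding S_def by (subst insert.IH) (use D in \<open>auto simp: S_def[symmetric] field_simps\<close>)
  also have "1 - 2 * (t / D) * S = (D - 2 * t * S) / D" using D by (simp add: field_simps)
  also have "(t / D) * u^2 / ((D - 2 * t * S) / D) = t * u^2 / (D - 2 * t * S)" using D by simp
  also have "ennreal (exp (t * u^2 / (D - 2 * t * S)) / sqrt ((D - 2 * t * S) / D)) * ennreal (1 / sqrt D) = 
     ennreal (exp (t * u^2 / (D - 2 * t * S)) / sqrt (D - 2 * t * S))"
    using D by (subst ennreal_mult'[symmetric]) (auto simp: real_sqrt_divide)
  also have "D - 2 * t * S = 1 - 2 * t * (\<Sum>i\<in>insert j J. (v i)^2)"
    using insert.hyps by (simp add: D_def S_def algebra_simps)
  finally show ?case .
qed

lemma gauss_linear_PiM: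
  fixes c :: "'i \<Rightarrow> real"
  assumes "finite I"
  shows "(\<integral>\<^sup>+x. ennreal (exp (\<Sum>i\<in>I. c i * x i)) \<partial>(\<Pi>\<^sub>M i\<in>I. std_gauss)) = ennreal (exp ((\<Sum>i\<in>I. (c i)^2) / 2))"
proof -
  have "(\<integral>\<^sup>+x. ennreal (exp (\<Sum>i\<in>I. c i * x i)) \<partial>(\<Pi>\<^sub>M i\<in>I. std_gauss)) = 
     (\<integral>\<^sup>+x. (\<Prod>i\<in>I. ennreal (exp (c i * x i))) \<partial>(\<Pi>\<^sub>M i\<in>I. std_gauss))"
    by (simp add: exp_sum assms prod_ennreal)
  also have "\<dots> = (\<Prod>i\<in>I. \<integral>\<^sup>+x. ennreal (exp (c i * x)) \<partial>std_gauss)"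
    by (rule Psg.product_nn_integral_prod) (auto simp: assms)
  also have "\<dots> = ennreal (exp ((\<Sum>i\<in>I. (c i)^2) / 2))"
    by (simp add: gauss_linear prod_ennreal assms sum_divide_distrib exp_sum)
  finally show ?thesis .
qed

text \<open>
The rows of the matrix \<open>x\<close> are independent, so an integral of a product of functions of the entries
of \<open>x v\<close> factorizes.
\<close>

lemma row_block_integral:
  fixes H :: "nat \<Rightarrow> real \<Rightarrow> ennreal" and v :: "nat \<Rightarrow> real" and n q :: nat
  assumes H: "\<And>a. H a \<in> borel_measurable borel"
  shows "(\<integral>\<^sup>+x. (\<Prod>a<n. H a (\<Sum>b<q. v b * x (a, b))) \<partial>(\<Pi>\<^sub>M i\<in>{..<n} \<times> {..<q}. std_gauss)) =
     (\<Prod>a<n. \<integral>\<^sup>+x. H a (\<Sum>i\<in>{a} \<times> {..<q}. v (snd i) * x i) \<partial>(\<Pi>\<^sub>M i\<in>{a} \<times> {..<q}. std_gauss))"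
proof (induction n)
  case 0
  show ?case by (simp only: lessThan_0 Sigma_empty1) (subst Psg.nn_integral_empty, auto)
next
  case (Suc n)
  have e: "{..<Suc n} \<times> {..<q} = ({..<n} \<times> {..<q}) \<union> ({n} \<times> {..<q})" by auto
  have m: "(\<lambda>x. \<Prod>a<n. H a (\<Sum>b<q. v b * x (a, b))) \<in> borel_measurable (\<Pi>\<^sub>M i\<in>{..<n} \<times> {..<q}. std_gauss)"
    by (intro borel_measurable_prod_ennreal measurable_compose[OF _ H]) auto
  have m': "(\<lambda>x. \<Prod>a<Suc n. H a (\<Sum>b<q. v b * x (a, b))) \<in> borel_measurable (\<Pi>\<^sub>M i\<in>{..<Suc n} \<times> {..<q}. std_gauss)"
    by (intro borel_measurable_prod_ennreal measurable_compose[OF _ H]) auto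
  have m'': "(\<lambda>x. H n (\<Sum>i\<in>{n} \<times> {..<q}. v (snd i) * x i)) \<in> borel_measurable (\<Pi>\<^sub>M i\<in>{n} \<times> {..<q}. std_gauss)"
    by (intro measurable_compose[OF _ H]) auto
  let ?I = "{..<n} \<times> {..<q}" and ?J = "{n} \<times> {..<q}"
  have s1: "(\<Sum>b<q. v b * merge ?I ?J (x, y) (a, b)) = (\<Sum>b<q. v b * x (a, b))" if "a < n" for a and x y :: "nat \<times> nat \<Rightarrow> real"
    using that by (intro sum.cong) (auto simp: merge_def)
  have s2: "(\<Sum>b<q. v b * merge ?I ?J (x, y) (n, b)) = (\<Sum>i\<in>?J. v (snd i) * y i)" for x y :: "nat \<times> nat \<Rightarrow> real"
    by (rule sum.reindex_bij_witness[of _ snd "\<lambda>b. (n, b)"]) (auto simp: merge_def)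
  have "(\<integral>\<^sup>+x. (\<Prod>a<Suc n. H a (\<Sum>b<q. v b * x (a, b))) \<partial>(\<Pi>\<^sub>M i\<in>{..<Suc n} \<times> {..<q}. std_gauss)) =
     (\<integral>\<^sup>+x. \<integral>\<^sup>+y. (\<Prod>a<Suc n. H a (\<Sum>b<q. v b * merge ?I ?J (x, y) (a, b))) \<partial>(\<Pi>\<^sub>M i\<in>?J. std_gauss) \<partial>(\<Pi>\<^sub>M i\<in>?I. std_gauss))"
    unfolding e by (rule Psg.product_nn_integral_fold) (use m' e in auto)
  also have "\<dots> = (\<integral>\<^sup>+x. \<integral>\<^sup>+y. (\<Prod>a<n. H a (\<Sum>b<q. v b * x (a, b))) * H n (\<Sum>i\<in>?J. v (snd i) * y i) \<partial>(\<Pi>\<^sub>M i\<in>?J. std_gauss) \<partial>(\<Pi>\<^sub>M i\<in>?I. std_gauss))"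
    by (intro nn_integral_cong) (auto simp: s2 s1 intro!: arg_cong2[where f = "(*)"] prod.cong)
  also have "\<dots> = (\<integral>\<^sup>+x. (\<Prod>a<n. H a (\<Sum>b<q. v b * x (a, b))) \<partial>(\<Pi>\<^sub>M i\<in>?I. std_gauss)) * (\<integral>\<^sup>+y. H n (\<Sum>i\<in>?J. v (snd i) * y i) \<partial>(\<Pi>\<^sub>M i\<in>?J. std_gauss))"
    using m m'' by (simp add: nn_integral_cmult nn_integral_multc)
  finally show ?case using Suc.IH by simp
qed

lemma gauss_matrix_quadratic:
  fixes u v :: "nat \<Rightarrow> real" and p q :: nat
  defines "S \<equiv> (\<Sum>b<q. (v b)^2)" and "U \<equiv> (\<Sum>a<p. (u a)^2)"
  assumes D: "2 * t * S < 1"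
  shows "(\<integral>\<^sup>+x. ennreal (exp (t * (\<Sum>a<p. (u a + (\<Sum>b<q. v b * x (a, b)))^2))) \<partial>(\<Pi>\<^sub>M i\<in>{..<p} \<times> {..<q}. std_gauss)) =
    ennreal (exp (t * U / (1 - 2 * t * S)) * (1 / sqrt (1 - 2 * t * S)) ^ p)"
proof -
  have S: "(\<Sum>i\<in>{a} \<times> {..<q}. (v (snd i))^2) = S" for a :: nat
    unfolding S_def by (rule sum.reindex_bij_witness[of _ "\<lambda>b. (a, b)" snd]) auto
  have "(\<integral>\<^sup>+x. ennreal (exp (t * (\<Sum>a<p. (u a + (\<Sum>b<q. v b * x (a, b)))^2))) \<partial>(\<Pi>\<^sub>M i\<in>{..<p} \<times> {..<q}. std_gauss)) =
     (\<integral>\<^sup>+x. (\<Prod>a<p. ennreal (exp (t * (u a + (\<Sum>b<q. v b * x (a, b)))^2))) \<partial>(\<Pi>\<^sub>M i\<in>{..<p} \<times> {..<q}. std_gauss))"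
    by (simp add: sum_distrib_left exp_sum prod_ennreal)
  also have "\<dots> = (\<Prod>a<p. \<integral>\<^sup>+x. ennreal (exp (t * (u a + (\<Sum>i\<in>{a} \<times> {..<q}. v (snd i) * x i))^2)) \<partial>(\<Pi>\<^sub>M i\<in>{a} \<times> {..<q}. std_gauss))"
    by (rule row_block_integral[where H = "\<lambda>a s. ennreal (exp (t * (u a + s)^2))"]) auto
  also have "\<dots> = (\<Prod>a<p. ennreal (exp (t * (u a)^2 / (1 - 2 * t * S)) / sqrt (1 - 2 * t * S)))"
    using D by (intro prod.cong refl, subst gauss_quadratic_PiM) (auto simp: S)
  also have "\<dots> = ennreal (\<Prod>a<p. exp (t * (u a)^2 / (1 - 2 * t * S)) * (1 / sqrt (1 - 2 * t * S)))"
    using D by (subst prod_ennreal) auto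
  also have "(\<Prod>a<p. exp (t * (u a)^2 / (1 - 2 * t * S)) * (1 / sqrt (1 - 2 * t * S))) = 
     exp (t * U / (1 - 2 * t * S)) * (1 / sqrt (1 - 2 * t * S)) ^ p"
    unfolding prod.distrib by (simp add: exp_sum[symmetric] U_def sum_distrib_left sum_divide_distrib)
  finally show ?thesis .
qed

lemma inverse_sqrt_le_exp:
  assumes "0 \<le> y" "y \<le> (1/2::real)"
  shows "1 / sqrt (1 - y) \<le> exp y"
proof -
  have "1 / (1 - y) \<le> 1 + 2 * y"
  proof -
    have "1 \<le> (1 + 2 * y) * (1 - y)"
      using mult_left_mono[of y "1/2" y] assms by (simp add: algebra_simps)
    then show ?thesis using assms by (simp add: field_simps)
  qed
  also have "\<dots> \<le> exp (2 * y)" by (rule exp_ge_add_one_self)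
  also have "\<dots> = (exp y)^2" by (simp add: exp_double)
  finally have "sqrt (1 / (1 - y)) \<le> exp y" by (intro real_le_lsqrt) auto
  then show ?thesis by (simp add: real_sqrt_divide)
qed

text \<open>
If \<open>u = A v\<close>, this is \<open>v\<^sup>T Y\<^sup>T Y v\<close> for \<open>Y = A + w\<close>: the sum of the squares of the entries of \<open>Y v\<close>.
\<close>

definition quad_form :: "nat \<Rightarrow> nat \<Rightarrow> (nat \<Rightarrow> real) \<Rightarrow> (nat \<Rightarrow> real) \<Rightarrow> (nat \<times> nat \<Rightarrow> complex) \<Rightarrow> complex" where
  "quad_form p q u v w = (\<Sum>a<p. (of_real (u a) + (\<Sum>b<q. of_real (v b) * w (a, b)))^2)"

text \<open>
For real \<open>v\<close> the vector \<open>w v\<close> is \<open>x + \<i> z\<close> with independent real Gaussian vectors \<open>x\<close>, \<open>z\<close>. The real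
part of the form is \<open>\<parallel>u + x\<parallel>\<^sup>2 - \<parallel>z\<parallel>\<^sup>2\<close> and the imaginary part is \<open>2 (u + x) \<bullet> z\<close>. In neither
case is there a term of first order in \<open>l p\<close>: the exponent contains only \<open>l\<^sup>2 p\<close>. With a conjugated transpose
the form would be \<open>\<parallel>u + x\<parallel>\<^sup>2 + \<parallel>z\<parallel>\<^sup>2\<close>, and its mean alone would contribute \<open>2 l p\<close>.
\<close>

lemma quad_form_mgf:
  fixes u v :: "nat \<Rightarrow> real" and p q :: nat and l :: real
  defines "S \<equiv> (\<Sum>b<q. (v b)^2)" and "U \<equiv> (\<Sum>a<p. (u a)^2)"
  defines "B \<equiv> exp (4 * l^2 * real p + 2 * l * U)"
  assumes l: "0 < l" "l \<le> 1/4" and S1: "S \<le> 1" and th: "th \<in> {1, -1, \<i>, -\<i>}"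
  shows "(\<integral>\<^sup>+w. ennreal (exp (l * Re (th * quad_form p q u v w))) \<partial>(\<Pi>\<^sub>M i\<in>{..<p} \<times> {..<q}. cgauss)) \<le> ennreal B"
proof -
  let ?I = "{..<p} \<times> {..<q}"
  let ?P = "\<Pi>\<^sub>M i\<in>?I. std_gauss"
  have S0: "S \<ge> 0" and U0: "U \<ge> 0" by (simp_all add: S_def U_def sum_nonneg)
  define s where "s x a = (\<Sum>b<q. v b * x (a, b))" for x :: "nat \<times> nat \<Rightarrow> real" and a
  define y where "y = 4 * l^2 * S^2"
  have y: "0 \<le> y" "y \<le> 4 * l^2" "y \<le> 1/4"
  proof -
    have "S^2 \<le> 1" using S0 S1 by (simp add: power_le_one)
    then show 1: "y \<le> 4 * l^2" unfolding y_def by (intro mult_left_le) auto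
    have "l^2 \<le> (1/4)^2" using l by (intro power_mono) auto
    then show "y \<le> 1/4" using 1 by (simp add: power2_eq_square)
  qed (simp add: y_def)
  have q1: "(1 / sqrt (1 - y)) ^ p \<le> exp (4 * l^2 * real p)"
  proof -
    have "(1 / sqrt (1 - y)) ^ p \<le> exp (4 * l^2) ^ p"
      using inverse_sqrt_le_exp[of y] y by (intro power_mono) (auto intro: order.trans)
    then show ?thesis by (simp add: exp_of_nat_mult[symmetric] mult.commute)
  qed
  have lS: "2 * l * S \<le> 1/2" using mult_mono[OF l(2) S1] l S0 by simp
  have "0 \<le> 2 * l * S" using l S0 by simp
  then have lS': "- 1 < 2 * l * S" by linarith
  have fac: "1 / sqrt (1 - y) = (1 / sqrt (1 - 2 * l * S)) * (1 / sqrt (1 + 2 * l * S))"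
    by (simp add: y_def algebra_simps power2_eq_square flip: real_sqrt_mult)
  have re: "Re (\<Sum>a<p. (Complex (u a + s x a) (s z a))^2) = (\<Sum>a<p. (u a + s x a)^2) - (\<Sum>a<p. (s z a)^2)" for x z
    by (simp add: Re_sum power2_eq_square sum_subtractf)
  have em: "0 \<le> e \<Longrightarrow> 0 \<le> g \<Longrightarrow> ennreal (e * g) * ennreal h = ennreal (e * (g * h))" for e g h :: real
    by (simp add: ennreal_mult'[symmetric] mult.assoc)
  have qf: "quad_form p q u v (\<lambda>i\<in>?I. Complex (x i) (z i)) = (\<Sum>a<p. (Complex (u a + s x a) (s z a))^2)" for x z
    unfolding quad_form_def s_def
    by (intro sum.cong refl arg_cong[where f = "\<lambda>z. z^2"]) (auto simp: complex_eq_iff Re_sum Im_sum)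
  have "(\<integral>\<^sup>+w. ennreal (exp (l * Re (th * quad_form p q u v w))) \<partial>(\<Pi>\<^sub>M i\<in>?I. cgauss)) =
     (\<integral>\<^sup>+x. \<integral>\<^sup>+z. ennreal (exp (l * Re (th * (\<Sum>a<p. (Complex (u a + s x a) (s z a))^2)))) \<partial>?P \<partial>?P)"
    by (subst nn_integral_cgauss_PiM) (auto simp: qf, auto simp: quad_form_def)
  also have "\<dots> \<le> ennreal B"
  proof -
    from th consider "th = 1" | "th = -1" | c where "th = c * \<i>" "c \<in> {1, -1}" by (metis insertCI insert_iff minus_mult_commute mult_1 singletonD)
    then show ?thesis
    proof cases
      case 1
      have "(\<integral>\<^sup>+x. \<integral>\<^sup>+z. ennreal (exp (l * Re (th * (\<Sum>a<p. (Complex (u a + s x a) (s z a))^2)))) \<partial>?P \<partial>?P) = 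
        (\<integral>\<^sup>+x. \<integral>\<^sup>+z. ennreal (exp (l * (\<Sum>a<p. (u a + s x a)^2))) * ennreal (exp ((-l) * (\<Sum>a<p. (0 + s z a)^2))) \<partial>?P \<partial>?P)"
      proof (intro nn_integral_cong)
        fix x z
        have "l * Re (th * (\<Sum>a<p. (Complex (u a + s x a) (s z a))^2)) = l * (\<Sum>a<p. (u a + s x a)^2) + (-l) * (\<Sum>a<p. (0 + s z a)^2)"
          unfolding 1 mult_1_left re by (simp add: right_diff_distrib)
        then show "ennreal (exp (l * Re (th * (\<Sum>a<p. (Complex (u a + s x a) (s z a))^2)))) = 
           ennreal (exp (l * (\<Sum>a<p. (u a + s x a)^2))) * ennreal (exp ((-l) * (\<Sum>a<p. (0 + s z a)^2)))"
          by (simp only: exp_add) (simp only: ennreal_mult' exp_ge_zero)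
      qed
      also have "\<dots> = (\<integral>\<^sup>+x. ennreal (exp (l * (\<Sum>a<p. (u a + s x a)^2))) \<partial>?P) * (\<integral>\<^sup>+z. ennreal (exp ((-l) * (\<Sum>a<p. (0 + s z a)^2))) \<partial>?P)"
        unfolding s_def by (subst nn_integral_cmult, simp, subst nn_integral_multc) auto
      also have "\<dots> = ennreal (exp (l * U / (1 - 2 * l * S)) * (1 / sqrt (1 - 2 * l * S)) ^ p) * ennreal ((1 / sqrt (1 + 2 * l * S)) ^ p)"
        unfolding s_def using lS lS' l S0
        by (subst (1 2) gauss_matrix_quadratic) (auto simp: S_def[symmetric] U_def[symmetric])
      also have "\<dots> = ennreal (exp (l * U / (1 - 2 * l * S)) * (1 / sqrt (1 - y)) ^ p)"
        unfolding fac power_mult_distrib by (rule em) (use lS lS' in auto)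
      also have "\<dots> \<le> ennreal B"
      proof (rule ennreal_leI)
        have "l * U / (1 - 2 * l * S) \<le> l * U / (1/2)"
          using lS l U0 by (intro divide_left_mono mult_nonneg_nonneg) auto
        then have "exp (l * U / (1 - 2 * l * S)) \<le> exp (2 * l * U)" by simp
        from mult_mono[OF this q1] show "exp (l * U / (1 - 2 * l * S)) * (1 / sqrt (1 - y)) ^ p \<le> B"
          using y by (simp add: B_def exp_add mult.commute)
      qed
      finally show ?thesis .
    next
      case 2
      have "(\<integral>\<^sup>+x. \<integral>\<^sup>+z. ennreal (exp (l * Re (th * (\<Sum>a<p. (Complex (u a + s x a) (s z a))^2)))) \<partial>?P \<partial>?P) = 
        (\<integral>\<^sup>+x. \<integral>\<^sup>+z. ennreal (exp ((-l) * (\<Sum>a<p. (u a + s x a)^2))) * ennreal (exp (l * (\<Sum>a<p. (0 + s z a)^2))) \<partial>?P \<partial>?P)"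
      proof (intro nn_integral_cong)
        fix x z
        have "l * Re (th * (\<Sum>a<p. (Complex (u a + s x a) (s z a))^2)) = (-l) * (\<Sum>a<p. (u a + s x a)^2) + l * (\<Sum>a<p. (0 + s z a)^2)"
          unfolding 2 mult_minus1 uminus_complex.sel re by (simp add: right_diff_distrib)
        then show "ennreal (exp (l * Re (th * (\<Sum>a<p. (Complex (u a + s x a) (s z a))^2)))) = 
           ennreal (exp ((-l) * (\<Sum>a<p. (u a + s x a)^2))) * ennreal (exp (l * (\<Sum>a<p. (0 + s z a)^2)))"
          by (simp only: exp_add) (simp only: ennreal_mult' exp_ge_zero)
      qed
      also have "\<dots> = (\<integral>\<^sup>+x. ennreal (exp ((-l) * (\<Sum>a<p. (u a + s x a)^2))) \<partial>?P) * (\<integral>\<^sup>+z. ennreal (exp (l * (\<Sum>a<p. (0 + s z a)^2))) \<partial>?P)"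
        unfolding s_def by (subst nn_integral_cmult, simp, subst nn_integral_multc) auto
      also have "\<dots> = ennreal (exp ((-l) * U / (1 + 2 * l * S)) * (1 / sqrt (1 + 2 * l * S)) ^ p) * ennreal ((1 / sqrt (1 - 2 * l * S)) ^ p)"
        unfolding s_def using lS lS' l S0
        by (subst (1 2) gauss_matrix_quadratic) (auto simp: S_def[symmetric] U_def[symmetric])
      also have "\<dots> = ennreal (exp ((-l) * U / (1 + 2 * l * S)) * (1 / sqrt (1 - y)) ^ p)"
        unfolding fac power_mult_distrib mult.commute[of "(1 / sqrt (1 - 2 * l * S)) ^ p"] by (rule em) (use lS lS' in auto)
      also have "\<dots> \<le> ennreal B"
      proof (rule ennreal_leI)
        have "(-l) * U / (1 + 2 * l * S) \<le> 0" using l U0 S0 by (intro divide_nonpos_pos mult_nonpos_nonneg) (auto intro: add_pos_nonneg)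
        also have "0 \<le> 2 * l * U" using l U0 by simp
        finally have "exp ((-l) * U / (1 + 2 * l * S)) \<le> exp (2 * l * U)" by simp
        from mult_mono[OF this q1] show "exp ((-l) * U / (1 + 2 * l * S)) * (1 / sqrt (1 - y)) ^ p \<le> B"
          using y by (simp add: B_def exp_add mult.commute)
      qed
      finally show ?thesis .
    next
      case 3
      have c: "c = complex_of_real (Re c)" "(Re c)^2 = 1" using 3(2) by auto
      define r where "r = Re c"
      have th: "th = of_real r * \<i>" using 3(1) c by (simp add: r_def)
      have "(\<integral>\<^sup>+x. \<integral>\<^sup>+z. ennreal (exp (l * Re (th * (\<Sum>a<p. (Complex (u a + s x a) (s z a))^2)))) \<partial>?P \<partial>?P) = 
        (\<integral>\<^sup>+x. \<integral>\<^sup>+z. ennreal (exp (\<Sum>i\<in>?I. (- 2 * l * r * (u (fst i) + s x (fst i)) * v (snd i)) * z i)) \<partial>?P \<partial>?P)"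
      proof (intro nn_integral_cong arg_cong[where f = ennreal] arg_cong[where f = exp])
        fix x z
        have "l * Re (th * (\<Sum>a<p. (Complex (u a + s x a) (s z a))^2)) = (\<Sum>a<p. - 2 * l * r * (u a + s x a) * s z a)"
          by (simp add: th Im_sum power2_eq_square sum_distrib_left sum_negf algebra_simps)
        also have "\<dots> = (\<Sum>a<p. \<Sum>b<q. (- 2 * l * r * (u a + s x a) * v b) * z (a, b))"
          unfolding s_def[of z] sum_distrib_left by (simp add: mult_ac)
        finally show "l * Re (th * (\<Sum>a<p. (Complex (u a + s x a) (s z a))^2)) = 
           (\<Sum>i\<in>?I. (- 2 * l * r * (u (fst i) + s x (fst i)) * v (snd i)) * z i)"
          by (simp add: sum.cartesian_product case_prod_beta')
      qed
      also have "\<dots> = (\<integral>\<^sup>+x. ennreal (exp ((2 * l^2 * S) * (\<Sum>a<p. (u a + s x a)^2))) \<partial>?P)"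
      proof (rule nn_integral_cong)
        fix x
        have "(\<Sum>i\<in>?I. (- 2 * l * r * (u (fst i) + s x (fst i)) * v (snd i))^2) = (\<Sum>a<p. \<Sum>b<q. 4 * l^2 * r^2 * (u a + s x a)^2 * (v b)^2)"
          by (simp add: sum.cartesian_product case_prod_beta' power_mult_distrib)
        also have "\<dots> = 4 * l^2 * S * (\<Sum>a<p. (u a + s x a)^2)"
        proof -
          have "4 * l^2 * S * (\<Sum>a<p. (u a + s x a)^2) = 4 * l^2 * ((\<Sum>a<p. (u a + s x a)^2) * S)" by simp
          also have "\<dots> = (\<Sum>a<p. \<Sum>b<q. 4 * l^2 * r^2 * (u a + s x a)^2 * (v b)^2)"
          proof -
            have "(\<Sum>a<p. (u a + s x a)^2) * S = (\<Sum>a<p. \<Sum>b<q. (u a + s x a)^2 * (v b)^2)"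
              unfolding S_def by (rule sum_product)
            then show ?thesis using c by (simp add: r_def mult.assoc sum_distrib_left)
          qed
          finally show ?thesis ..
        qed
        finally show "(\<integral>\<^sup>+z. ennreal (exp (\<Sum>i\<in>?I. (- 2 * l * r * (u (fst i) + s x (fst i)) * v (snd i)) * z i)) \<partial>?P) = 
          ennreal (exp ((2 * l^2 * S) * (\<Sum>a<p. (u a + s x a)^2)))"
          by (subst gauss_linear_PiM) auto
      qed
      also have "\<dots> = ennreal (exp (2 * l^2 * S * U / (1 - y)) * (1 / sqrt (1 - y)) ^ p)"
      proof -
        have "2 * (2 * l^2 * S) * S = y" by (simp add: y_def power2_eq_square)
        then show ?thesis
          unfolding s_def using y by (subst gauss_matrix_quadratic) (auto simp: S_def[symmetric] U_def[symmetric])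
      qed
      also have "\<dots> \<le> ennreal B"
      proof (rule ennreal_leI)
        have "2 * l^2 * S * U / (1 - y) \<le> 2 * l^2 * S * U / (1/2)"
          using y l U0 S0 by (intro divide_left_mono mult_nonneg_nonneg) auto
        also have "\<dots> = (4 * l * S) * (l * U)" by (simp add: power2_eq_square)
        also have "\<dots> \<le> 2 * (l * U)"
        proof (rule mult_right_mono)
          show "4 * l * S \<le> 2" using lS by linarith
        qed (use l U0 in simp)
        finally have "exp (2 * l^2 * S * U / (1 - y)) \<le> exp (2 * l * U)" by simp
        from mult_mono[OF this q1] show "exp (2 * l^2 * S * U / (1 - y)) * (1 / sqrt (1 - y)) ^ p \<le> B"
          using y by (simp add: B_def exp_add mult.commute)
      qed
      finally show ?thesis .
    qed
  qed
  finally show ?thesis .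
qed


section \<open>Operator norms from a lattice net\<close>

definition bilin :: "nat \<Rightarrow> (nat \<Rightarrow> nat \<Rightarrow> real) \<Rightarrow> (nat \<Rightarrow> real) \<Rightarrow> (nat \<Rightarrow> real) \<Rightarrow> real" where
  "bilin q R x y = (\<Sum>i<q. \<Sum>j<q. R i j * x i * y j)"

lemma bilin_polarization:
  assumes "\<And>i j. R i j = R j i"
  shows "bilin q R (\<lambda>i. x i + y i) (\<lambda>i. x i + y i) - bilin q R (\<lambda>i. x i - y i) (\<lambda>i. x i - y i) = 4 * bilin q R x y"
proof -
  have "(\<Sum>i<q. \<Sum>j<q. R i j * y i * x j) = (\<Sum>i<q. \<Sum>j<q. R i j * x i * y j)"
    by (subst sum.swap) (intro sum.cong refl, metis assms mult.assoc mult.commute)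
  then have e: "bilin q R y x = bilin q R x y" by (simp add: bilin_def)
  have "bilin q R (\<lambda>i. x i + y i) (\<lambda>i. x i + y i) - bilin q R (\<lambda>i. x i - y i) (\<lambda>i. x i - y i) = 2 * bilin q R x y + 2 * bilin q R y x"
    unfolding bilin_def sum_subtractf[symmetric] sum_distrib_left sum.distrib[symmetric]
    by (intro sum.cong refl) (simp add: algebra_simps)
  then show ?thesis by (simp add: e)
qed

lemma bilin_scale: "bilin q R (\<lambda>i. a * x i) (\<lambda>i. b * y i) = a * b * bilin q R x y"
  by (simp add: bilin_def sum_distrib_left mult_ac)

lemma bilin_le_of_quadratic:
  assumes sym: "\<And>i j. R i j = R j i" and B: "\<And>x. \<bar>bilin q R x x\<bar> \<le> B * (\<Sum>i<q. (x i)^2)"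
  shows "\<bar>bilin q R x y\<bar> \<le> B / 2 * ((\<Sum>i<q. (x i)^2) + (\<Sum>i<q. (y i)^2))"
proof -
  have "4 * \<bar>bilin q R x y\<bar> \<le> \<bar>bilin q R (\<lambda>i. x i + y i) (\<lambda>i. x i + y i)\<bar> + \<bar>bilin q R (\<lambda>i. x i - y i) (\<lambda>i. x i - y i)\<bar>"
    using bilin_polarization[of R q x y, OF sym] by linarith
  also have "\<dots> \<le> B * (\<Sum>i<q. (x i + y i)^2) + B * (\<Sum>i<q. (x i - y i)^2)"
    by (intro add_mono B)
  also have "\<dots> = 2 * B * ((\<Sum>i<q. (x i)^2) + (\<Sum>i<q. (y i)^2))"
    unfolding distrib_left[symmetric] sum.distrib[symmetric] sum_distrib_left
    by (intro sum.cong refl) (simp add: power2_eq_square algebra_simps)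
  finally show ?thesis by simp
qed

text \<open>
The classical net argument, with a net of lattice points. On the ball of squared radius \<open>16 q\<close> a vector
is rounded down to a lattice point of squared norm at most \<open>25 q\<close>; by polarization the change of the
form is at most a fixed fraction of its supremum \<open>S\<close> over the ball, so that \<open>S\<close> is bounded by the
values on the net.
\<close>

lemma quadratic_bound_from_lattice:
  fixes R :: "nat \<Rightarrow> nat \<Rightarrow> real"
  assumes q: "q > 0" and sym: "\<And>i j. R i j = R j i"
    and net: "\<And>z :: nat \<Rightarrow> int. (\<Sum>i<q. (z i)^2) \<le> 25 * int q \<Longrightarrow> 
       \<bar>bilin q R (\<lambda>i. of_int (z i)) (\<lambda>i. of_int (z i))\<bar> \<le> 25 * real q * L"
  shows "\<bar>bilin q R x x\<bar> \<le> 4 * L * (\<Sum>i<q. (x i)^2)"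
proof -
  define n2 where "n2 x = (\<Sum>i<q. (x i)^2)" for x :: "nat \<Rightarrow> real"
  define Q where "Q x = bilin q R x x" for x
  define S where "S = (SUP x\<in>{x. n2 x \<le> 16 * real q}. \<bar>Q x\<bar>)"
  have n20: "n2 x \<ge> 0" for x by (simp add: n2_def sum_nonneg)
  have zero_in: "(\<lambda>_. 0) \<in> {x. n2 x \<le> 16 * real q}" by (simp add: n2_def)
  have bdd: "bdd_above ((\<lambda>x. \<bar>Q x\<bar>) ` {x. n2 x \<le> 16 * real q})"
  proof (rule bdd_aboveI2)
    fix x assume "x \<in> {x. n2 x \<le> 16 * real q}"
    then have x: "(x i)^2 \<le> 16 * real q" if "i < q" for i
      using that member_le_sum[of i "{..<q}" "\<lambda>i. (x i)^2"] by (auto simp: n2_def)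
    have "\<bar>Q x\<bar> \<le> (\<Sum>i<q. \<Sum>j<q. \<bar>R i j * x i * x j\<bar>)"
      unfolding Q_def bilin_def by (rule order.trans[OF sum_abs], rule sum_mono, rule sum_abs)
    also have "\<dots> \<le> (\<Sum>i<q. \<Sum>j<q. \<bar>R i j\<bar> * (16 * real q))"
    proof (intro sum_mono)
      fix i j assume ij: "i \<in> {..<q}" "j \<in> {..<q}"
      have "2 * \<bar>x i * x j\<bar> \<le> (x i)^2 + (x j)^2"
        using sum_squares_bound[of "\<bar>x i\<bar>" "\<bar>x j\<bar>"] by (simp add: abs_mult)
      then have "\<bar>x i * x j\<bar> \<le> 16 * real q" using x[of i] x[of j] ij by auto
      then show "\<bar>R i j * x i * x j\<bar> \<le> \<bar>R i j\<bar> * (16 * real q)"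
        unfolding mult.assoc abs_mult[of "R i j"] by (intro mult_left_mono) auto
    qed
    finally show "\<bar>Q x\<bar> \<le> (\<Sum>i<q. \<Sum>j<q. \<bar>R i j\<bar> * (16 * real q))" .
  qed
  have S_upper: "\<bar>Q x\<bar> \<le> S" if "n2 x \<le> 16 * real q" for x
    unfolding S_def using that by (intro cSUP_upper bdd) auto
  have S0: "S \<ge> 0" using S_upper[of "\<lambda>_. 0"] zero_in by auto
  have hom: "\<bar>Q w\<bar> \<le> S / (16 * real q) * n2 w" for w
  proof (cases "n2 w = 0")
    case True
    then have "\<forall>i<q. w i = 0" by (auto simp: n2_def sum_nonneg_eq_0_iff)
    then show ?thesis using True by (simp add: Q_def bilin_def)
  next
    case False
    \<comment> \<open>Rescale \<open>w\<close> to the boundary of the ball.\<close>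
    define r where "r = sqrt (16 * real q / n2 w)"
    have pos: "n2 w > 0" using False n20[of w] by simp
    have r2: "r^2 = 16 * real q / n2 w" using pos by (simp add: r_def)
    have "n2 (\<lambda>i. r * w i) = r^2 * n2 w" by (simp add: n2_def sum_distrib_left power_mult_distrib)
    then have "n2 (\<lambda>i. r * w i) \<le> 16 * real q" using pos r2 by simp
    then have "\<bar>Q (\<lambda>i. r * w i)\<bar> \<le> S" by (rule S_upper)
    also have "Q (\<lambda>i. r * w i) = r^2 * Q w" by (simp add: Q_def bilin_scale power2_eq_square)
    finally have "r^2 * \<bar>Q w\<bar> \<le> S" by (simp add: abs_mult)
    then show ?thesis unfolding r2 using pos q by (simp add: field_simps)
  qed
  have key: "\<bar>Q x\<bar> \<le> 25 * real q * L + 9 / 16 * S" if x: "n2 x \<le> 16 * real q" for x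
  proof -
    define z where "z i = \<lfloor>x i\<rfloor>" for i
    define d where "d i = x i - of_int (z i)" for i
    have d: "(d i)^2 \<le> 1" for i
    proof -
      have "0 \<le> d i" "d i \<le> 1" unfolding d_def z_def by linarith+
      then show ?thesis by (simp add: power_le_one)
    qed
    have d2: "n2 d \<le> real q" 
      unfolding n2_def using sum_mono[of "{..<q}" "\<lambda>i. (d i)^2" "\<lambda>_. 1"] d by simp
    have "real_of_int (\<Sum>i<q. (z i)^2) = n2 (\<lambda>i. x i - d i)" by (simp add: n2_def d_def)
    also have "\<dots> \<le> (\<Sum>i<q. 5/4 * (x i)^2 + 5 * (d i)^2)"
      unfolding n2_def
    proof (rule sum_mono)
      fix i
      \<comment> \<open>The weights give \<open>5/4 \<cdot> 16 q + 5 q = 25 q\<close>.\<close>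
      have "0 \<le> (x i / 2 + 2 * d i)^2" by simp
      then show "(x i - d i)^2 \<le> 5/4 * (x i)^2 + 5 * (d i)^2" by (simp add: power2_eq_square algebra_simps)
    qed
    also have "\<dots> = 5/4 * n2 x + 5 * n2 d" by (simp add: n2_def sum.distrib sum_distrib_left)
    also have "\<dots> \<le> 25 * real q" using x d2 by simp
    finally have "(\<Sum>i<q. (z i)^2) \<le> 25 * int q" by linarith
    from net[OF this] have Qz: "\<bar>Q (\<lambda>i. of_int (z i))\<bar> \<le> 25 * real q * L" by (simp add: Q_def)
    define s where "s i = x i + of_int (z i)" for i
    have s2: "n2 s \<le> 81 * real q"
    proof -
      have "n2 s \<le> (\<Sum>i<q. 9/2 * (x i)^2 + 9 * (d i)^2)"
        unfolding n2_def
      proof (rule sum_mono)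
        fix i
        \<comment> \<open>The weights give \<open>9/2 \<cdot> 16 q + 9 q = 81 q\<close>.\<close>
        have sqn: "0 \<le> (x i + 4 * d i)^2" by simp
        have si: "s i = 2 * x i - d i" by (simp add: s_def d_def)
        from sqn show "(s i)^2 \<le> 9/2 * (x i)^2 + 9 * (d i)^2" unfolding si by (simp add: power2_eq_square algebra_simps)
      qed
      also have "\<dots> = 9/2 * n2 x + 9 * n2 d" by (simp add: n2_def sum.distrib sum_distrib_left)
      also have "\<dots> \<le> 81 * real q" using x d2 by simp
      finally show ?thesis .
    qed
    have "Q x - Q (\<lambda>i. of_int (z i)) = bilin q R d s"
    proof -
      have "4 * bilin q R d s = 4 * (Q x - Q (\<lambda>i. of_int (z i)))"
      proof -
        have 1: "d i + s i = 2 * x i" and 2: "d i - s i = (-2) * of_int (z i)" for i by (simp_all add: d_def s_def)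
        show ?thesis
          using bilin_polarization[of R q d s, OF sym] unfolding 1 2 bilin_scale by (simp add: Q_def)
      qed
      then show ?thesis by simp
    qed
    moreover have "\<bar>bilin q R d s\<bar> \<le> 9 / 16 * S"
    proof -
      \<comment> \<open>The scaling balances the squared norms \<open>q\<close> of \<open>d\<close> and \<open>81 q\<close> of \<open>s\<close>.\<close>
      have "\<bar>bilin q R d s\<bar> = \<bar>bilin q R (\<lambda>i. 3 * d i) (\<lambda>i. (1/3) * s i)\<bar>" by (simp only: bilin_scale)
      also have "\<dots> \<le> S / (16 * real q) / 2 * (n2 (\<lambda>i. 3 * d i) + n2 (\<lambda>i. (1/3) * s i))"
        unfolding n2_def using hom by (intro bilin_le_of_quadratic sym) (simp add: Q_def n2_def)
      also have "n2 (\<lambda>i. 3 * d i) = 9 * n2 d" by (simp add: n2_def power_mult_distrib sum_distrib_left)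
      also have "n2 (\<lambda>i. (1/3) * s i) = n2 s / 9" by (simp add: n2_def power_mult_distrib power_divide sum_divide_distrib)
      also have "S / (16 * real q) / 2 * (9 * n2 d + n2 s / 9) \<le> S / (16 * real q) / 2 * (18 * real q)"
        using d2 s2 S0 by (intro mult_left_mono) auto
      finally show ?thesis using q by simp
    qed
    ultimately show ?thesis using Qz by linarith
  qed
  have "S \<le> 25 * real q * L + 9 / 16 * S"
    unfolding S_def by (rule cSUP_least) (use zero_in key[unfolded S_def] in auto)
  then have "S \<le> 16 / 7 * 25 * real q * L" by simp
  then have "S / (16 * real q) \<le> 25 / 7 * L" using q by (simp add: field_simps)
  moreover have "0 \<le> S / (16 * real q)" using S0 by simp
  ultimately have "S / (16 * real q) \<le> 4 * L" by linarith
  then have "S / (16 * real q) * n2 x \<le> 4 * L * n2 x" using n20 by (intro mult_right_mono) auto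
  with hom[of x] show ?thesis by (simp add: Q_def n2_def)
qed

lemma half_sum_cancel:
  assumes "0 < c" "c * b \<le> c / 2 * (b + a)"
  shows "b \<le> (a::real)"
proof -
  have "c * b \<le> c * ((b + a) / 2)" using assms(2) by simp
  then have "b \<le> (b + a) / 2" using assms(1) by (simp only: mult_le_cancel_left_pos)
  then show ?thesis by simp
qed

lemma operator_bound_of_quadratic:
  fixes R :: "nat \<Rightarrow> nat \<Rightarrow> real"
  assumes sym: "\<And>i j. R i j = R j i" and c: "c > 0" and B: "\<And>x. \<bar>bilin q R x x\<bar> \<le> c * (\<Sum>i<q. (x i)^2)"
  shows "(\<Sum>i<q. (\<Sum>j<q. R i j * x j)^2) \<le> c^2 * (\<Sum>i<q. (x i)^2)"
proof -
  define y where "y i = (1 / c) * (\<Sum>j<q. R i j * x j)" for i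
  have Rx: "(\<Sum>j<q. R i j * x j) = c * y i" for i using c by (simp add: y_def)
  have "bilin q R y x = (\<Sum>i<q. y i * (\<Sum>j<q. R i j * x j))" by (simp add: bilin_def sum_distrib_left mult_ac)
  also have "\<dots> = c * (\<Sum>i<q. (y i)^2)" unfolding Rx by (simp add: sum_distrib_left power2_eq_square mult_ac)
  finally have "c * (\<Sum>i<q. (y i)^2) \<le> c / 2 * ((\<Sum>i<q. (y i)^2) + (\<Sum>i<q. (x i)^2))"
    using bilin_le_of_quadratic[of R q c y x, OF sym B] by linarith
  then have "(\<Sum>i<q. (y i)^2) \<le> (\<Sum>i<q. (x i)^2)" by (rule half_sum_cancel[OF c])
  then have "c^2 * (\<Sum>i<q. (y i)^2) \<le> c^2 * (\<Sum>i<q. (x i)^2)" by (intro mult_left_mono) auto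
  then show ?thesis unfolding Rx by (simp add: power_mult_distrib sum_distrib_left)
qed

text \<open>
Lattice points of squared norm at most \<open>25 q\<close>. The bound on the single entries follows from the bound
on the sum of squares; it makes the set visibly finite.
\<close>

definition lattice_net :: "nat \<Rightarrow> (nat \<Rightarrow> int) set" where
  "lattice_net q = {z \<in> {..<q} \<rightarrow>\<^sub>E {- (25 * int q)..25 * int q}. (\<Sum>i<q. (z i)^2) \<le> 25 * int q}"

lemma finite_lattice_net: "finite (lattice_net q)"
  unfolding lattice_net_def by (auto intro!: finite_PiE)

lemma sum_half_power: "(\<Sum>a\<in>{- int B..int B}. (1/2::real) ^ nat \<bar>a\<bar>) = 3 - 2 * (1/2) ^ B"
proof (induction B)
  case (Suc B)
  have "{- int (Suc B)..int (Suc B)} = insert (int (Suc B)) (insert (- int (Suc B)) {- int B..int B})" by auto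
  then show ?case using Suc by (simp add: nat_add_distrib)
qed auto

text \<open>
Every net point \<open>z\<close> satisfies \<open>1 \<le> exp (25 q - \<parallel>z\<parallel>\<^sup>2)\<close>. Dropping the constraint on the norm, the sum of
the right-hand sides factorizes over the coordinates, and each factor is at most \<open>3 \<le> exp 2\<close>.
\<close>

lemma card_lattice_net: "real (card (lattice_net q)) \<le> exp (27 * real q)"
proof -
  let ?B = "{- (25 * int q)..25 * int q}"
  have one: "(\<Sum>a\<in>?B. exp (- ((real_of_int a)^2))) \<le> 3"
  proof -
    have "(\<Sum>a\<in>?B. exp (- ((real_of_int a)^2))) \<le> (\<Sum>a\<in>?B. (1/2) ^ nat \<bar>a\<bar>)"
    proof (rule sum_mono)
      fix a :: int
      have "real (nat \<bar>a\<bar>) \<le> (real_of_int a)^2"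
      proof (cases "a = 0")
        case False
        then have "1 \<le> \<bar>real_of_int a\<bar>" by linarith
        then have "\<bar>real_of_int a\<bar> * 1 \<le> \<bar>real_of_int a\<bar> * \<bar>real_of_int a\<bar>" by (intro mult_left_mono) auto
        then show ?thesis by (simp add: power2_eq_square)
      qed auto
      then have "exp (- ((real_of_int a)^2)) \<le> exp (- real (nat \<bar>a\<bar>))" by simp
      also have "\<dots> = exp (- 1) ^ nat \<bar>a\<bar>" by (simp flip: exp_of_nat_mult)
      also have "\<dots> \<le> (1/2) ^ nat \<bar>a\<bar>"
        using exp_ge_add_one_self[of 1] by (intro power_mono) (auto simp: exp_minus field_simps)
      finally show "exp (- ((real_of_int a)^2)) \<le> (1/2) ^ nat \<bar>a\<bar>" .
    qed
    also have "\<dots> = 3 - 2 * (1/2) ^ (25 * q)" using sum_half_power[of "25 * q"] by simp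
    also have "\<dots> \<le> 3" by simp
    finally show ?thesis by simp
  qed
  have "real (card (lattice_net q)) = (\<Sum>z\<in>lattice_net q. 1)" by simp
  also have "\<dots> \<le> (\<Sum>z\<in>lattice_net q. exp (25 * real q) * (\<Prod>i<q. exp (- ((real_of_int (z i))^2))))"
  proof (rule sum_mono)
    fix z assume "z \<in> lattice_net q"
    then have "(\<Sum>i<q. (z i)^2) \<le> 25 * int q" by (simp add: lattice_net_def)
    then have "real_of_int (\<Sum>i<q. (z i)^2) \<le> 25 * real q" by linarith
    then have "0 \<le> 25 * real q + (\<Sum>i<q. - ((real_of_int (z i))^2))" by (simp add: sum_negf)
    then have "1 \<le> exp (25 * real q + (\<Sum>i<q. - ((real_of_int (z i))^2)))" by (rule one_le_exp_iff[THEN iffD2])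
    also have "\<dots> = exp (25 * real q) * (\<Prod>i<q. exp (- ((real_of_int (z i))^2)))"
      unfolding exp_add by (subst exp_sum) simp_all
    finally show "1 \<le> exp (25 * real q) * (\<Prod>i<q. exp (- ((real_of_int (z i))^2)))" .
  qed
  also have "\<dots> \<le> (\<Sum>z\<in>{..<q} \<rightarrow>\<^sub>E ?B. exp (25 * real q) * (\<Prod>i<q. exp (- ((real_of_int (z i))^2))))"
  proof (rule sum_mono2)
    show "finite ({..<q} \<rightarrow>\<^sub>E ?B)" by (intro finite_PiE) simp_all
    show "lattice_net q \<subseteq> {..<q} \<rightarrow>\<^sub>E ?B" unfolding lattice_net_def by blast
  qed (intro mult_nonneg_nonneg prod_nonneg; simp)
  also have "\<dots> = exp (25 * real q) * (\<Prod>i<q. \<Sum>a\<in>?B. exp (- ((real_of_int a)^2)))"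
    unfolding sum_distrib_left[symmetric]
    by (rule arg_cong[where f = "\<lambda>x. exp (25 * real q) * x"], rule prod_sum_PiE[symmetric]) simp_all
  also have "\<dots> \<le> exp (25 * real q) * (\<Prod>i<q. exp 2)"
  proof (intro mult_left_mono prod_mono conjI)
    have "(3::real) \<le> exp 2" using exp_ge_add_one_self[of 2] by simp
    then show "(\<Sum>a\<in>?B. exp (- ((real_of_int a)^2))) \<le> exp 2" using one by linarith
  qed (auto intro: sum_nonneg)
  also have "\<dots> = exp (27 * real q)" by (simp flip: exp_of_nat_mult exp_add)
  finally show ?thesis .
qed

text \<open>
The real and the imaginary part of \<open>G\<close> are real symmetric matrices, to which the net argument applies
separately.
\<close>

lemma complex_operator_bound:
  fixes G :: "nat \<Rightarrow> nat \<Rightarrow> complex"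
  assumes q: "q > 0" and sym: "\<And>i j. G i j = G j i" and L: "L > 0"
    and net: "\<And>z. z \<in> lattice_net q \<Longrightarrow> 
       \<bar>Re (\<Sum>i<q. \<Sum>j<q. G i j * of_int (z i) * of_int (z j))\<bar> \<le> 25 * real q * L \<and>
       \<bar>Im (\<Sum>i<q. \<Sum>j<q. G i j * of_int (z i) * of_int (z j))\<bar> \<le> 25 * real q * L"
  shows "(\<Sum>i<q. norm (\<Sum>j<q. G i j * x j)^2) \<le> (8 * L)^2 * (\<Sum>i<q. norm (x i)^2)"
proof -
  have netz: "\<bar>bilin q (\<lambda>i j. Re (G i j)) (\<lambda>i. of_int (z i)) (\<lambda>i. of_int (z i))\<bar> \<le> 25 * real q * L \<and>
     \<bar>bilin q (\<lambda>i j. Im (G i j)) (\<lambda>i. of_int (z i)) (\<lambda>i. of_int (z i))\<bar> \<le> 25 * real q * L"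
    if z: "(\<Sum>i<q. (z i)^2) \<le> 25 * int q" for z :: "nat \<Rightarrow> int"
  proof -
    define z' where "z' = restrict z {..<q}"
    have "\<bar>z i\<bar> \<le> 25 * int q" if "i < q" for i
    proof -
      have "(z i)^2 \<le> 25 * int q"
        using member_le_sum[of i "{..<q}" "\<lambda>i. (z i)^2"] that z by simp
      moreover have "\<bar>z i\<bar> \<le> (z i)^2"
      proof (cases "z i = 0")
        case False
        then have "\<bar>z i\<bar> * 1 \<le> \<bar>z i\<bar> * \<bar>z i\<bar>" by (intro mult_left_mono) auto
        then show ?thesis by (simp add: power2_eq_square)
      qed auto
      ultimately show ?thesis by simp
    qed
    then have "z' \<in> lattice_net q" using z by (auto simp: lattice_net_def z'_def abs_le_iff minus_le_iff)
    note N = net[OF this]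
    have "(\<Sum>i<q. \<Sum>j<q. G i j * of_int (z' i) * of_int (z' j)) = (\<Sum>i<q. \<Sum>j<q. G i j * of_int (z i) * of_int (z j))"
      by (simp add: z'_def)
    with N show ?thesis by (simp add: bilin_def Re_sum Im_sum)
  qed
  have R: "(\<Sum>i<q. (\<Sum>j<q. Re (G i j) * y j)^2) \<le> (4 * L)^2 * (\<Sum>i<q. (y i)^2)" for y
    using netz sym L q by (intro operator_bound_of_quadratic quadratic_bound_from_lattice) auto
  have I: "(\<Sum>i<q. (\<Sum>j<q. Im (G i j) * y j)^2) \<le> (4 * L)^2 * (\<Sum>i<q. (y i)^2)" for y
    using netz sym L q by (intro operator_bound_of_quadratic quadratic_bound_from_lattice) auto
  have sq: "(a - b)^2 \<le> 2 * a^2 + 2 * b^2" "(a + b)^2 \<le> 2 * a^2 + 2 * b^2" for a b :: real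
    using zero_le_power2[of "a + b"] zero_le_power2[of "a - b"] by (simp_all add: power2_eq_square algebra_simps)
  have "(\<Sum>i<q. norm (\<Sum>j<q. G i j * x j)^2) = 
     (\<Sum>i<q. ((\<Sum>j<q. Re (G i j) * Re (x j)) - (\<Sum>j<q. Im (G i j) * Im (x j)))^2 + 
             ((\<Sum>j<q. Re (G i j) * Im (x j)) + (\<Sum>j<q. Im (G i j) * Re (x j)))^2)"
    by (simp add: cmod_power2 Re_sum Im_sum sum_subtractf sum.distrib)
  also have "\<dots> \<le> (\<Sum>i<q. 2 * (\<Sum>j<q. Re (G i j) * Re (x j))^2 + 2 * (\<Sum>j<q. Im (G i j) * Im (x j))^2 + 
             (2 * (\<Sum>j<q. Re (G i j) * Im (x j))^2 + 2 * (\<Sum>j<q. Im (G i j) * Re (x j))^2))"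
    by (intro sum_mono add_mono sq)
  also have "\<dots> \<le> 2 * ((4 * L)^2 * (\<Sum>i<q. (Re (x i))^2)) + 2 * ((4 * L)^2 * (\<Sum>i<q. (Im (x i))^2)) + 
     (2 * ((4 * L)^2 * (\<Sum>i<q. (Im (x i))^2)) + 2 * ((4 * L)^2 * (\<Sum>i<q. (Re (x i))^2)))"
    unfolding sum.distrib sum_distrib_left[symmetric] by (intro add_mono mult_left_mono R I) auto
  also have "\<dots> = (8 * L)^2 * (\<Sum>i<q. norm (x i)^2)"
    by (simp add: cmod_power2 sum.distrib algebra_simps)
  finally show ?thesis .
qed

lemma frobenius_fmat_pow_bound:
  fixes G Y :: "nat \<Rightarrow> nat \<Rightarrow> complex"
  assumes sym: "\<And>i j. G i j = G j i" and B: "\<And>x. (\<Sum>i<q. norm (\<Sum>j<q. G i j * x j)^2) \<le> c * (\<Sum>i<q. norm (x i)^2)"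
    and c: "c \<ge> 0"
  shows "(\<Sum>r<p. \<Sum>s<q. norm (fmat_mult q Y (fmat_pow q G m) r s)^2) \<le> c ^ m * (\<Sum>r<p. \<Sum>s<q. norm (Y r s)^2)"
proof (induction m)
  case 0
  have "fmat_mult q Y (fmat_pow q G 0) r s = Y r s" if "s < q" for r s
    using that by (simp add: fmat_mult_def if_distrib[of "\<lambda>x. _ * x"] cong: if_cong)
  then show ?case by (simp del: fmat_pow.simps)
next
  case (Suc m)
  have "fmat_mult q Y (fmat_pow q G (Suc m)) r s = (\<Sum>j<q. G s j * fmat_mult q Y (fmat_pow q G m) r j)" if "s < q" for r s
  proof -
    have "fmat_mult q Y (fmat_pow q G (Suc m)) r s = fmat_mult q Y (fmat_mult q (fmat_pow q G m) G) r s"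
      using that by (intro fmat_mult_cong) (auto simp: fmat_pow_Suc_right simp del: fmat_pow.simps)
    also have "\<dots> = fmat_mult q (fmat_mult q Y (fmat_pow q G m)) G r s" by (simp only: fmat_mult_assoc)
    also have "\<dots> = (\<Sum>j<q. G s j * fmat_mult q Y (fmat_pow q G m) r j)"
      unfolding fmat_mult_def[of q "fmat_mult q Y (fmat_pow q G m)"] by (intro sum.cong refl) (simp add: sym[of _ s] mult.commute)
    finally show ?thesis .
  qed
  then have "(\<Sum>r<p. \<Sum>s<q. norm (fmat_mult q Y (fmat_pow q G (Suc m)) r s)^2) = (\<Sum>r<p. \<Sum>s<q. norm (\<Sum>j<q. G s j * fmat_mult q Y (fmat_pow q G m) r j)^2)"
    by (simp del: fmat_pow.simps)
  also have "\<dots> \<le> (\<Sum>r<p. c * (\<Sum>s<q. norm (fmat_mult q Y (fmat_pow q G m) r s)^2))"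
    by (intro sum_mono B)
  also have "\<dots> \<le> c * (c ^ m * (\<Sum>r<p. \<Sum>s<q. norm (Y r s)^2))"
    unfolding sum_distrib_left[symmetric] by (intro mult_left_mono Suc.IH c)
  finally show ?case by (simp add: mult.assoc)
qed


section \<open>Fluctuations of the statistics $U_k$\<close>

text \<open>
Beyond \<open>N \<ge> n\<close> the function \<open>t\<^sup>n exp (-t)\<close> is decreasing. This turns an exponential moment of size
\<open>exp (O(N))\<close> into moments of order up to \<open>N\<close>, without losing a power of the exponential moment.
\<close>

lemma power_le_exp:
  assumes "0 \<le> t" "real n \<le> N" "0 < N"
  shows "t ^ n \<le> N ^ n * (1 + exp (t - N))"
proof (cases "t \<le> N")
  case True
  then have "t ^ n \<le> N ^ n" using assms by (intro power_mono) auto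
  also have "N ^ n * 1 \<le> N ^ n * (1 + exp (t - N))" using assms by (intro mult_left_mono) auto
  finally show ?thesis by simp
next
  case False
  have "t / N \<le> exp (t / N - 1)" using exp_ge_add_one_self[of "t / N - 1"] by simp
  then have "(t / N) ^ n \<le> exp (t / N - 1) ^ n" using assms by (intro power_mono) auto
  also have "\<dots> = exp (real n * (t / N - 1))" by (simp add: exp_of_nat_mult)
  also have "\<dots> \<le> exp (N * (t / N - 1))" using False assms by (simp add: mult_right_mono)
  also have "N * (t / N - 1) = t - N" using assms by (simp add: right_diff_distrib)
  finally have "(t / N) ^ n \<le> 1 + exp (t - N)" by simp
  then have "N ^ n * (t / N) ^ n \<le> N ^ n * (1 + exp (t - N))" using assms by (intro mult_left_mono) auto
  moreover have "N ^ n * (t / N) ^ n = t ^ n" using assms by (simp flip: power_mult_distrib)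
  ultimately show ?thesis by simp
qed

lemma nn_integral_cgauss_PiM_component:
  assumes "finite I" "i \<in> I" and [measurable]: "f \<in> borel_measurable borel"
  shows "(\<integral>\<^sup>+w. f (w i) \<partial>(\<Pi>\<^sub>M i\<in>I. cgauss)) = (\<integral>\<^sup>+z. f z \<partial>cgauss)"
proof -
  have "(\<integral>\<^sup>+w. f (w i) \<partial>(\<Pi>\<^sub>M i\<in>I. cgauss)) = (\<integral>\<^sup>+w. (\<Prod>j\<in>I. (if j = i then f else (\<lambda>_. 1)) (w j)) \<partial>(\<Pi>\<^sub>M i\<in>I. cgauss))"
  proof (intro nn_integral_cong)
    fix w :: "'a \<Rightarrow> complex"
    have "(\<Prod>j\<in>I. (if j = i then f else (\<lambda>_. 1)) (w j)) = (\<Prod>j\<in>I. if j = i then f (w i) else 1)"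
      by (intro prod.cong) auto
    then show "f (w i) = (\<Prod>j\<in>I. (if j = i then f else (\<lambda>_. 1)) (w j))" using assms by simp
  qed
  also have "\<dots> = (\<Prod>j\<in>I. \<integral>\<^sup>+z. (if j = i then f else (\<lambda>_. 1)) z \<partial>cgauss)"
    by (rule Pcg.product_nn_integral_prod) (use assms in auto)
  also have "\<dots> = (\<Prod>j\<in>I. if j = i then (\<integral>\<^sup>+z. f z \<partial>cgauss) else 1)"
    using cgauss.emeasure_space_1 by (intro prod.cong) auto
  finally show ?thesis using assms by simp
qed

lemma cgauss_fourth_moment: "(\<integral>\<^sup>+z. ennreal (norm z ^ 4) \<partial>cgauss) = 8"
proof -
  have "(\<integral>\<^sup>+z. ennreal (norm z ^ 4) \<partial>cgauss) = (\<integral>\<^sup>+z. ennreal (norm (poly (monom 1 2) z) ^ 2) \<partial>cgauss)"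
    by (simp add: poly_monom norm_power flip: power_mult)
  also have "\<dots> = ennreal 8"
    unfolding nn_integral_cgauss_poly by (simp add: degree_monom_eq numeral_2_eq_2)
  finally show ?thesis by simp
qed

lemma nn_integral_affine:
  assumes [measurable]: "f \<in> borel_measurable M" "g \<in> borel_measurable M"
  shows "(\<integral>\<^sup>+x. c + d * f x + e * g x \<partial>M) = c * emeasure M (space M) + d * (\<integral>\<^sup>+x. f x \<partial>M) + e * (\<integral>\<^sup>+x. g x \<partial>M)"
  by (subst nn_integral_add, (measurable)[2], subst nn_integral_add, (measurable)[2]) (simp add: nn_integral_cmult)

text \<open>
What the fluctuation bounds use of the matrix \<open>A\<close>: its operator and Frobenius norms are those of a
matrix with singular values in \<open>[0, T]\<close>, up to constants.
\<close>

locale bounded_signal =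
  fixes p q :: nat and a :: "nat \<Rightarrow> nat \<Rightarrow> real" and T :: real
  assumes q: "q > 0" and qp: "q \<le> p" and T: "T > 0" and pq: "real p * real q \<le> T ^ 4"
    and opnorm: "\<And>x. (\<Sum>r<p. (\<Sum>s<q. a r s * x s)^2) \<le> 2 * T^2 * (\<Sum>s<q. (x s)^2)"
    and frob: "(\<Sum>r<p. \<Sum>s<q. (a r s)^2) \<le> real q * T^2"
begin

abbreviation I :: "(nat \<times> nat) set" where "I \<equiv> {..<p} \<times> {..<q}"
abbreviation W :: "(nat \<times> nat \<Rightarrow> complex) measure" where "W \<equiv> \<Pi>\<^sub>M i\<in>I. cgauss"

definition Y :: "(nat \<times> nat \<Rightarrow> complex) \<Rightarrow> nat \<Rightarrow> nat \<Rightarrow> complex" where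
  "Y w r s = of_real (a r s) + w (r, s)"

lemma emeasure_W: "emeasure W (space W) = 1"
proof -
  interpret P: prob_space W by (rule prob_space_PiM) (rule prob_space_cgauss)
  show ?thesis by (rule P.emeasure_space_1)
qed

lemma q_le_T2: "real q \<le> T^2"
proof -
  have "(real q)^2 \<le> real p * real q" using qp by (simp add: power2_eq_square mult_right_mono)
  also have "\<dots> \<le> (T^2)^2" using pq by (simp flip: power_mult)
  finally show ?thesis by (rule power2_le_imp_le) simp
qed

lemma measurable_Y: "r < p \<Longrightarrow> s < q \<Longrightarrow> (\<lambda>w. Y w r s) \<in> borel_measurable W"
  unfolding Y_def by auto

lemma measurable_gram_Y: "i < q \<Longrightarrow> j < q \<Longrightarrow> (\<lambda>w. gram p (Y w) i j) \<in> borel_measurable W"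
  unfolding gram_def by (intro borel_measurable_sum borel_measurable_times measurable_Y) auto

lemma measurable_pow_gram_Y: "i < q \<Longrightarrow> j < q \<Longrightarrow> (\<lambda>w. fmat_pow q (gram p (Y w)) k i j) \<in> borel_measurable W"
proof (induction k arbitrary: i j)
  case (Suc k)
  then show ?case unfolding fmat_pow.simps fmat_mult_def
    by (intro borel_measurable_sum borel_measurable_times measurable_gram_Y) auto
qed auto

lemma measurable_grad: "r < p \<Longrightarrow> s < q \<Longrightarrow> (\<lambda>w. fmat_mult q (Y w) (fmat_pow q (gram p (Y w)) m) r s) \<in> borel_measurable W"
  unfolding fmat_mult_def by (intro borel_measurable_sum borel_measurable_times measurable_Y measurable_pow_gram_Y) auto

lemma measurable_cycle: "k > 0 \<Longrightarrow> (\<lambda>w. cycle_poly k p q (Y w)) \<in> borel_measurable W"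
  unfolding cycle_poly_eq_trace fmat_trace_def by (intro borel_measurable_sum measurable_pow_gram_Y) auto

lemma Y_upd: "Y (w((r, s) := z)) = (\<lambda>b c. poly (perturb r s (of_real (a r s)) (Y w) b c) z)"
  by (intro ext) (auto simp: Y_def perturb_def)

text \<open>
The value of \<open>tr (Y\<^sup>T Y)\<^sup>k\<close> without noise.
\<close>

definition clean_cycle :: "nat \<Rightarrow> real" where "clean_cycle k = cycle_poly k p q a"

lemma of_real_clean_cycle: "cycle_poly k p q (\<lambda>r s. complex_of_real (a r s)) = of_real (clean_cycle k)"
  by (simp add: cycle_poly_def clean_cycle_def)

text \<open>
Up to the factor \<open>4 (m + 1)\<^sup>2\<close>, the squared norm of the gradient of \<open>tr (Y\<^sup>T Y)\<^sup>m\<^sup>+\<^sup>1\<close>.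
\<close>

definition grad_sq :: "nat \<Rightarrow> (nat \<times> nat \<Rightarrow> complex) \<Rightarrow> real" where
  "grad_sq m w = (\<Sum>r<p. \<Sum>s<q. norm (fmat_mult q (Y w) (fmat_pow q (gram p (Y w)) m) r s)^2)"

lemma Poincare_cycle:
  assumes k: "k > 0"
  shows "(\<integral>\<^sup>+w. ennreal (norm (cycle_poly k p q (Y w) - of_real (clean_cycle k)) ^ 2) \<partial>W) \<le>
     ennreal (8 * real k ^ 2) * (\<integral>\<^sup>+w. ennreal (grad_sq (k - 1) w) \<partial>W)"
proof -
  define F where "F w = cycle_poly k p q (Y w) - of_real (clean_cycle k)" for w
  define F' where "F' i w = of_nat (2 * k) * fmat_mult q (Y w) (fmat_pow q (gram p (Y w)) (k - 1)) (fst i) (snd i)" for i w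
  have F: "F w = fmat_trace q (fmat_pow q (gram p (Y w)) k) - of_real (clean_cycle k)" for w
    by (simp add: F_def cycle_poly_eq_trace k)
  have P: "(\<integral>\<^sup>+w. ennreal (norm (F w) ^ 2) \<partial>W) \<le>
    ennreal (norm (F (\<lambda>i. if i \<in> I then 0 else undefined)) ^ 2) + 
     2 * (\<Sum>i\<in>I. \<integral>\<^sup>+w. ennreal (norm (F' i w) ^ 2) \<partial>W)"
  proof (rule cgauss_PiM_Poincare)
    show "F \<in> borel_measurable W" unfolding F_def using measurable_cycle[OF k] by simp
    show "F' i \<in> borel_measurable W" if "i \<in> I" for i
      unfolding F'_def using that by (intro borel_measurable_times measurable_grad) auto
    show "\<exists>g. \<forall>z. F (w(i := z)) = poly g z \<and> F' i (w(i := z)) = poly (pderiv g) z" if iI: "i \<in> I" for i w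
    proof -
      obtain r s where i: "i = (r, s)" and rs: "r < p" "s < q" using iI by (cases i) auto
      define Yp where "Yp = perturb r s (of_real (a r s)) (Y w)"
      define g where "g = fmat_trace q (fmat_pow q (gram p Yp) k) - [:of_real (clean_cycle k):]"
      have "pderiv g = of_nat (2 * k) * fmat_mult q Yp (fmat_pow q (gram p Yp) (k - 1)) r s"
        unfolding g_def pderiv_diff 
        by (subst pderiv_fmat_trace_gram[OF rs]) (auto simp: Yp_def perturb_def pderiv_pCons)
      then show ?thesis
        by (intro exI[of _ g]) (simp add: i F F'_def g_def Y_upd Yp_def[symmetric] poly_fmat_trace poly_fmat_pow poly_gram poly_fmat_mult)
    qed
    show "\<exists>g. \<forall>z. F' i (w(j := z)) = poly g z" if "j \<in> I" for i j w
    proof -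
      obtain r s where j: "j = (r, s)" by (cases j)
      define Yp where "Yp = perturb r s (of_real (a r s)) (Y w)"
      show ?thesis
        by (intro exI[of _ "of_nat (2 * k) * fmat_mult q Yp (fmat_pow q (gram p Yp) (k - 1)) (fst i) (snd i)"])
           (simp add: j F'_def Y_upd Yp_def[symmetric] poly_fmat_trace poly_fmat_pow poly_gram poly_fmat_mult)
    qed
  qed auto
  have "F (\<lambda>i. if i \<in> I then 0 else undefined) = 0"
  proof -
    let ?w = "\<lambda>i. if i \<in> I then 0 else undefined"
    have "cycle_poly k p q (Y ?w) = cycle_poly k p q (\<lambda>r s. complex_of_real (a r s))"
      unfolding cycle_poly_eq_trace[OF k] by (intro fmat_trace_cong fmat_pow_cong) (auto simp: gram_def Y_def intro!: sum.cong)
    then show ?thesis by (simp add: F_def of_real_clean_cycle)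
  qed
  then have "(\<integral>\<^sup>+w. ennreal (norm (F w) ^ 2) \<partial>W) \<le> 2 * (\<Sum>i\<in>I. \<integral>\<^sup>+w. ennreal (norm (F' i w) ^ 2) \<partial>W)"
    using P by simp
  also have "(\<Sum>i\<in>I. \<integral>\<^sup>+w. ennreal (norm (F' i w) ^ 2) \<partial>W) = (\<integral>\<^sup>+w. (\<Sum>i\<in>I. ennreal (norm (F' i w) ^ 2)) \<partial>W)"
  proof (rule nn_integral_sum[symmetric])
    fix i assume "i \<in> I"
    then have [measurable]: "F' i \<in> borel_measurable W"
      unfolding F'_def by (intro borel_measurable_times measurable_grad) auto
    show "(\<lambda>w. ennreal (norm (F' i w) ^ 2)) \<in> borel_measurable W" by measurable
  qed
  also have "(\<lambda>w. \<Sum>i\<in>I. ennreal (norm (F' i w) ^ 2)) = (\<lambda>w. ennreal ((2 * real k)^2) * ennreal (grad_sq (k - 1) w))"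
  proof
    fix w
    have "(\<Sum>i\<in>I. norm (F' i w) ^ 2) = (2 * real k)^2 * grad_sq (k - 1) w"
      by (simp add: grad_sq_def F'_def norm_mult power_mult_distrib sum.cartesian_product case_prod_beta' sum_distrib_left)
    then show "(\<Sum>i\<in>I. ennreal (norm (F' i w) ^ 2)) = ennreal ((2 * real k)^2) * ennreal (grad_sq (k - 1) w)"
      by (simp add: sum_ennreal ennreal_mult')
  qed
  also have "2 * (\<integral>\<^sup>+w. ennreal ((2 * real k)^2) * ennreal (grad_sq (k - 1) w) \<partial>W) = 2 * ennreal ((2 * real k)^2) * (\<integral>\<^sup>+w. ennreal (grad_sq (k - 1) w) \<partial>W)"
  proof -
    have "(\<lambda>w. ennreal (grad_sq (k - 1) w)) \<in> borel_measurable W"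
      unfolding grad_sq_def using measurable_grad by (intro measurable_compose[OF _ measurable_ennreal] borel_measurable_sum borel_measurable_power borel_measurable_norm) auto
    then show ?thesis by (simp add: nn_integral_cmult mult.assoc)
  qed
  also have "2 * ennreal ((2 * real k)^2) = ennreal (8 * real k ^ 2)"
    by (subst ennreal_numeral[symmetric], subst ennreal_mult'[symmetric]) (auto simp: power_mult_distrib)
  finally show ?thesis unfolding F_def .
qed

text \<open>
The largest rate, up to a constant, at which the exponential moments of the quadratic forms are still
\<open>exp (O(q))\<close>, that is, of the order of the cardinality of the net.
\<close>

definition rate :: real where "rate = real q / (4 * T^2)"

lemma rate: "0 < rate" "rate \<le> 1/4"
  using q T q_le_T2 by (auto simp: rate_def field_simps)

text \<open>
Net points scaled to norm at most \<open>1\<close>.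
\<close>

definition net_vec :: "(nat \<Rightarrow> int) \<Rightarrow> nat \<Rightarrow> real" where "net_vec z i = of_int (z i) / (5 * sqrt (real q))"
definition net_image :: "(nat \<Rightarrow> int) \<Rightarrow> nat \<Rightarrow> real" where "net_image z r = (\<Sum>s<q. a r s * net_vec z s)"
definition net_form :: "(nat \<Rightarrow> int) \<Rightarrow> (nat \<times> nat \<Rightarrow> complex) \<Rightarrow> complex" where
  "net_form z w = quad_form p q (net_image z) (net_vec z) w"

lemma gram_quadratic: 
  "(\<Sum>i<q. \<Sum>j<q. gram p (Y w) i j * of_int (z i) * of_int (z j)) = of_real (25 * real q) * net_form z w"
proof -
  let ?c = "complex_of_real (5 * sqrt (real q))"
  have zi: "of_int (z i) = ?c * of_real (net_vec z i)" for i
    using q by (simp add: net_vec_def)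
  have c2: "?c * ?c = of_real (25 * real q)" by (simp flip: of_real_mult)
  have lin: "of_real (net_image z r) + (\<Sum>s<q. of_real (net_vec z s) * w (r, s)) = (\<Sum>s<q. Y w r s * of_real (net_vec z s))" for r
    by (simp add: net_image_def Y_def sum.distrib algebra_simps)
  have "(\<Sum>i<q. \<Sum>j<q. gram p (Y w) i j * of_int (z i) * of_int (z j)) = 
    (\<Sum>i<q. \<Sum>j<q. \<Sum>r<p. (?c * ?c) * ((Y w r i * of_real (net_vec z i)) * (Y w r j * of_real (net_vec z j))))"
    unfolding zi gram_def sum_distrib_right by (intro sum.cong refl) (simp add: mult_ac)
  also have "\<dots> = (\<Sum>i<q. \<Sum>r<p. \<Sum>j<q. (?c * ?c) * ((Y w r i * of_real (net_vec z i)) * (Y w r j * of_real (net_vec z j))))"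
    by (intro sum.cong refl sum.swap)
  also have "\<dots> = (\<Sum>r<p. \<Sum>i<q. \<Sum>j<q. (?c * ?c) * ((Y w r i * of_real (net_vec z i)) * (Y w r j * of_real (net_vec z j))))"
    by (rule sum.swap)
  also have "\<dots> = (?c * ?c) * (\<Sum>r<p. (\<Sum>i<q. Y w r i * of_real (net_vec z i)) * (\<Sum>j<q. Y w r j * of_real (net_vec z j)))"
  proof -
    have "(\<Sum>i<q. Y w r i * of_real (net_vec z i)) * (\<Sum>j<q. Y w r j * of_real (net_vec z j)) = 
       (\<Sum>i<q. \<Sum>j<q. (Y w r i * of_real (net_vec z i)) * (Y w r j * of_real (net_vec z j)))" for r
      by (rule sum_product)
    then show ?thesis by (simp only: sum_distrib_left)
  qed
  also have "\<dots> = (?c * ?c) * net_form z w" unfolding net_form_def quad_form_def lin by (simp add: power2_eq_square)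
  finally show ?thesis unfolding c2 .
qed

text \<open>
A union bound in additive form: the logarithm of \<open>exp_total\<close> dominates \<open>rate\<close> times the real and
imaginary parts, with both signs, of all quadratic forms on the net.
\<close>

definition exp_total :: "(nat \<times> nat \<Rightarrow> complex) \<Rightarrow> real" where
  "exp_total w = (\<Sum>z\<in>lattice_net q. \<Sum>th\<in>{1, -1, \<i>, -\<i>}. exp (rate * Re (th * net_form z w)))"

lemma zero_in_net: "(\<lambda>i\<in>{..<q}. 0) \<in> lattice_net q"
  by (auto simp: lattice_net_def)

lemma exp_le_exp_total: "z \<in> lattice_net q \<Longrightarrow> th \<in> {1, -1, \<i>, -\<i>} \<Longrightarrow> exp (rate * Re (th * net_form z w)) \<le> exp_total w"
  unfolding exp_total_def
  by (rule order.trans[OF member_le_sum[of th] member_le_sum[of z]])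
     (auto simp: finite_lattice_net simp del: sum.insert intro!: sum_nonneg)

lemma exp_total_gt_1: "exp_total w > 1"
proof -
  define z where "z = (\<lambda>i\<in>{..<q}. 0::int)"
  have v0: "net_vec z s = 0" if "s < q" for s using that by (simp add: net_vec_def z_def)
  have "net_form z w = 0" by (simp add: net_form_def quad_form_def net_image_def v0)
  then have "4 = (\<Sum>th\<in>{1, -1, \<i>, -\<i>}. exp (rate * Re (th * net_form z w)))" by (simp add: complex_eq_iff)
  also have "\<dots> \<le> exp_total w"
    unfolding exp_total_def using zero_in_net
    by (intro member_le_sum[of z]) (auto simp: finite_lattice_net z_def simp del: sum.insert intro!: sum_nonneg)
  finally show ?thesis by simp
qed

lemma net_form_bound:
  assumes z: "z \<in> lattice_net q"
  shows "\<bar>Re (net_form z w)\<bar> \<le> ln (exp_total w) / rate" "\<bar>Im (net_form z w)\<bar> \<le> ln (exp_total w) / rate"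
proof -
  have "Re (th * net_form z w) \<le> ln (exp_total w) / rate" if "th \<in> {1, -1, \<i>, -\<i>}" for th
  proof -
    have "rate * Re (th * net_form z w) \<le> ln (exp_total w)"
      using exp_le_exp_total[OF z that, of w] exp_total_gt_1[of w] by (subst ln_ge_iff) auto
    then show ?thesis using rate by (simp add: field_simps)
  qed
  from this[of 1] this[of "-1"] this[of \<i>] this[of "-\<i>"]
  show "\<bar>Re (net_form z w)\<bar> \<le> ln (exp_total w) / rate" "\<bar>Im (net_form z w)\<bar> \<le> ln (exp_total w) / rate" by auto
qed

lemma grad_sq_bound: "grad_sq m w \<le> ((8 * (ln (exp_total w) / rate))^2) ^ m * (\<Sum>r<p. \<Sum>s<q. norm (Y w r s)^2)"
  unfolding grad_sq_def
proof (rule frobenius_fmat_pow_bound[OF gram_sym])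
  fix x
  show "(\<Sum>i<q. norm (\<Sum>j<q. gram p (Y w) i j * x j)^2) \<le> (8 * (ln (exp_total w) / rate))^2 * (\<Sum>i<q. norm (x i)^2)"
  proof (rule complex_operator_bound[OF q gram_sym])
    show "0 < ln (exp_total w) / rate" using exp_total_gt_1[of w] rate by (intro divide_pos_pos ln_gt_zero)
    fix z assume "z \<in> lattice_net q"
    note B = net_form_bound[OF this, of w]
    have "25 * real q * \<bar>Re (net_form z w)\<bar> \<le> 25 * real q * (ln (exp_total w) / rate)" 
      "25 * real q * \<bar>Im (net_form z w)\<bar> \<le> 25 * real q * (ln (exp_total w) / rate)"
      by (intro mult_left_mono B; simp)+
    then show "\<bar>Re (\<Sum>i<q. \<Sum>j<q. gram p (Y w) i j * of_int (z i) * of_int (z j))\<bar> \<le> 25 * real q * (ln (exp_total w) / rate) \<and>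
       \<bar>Im (\<Sum>i<q. \<Sum>j<q. gram p (Y w) i j * of_int (z i) * of_int (z j))\<bar> \<le> 25 * real q * (ln (exp_total w) / rate)"
      unfolding gram_quadratic by (simp add: abs_mult)
  qed
qed simp

lemma exp_total_integral: "(\<integral>\<^sup>+w. ennreal (exp_total w) \<partial>W) \<le> ennreal (exp (31 * real q))"
proof -
  have one: "(\<integral>\<^sup>+w. ennreal (exp (rate * Re (th * net_form z w))) \<partial>W) \<le> ennreal (exp (2 * real q))"
    if z: "z \<in> lattice_net q" and th: "th \<in> {1, -1, \<i>, -\<i>}" for z th
  proof -
    have "(\<Sum>i<q. (z i)^2) \<le> 25 * int q" using z by (simp add: lattice_net_def)
    then have "real_of_int (\<Sum>i<q. (z i)^2) \<le> 25 * real q" by linarith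
    then have S: "(\<Sum>s<q. (net_vec z s)^2) \<le> 1"
      using q by (simp add: net_vec_def power_divide power_mult_distrib flip: sum_divide_distrib)
    have img: "(\<Sum>r<p. (net_image z r)^2) \<le> 2 * T^2"
      using opnorm[of "net_vec z"] mult_left_mono[OF S, of "2 * T^2"] by (simp add: net_image_def)
    have "(\<integral>\<^sup>+w. ennreal (exp (rate * Re (th * net_form z w))) \<partial>W) \<le> ennreal (exp (4 * rate^2 * real p + 2 * rate * (\<Sum>r<p. (net_image z r)^2)))"
      unfolding net_form_def by (rule quad_form_mgf[OF rate S th])
    also have "\<dots> \<le> ennreal (exp (2 * real q))"
    proof (intro ennreal_leI, subst exp_le_cancel_iff)
      have "4 * rate^2 * real p = (real q / 4) * ((real p * real q) / T^4)"
        using T by (simp add: rate_def power_divide power_mult_distrib field_simps power2_eq_square power4_eq_xxxx)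
      also have "\<dots> \<le> (real q / 4) * 1" using pq T by (intro mult_left_mono) (auto simp: field_simps)
      finally have 1: "4 * rate^2 * real p \<le> real q / 4" by simp
      have "2 * rate * (\<Sum>r<p. (net_image z r)^2) \<le> 2 * rate * (2 * T^2)" using rate by (intro mult_left_mono img) auto
      also have "\<dots> = real q" using T by (simp add: rate_def)
      finally show "4 * rate^2 * real p + 2 * rate * (\<Sum>r<p. (net_image z r)^2) \<le> 2 * real q" using 1 by simp
    qed
    finally show ?thesis .
  qed
  have meas: "(\<lambda>w. ennreal (exp (rate * Re (th * net_form z w)))) \<in> borel_measurable W" for th z
    unfolding net_form_def quad_form_def by auto
  have "(\<integral>\<^sup>+w. ennreal (exp_total w) \<partial>W) = (\<integral>\<^sup>+w. (\<Sum>z\<in>lattice_net q. \<Sum>th\<in>{1, -1, \<i>, -\<i>}. ennreal (exp (rate * Re (th * net_form z w)))) \<partial>W)"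
    unfolding exp_total_def by (subst sum_ennreal[symmetric]; auto simp del: sum.insert intro!: sum_nonneg nn_integral_cong sum.cong)
  also have "\<dots> = (\<Sum>z\<in>lattice_net q. \<Sum>th\<in>{1, -1, \<i>, -\<i>}. \<integral>\<^sup>+w. ennreal (exp (rate * Re (th * net_form z w))) \<partial>W)"
    using meas by (subst nn_integral_sum; (intro borel_measurable_sum meas sum.cong refl nn_integral_sum)?)
  also have "\<dots> \<le> (\<Sum>z\<in>lattice_net q. \<Sum>th\<in>{1, -1, \<i>, -\<i>}. ennreal (exp (2 * real q)))"
    by (intro sum_mono one)
  also have "\<dots> = ennreal (real (card (lattice_net q)) * (4 * exp (2 * real q)))"
    by (simp add: complex_eq_iff ennreal_mult' ennreal_of_nat_eq_real_of_nat)
  also have "\<dots> \<le> ennreal (exp (31 * real q))"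
  proof (rule ennreal_leI)
    have "(4::real) \<le> exp 1 * exp 1" using mult_mono[OF exp_ge_add_one_self[of 1] exp_ge_add_one_self[of 1]] by simp
    also have "\<dots> = exp 2" by (simp flip: exp_add)
    also have "\<dots> \<le> exp (2 * real q)" using q by simp
    finally have "real (card (lattice_net q)) * (4 * exp (2 * real q)) \<le> exp (27 * real q) * (exp (2 * real q) * exp (2 * real q))"
      by (intro mult_mono card_lattice_net) auto
    also have "\<dots> = exp (31 * real q)" by (simp flip: exp_add)
    finally show "real (card (lattice_net q)) * (4 * exp (2 * real q)) \<le> exp (31 * real q)" .
  qed
  finally show ?thesis .
qed

lemma frobenius_Y: "(\<Sum>r<p. \<Sum>s<q. norm (Y w r s)^2)^2 \<le> 8 * T^8 + 8 * T^4 * (\<Sum>i\<in>I. norm (w i)^4)"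
proof -
  define x where "x = (\<Sum>r<p. \<Sum>s<q. (a r s)^2)"
  define y where "y = (\<Sum>i\<in>I. norm (w i)^2)"
  have "(\<Sum>r<p. \<Sum>s<q. norm (Y w r s)^2) \<le> (\<Sum>r<p. \<Sum>s<q. 2 * (a r s)^2 + 2 * norm (w (r, s))^2)"
  proof (intro sum_mono)
    fix r s
    have "norm (Y w r s)^2 \<le> (\<bar>a r s\<bar> + norm (w (r, s)))^2"
      unfolding Y_def using norm_triangle_ineq[of "of_real (a r s)" "w (r, s)"] by (intro power_mono) auto
    also have "\<dots> \<le> 2 * (a r s)^2 + 2 * norm (w (r, s))^2"
      using zero_le_power2[of "\<bar>a r s\<bar> - norm (w (r, s))"] by (simp add: power2_sum power2_diff)
    finally show "norm (Y w r s)^2 \<le> 2 * (a r s)^2 + 2 * norm (w (r, s))^2" .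
  qed
  also have "\<dots> = 2 * x + 2 * y"
    by (simp add: x_def y_def sum.distrib sum_distrib_left sum.cartesian_product case_prod_beta')
  finally have "(\<Sum>r<p. \<Sum>s<q. norm (Y w r s)^2)^2 \<le> (2 * x + 2 * y)^2"
    by (intro power_mono) (auto intro!: sum_nonneg)
  also have "\<dots> \<le> 8 * x^2 + 8 * y^2"
    using zero_le_power2[of "x - y"] by (simp add: power2_eq_square algebra_simps)
  also have "x^2 \<le> T^8"
  proof -
    have "x \<le> real q * T^2" unfolding x_def by (rule frob)
    also have "\<dots> \<le> T^2 * T^2" using q_le_T2 by (intro mult_right_mono) auto
    finally have "x^2 \<le> (T^2 * T^2)^2" by (intro power_mono) (auto simp: x_def intro!: sum_nonneg)
    then show ?thesis by (simp flip: power_mult power_add)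
  qed
  also have "y^2 \<le> T^4 * (\<Sum>i\<in>I. norm (w i)^4)"
  proof -
    have "(\<Sum>i\<in>I. 1 * norm (w i)^2)^2 \<le> (\<Sum>i\<in>I. 1^2) * (\<Sum>i\<in>I. (norm (w i)^2)^2)"
      by (rule Cauchy_Schwarz_ineq_sum)
    also have "\<dots> = (real p * real q) * (\<Sum>i\<in>I. norm (w i)^4)" by (simp flip: power_mult)
    also have "\<dots> \<le> T^4 * (\<Sum>i\<in>I. norm (w i)^4)" by (intro mult_right_mono pq sum_nonneg) auto
    finally show ?thesis by (simp add: y_def)
  qed
  finally show ?thesis by simp
qed

text \<open>
The squared Frobenius norm and the power of the operator norm are separated by Young's inequality
\<open>2 g f \<le> (b / T\<^sup>4) f\<^sup>2 + (T\<^sup>4 / b) g\<^sup>2\<close>, in which \<open>b\<close> is the order of magnitude of \<open>g\<close> and \<open>T\<^sup>4\<close> that of \<open>f\<close>.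
\<close>

lemma grad_sq_integral:
  assumes m: "4 * m \<le> 31 * q"
  shows "(\<integral>\<^sup>+w. ennreal (grad_sq m w) \<partial>W) \<le> ennreal (37 * T^4 * (992 * T^2) ^ (2 * m))"
proof -
  \<comment> \<open>\<open>exp N\<close> bounds the mean of \<open>exp_total\<close>; \<open>992 = 8 \<cdot> 31 \<cdot> 4\<close> collects the factor of \<open>complex_operator_bound\<close>, \<open>N\<close> and \<open>1 / rate\<close>.\<close>
  define N where "N = 31 * real q"
  define b where "b = (992 * T^2) ^ (2 * m)"
  have b: "b > 0" using T by (simp add: b_def)
  have N: "N > 0" using q by (simp add: N_def)
  have Nl: "8 * (N / rate) = 992 * T^2" using q T by (simp add: N_def rate_def)
  have pt: "grad_sq m w \<le> b * (9/2 * T^4) + b * 4 * (\<Sum>i\<in>I. norm (w i)^4) + (b * T^4 / 2 * exp (- N)) * exp_total w" for w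
  proof -
    define t where "t = ln (exp_total w)"
    have t: "t \<ge> 0" using exp_total_gt_1[of w] by (simp add: t_def)
    define f where "f = (\<Sum>r<p. \<Sum>s<q. norm (Y w r s)^2)"
    define g where "g = (8 * (t / rate)) ^ (2 * m)"
    have "grad_sq m w \<le> g * f" using grad_sq_bound[of m w] by (simp add: f_def g_def t_def power_mult)
    also have "\<dots> \<le> (b / T^4 * f^2 + T^4 / b * g^2) / 2"
    proof -
      have "2 * ((sqrt (b / T^4) * f) * (sqrt (T^4 / b) * g)) \<le> (sqrt (b / T^4) * f)^2 + (sqrt (T^4 / b) * g)^2"
        using sum_squares_bound[of "sqrt (b / T^4) * f" "sqrt (T^4 / b) * g"] by (simp add: mult.assoc)
      moreover have "sqrt (b / T^4) * sqrt (T^4 / b) = 1" using b T by (simp flip: real_sqrt_mult)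
      then have "(sqrt (b / T^4) * f) * (sqrt (T^4 / b) * g) = g * f"
        by (metis (no_types, opaque_lifting) mult.assoc mult.commute mult_1)
      moreover have "(sqrt (b / T^4) * f)^2 = b / T^4 * f^2" "(sqrt (T^4 / b) * g)^2 = T^4 / b * g^2"
        using b T by (simp_all add: power_mult_distrib)
      ultimately show ?thesis by simp
    qed
    also have "\<dots> \<le> (b / T^4 * (8 * T^8 + 8 * T^4 * (\<Sum>i\<in>I. norm (w i)^4)) + T^4 / b * (b^2 * (1 + exp_total w * exp (- N)))) / 2"
    proof (intro divide_right_mono add_mono mult_left_mono)
      show "f^2 \<le> 8 * T^8 + 8 * T^4 * (\<Sum>i\<in>I. norm (w i)^4)" unfolding f_def by (rule frobenius_Y)
      have "g^2 = (8 / rate) ^ (4 * m) * t ^ (4 * m)"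
        by (simp add: g_def power_mult_distrib power_divide flip: power_mult)
      also have "\<dots> \<le> (8 / rate) ^ (4 * m) * (N ^ (4 * m) * (1 + exp (t - N)))"
        using m rate t N by (intro mult_left_mono power_le_exp) (auto simp: N_def)
      also have "\<dots> = (8 * (N / rate)) ^ (4 * m) * (1 + exp (t - N))"
        by (simp add: power_mult_distrib power_divide)
      also have "(8 * (N / rate)) ^ (4 * m) = b^2" unfolding Nl b_def using power_even_eq[of "992 * T^2" "2 * m"] by simp
      also have "exp (t - N) = exp_total w * exp (- N)" using exp_total_gt_1[of w] by (simp add: t_def exp_diff exp_minus field_simps)
      finally show "g^2 \<le> b^2 * (1 + exp_total w * exp (- N))" .
    qed (use b T in auto)
    also have "\<dots> = b * (9/2 * T^4) + b * 4 * (\<Sum>i\<in>I. norm (w i)^4) + (b * T^4 / 2 * exp (- N)) * exp_total w"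
    proof -
      have "T^8 = T^4 * T^4" by (simp flip: power_add)
      then show ?thesis using b T by (simp add: field_simps power2_eq_square)
    qed
    finally show ?thesis .
  qed
  have meas_total: "(\<lambda>w. ennreal (exp_total w)) \<in> borel_measurable W"
    unfolding exp_total_def net_form_def quad_form_def by (intro measurable_compose[OF _ measurable_ennreal] borel_measurable_sum) auto
  have nonneg: "exp_total w \<ge> 0" for w using exp_total_gt_1[of w] by simp
  have "(\<integral>\<^sup>+w. ennreal (grad_sq m w) \<partial>W) \<le> (\<integral>\<^sup>+w. ennreal (b * (9/2 * T^4)) + ennreal (b * 4) * (\<Sum>i\<in>I. ennreal (norm (w i)^4)) + ennreal (b * T^4 / 2 * exp (- N)) * ennreal (exp_total w) \<partial>W)"
  proof (rule nn_integral_mono)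
    fix w
    have "ennreal (grad_sq m w) \<le> ennreal (b * (9/2 * T^4) + b * 4 * (\<Sum>i\<in>I. norm (w i)^4) + (b * T^4 / 2 * exp (- N)) * exp_total w)"
      by (rule ennreal_leI[OF pt])
    also have "\<dots> = ennreal (b * (9/2 * T^4)) + ennreal (b * 4) * (\<Sum>i\<in>I. ennreal (norm (w i)^4)) + ennreal (b * T^4 / 2 * exp (- N)) * ennreal (exp_total w)"
      using b T nonneg[of w] by (subst sum_ennreal; simp add: sum_nonneg ennreal_plus[symmetric] ennreal_mult'[symmetric] del: ennreal_plus)
    finally show "ennreal (grad_sq m w) \<le> \<dots>" .
  qed
  also have "\<dots> = ennreal (b * (9/2 * T^4)) * emeasure W (space W) + ennreal (b * 4) * (\<Sum>i\<in>I. \<integral>\<^sup>+w. ennreal (norm (w i)^4) \<partial>W) + ennreal (b * T^4 / 2 * exp (- N)) * (\<integral>\<^sup>+w. ennreal (exp_total w) \<partial>W)"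
  proof -
    have m1: "(\<lambda>w. ennreal (norm (w i)^4)) \<in> borel_measurable W" if "i \<in> I" for i using that by auto
    then have "(\<lambda>w. \<Sum>i\<in>I. ennreal (norm (w i)^4)) \<in> borel_measurable W" by (rule borel_measurable_sum)
    from nn_integral_affine[OF this meas_total] show ?thesis
      by (simp only: nn_integral_sum[OF m1])
  qed
  also have "emeasure W (space W) = 1"
    by (rule emeasure_W)
  also have "(\<Sum>i\<in>I. \<integral>\<^sup>+w. ennreal (norm (w i)^4) \<partial>W) = ennreal (8 * (real p * real q))"
    by (simp add: nn_integral_cgauss_PiM_component[where f = "\<lambda>z. ennreal (norm z ^ 4)"] cgauss_fourth_moment ennreal_mult' ennreal_of_nat_eq_real_of_nat mult_ac)
  also have "ennreal (b * (9/2 * T^4)) * 1 + ennreal (b * 4) * ennreal (8 * (real p * real q)) + ennreal (b * T^4 / 2 * exp (- N)) * (\<integral>\<^sup>+w. ennreal (exp_total w) \<partial>W)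
     \<le> ennreal (b * (9/2 * T^4)) * 1 + ennreal (b * 4) * ennreal (8 * T^4) + ennreal (b * T^4 / 2 * exp (- N)) * ennreal (exp N)"
    using pq exp_total_integral by (intro add_mono mult_left_mono ennreal_leI) (auto simp: N_def)
  also have "\<dots> = ennreal (b * (9/2 * T^4) + b * 4 * (8 * T^4) + b * T^4 / 2 * exp (- N) * exp N)"
    using b T by (simp add: ennreal_plus[symmetric] ennreal_mult'[symmetric] del: ennreal_plus)
  also have "b * (9/2 * T^4) + b * 4 * (8 * T^4) + b * T^4 / 2 * exp (- N) * exp N = 37 * T^4 * b"
    unfolding mult.assoc[of _ "exp (- N)"] by (simp flip: exp_add)
  finally show ?thesis unfolding b_def .
qed

text \<open>
The Poincare inequality bounds the second moment of the deviation by \<open>s\<^sup>2\<close> with \<open>s = 2000\<^sup>k T\<^sup>2\<^sup>k\<close>; the first moment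
follows from \<open>2 s x \<le> s\<^sup>2 + x\<^sup>2\<close>.
\<close>

lemma cycle_deviation:
  assumes k: "k > 0" "4 * (k - 1) \<le> 31 * q"
  shows "(\<integral>\<^sup>+w. ennreal (norm (cycle_poly k p q (Y w) - of_real (clean_cycle k))) \<partial>W) \<le> ennreal (2000 ^ k * T ^ (2 * k))"
proof -
  define s where "s = 2000 ^ k * T ^ (2 * k)"
  have s: "s > 0" using T by (simp add: s_def)
  define F where "F w = cycle_poly k p q (Y w) - of_real (clean_cycle k)" for w
  have mF: "F \<in> borel_measurable W" unfolding F_def using measurable_cycle[OF k(1)] by simp
  have "(\<integral>\<^sup>+w. ennreal (norm (F w) ^ 2) \<partial>W) \<le> ennreal (8 * real k ^ 2) * (\<integral>\<^sup>+w. ennreal (grad_sq (k - 1) w) \<partial>W)"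
    unfolding F_def by (rule Poincare_cycle[OF k(1)])
  also have "\<dots> \<le> ennreal (8 * real k ^ 2) * ennreal (37 * T^4 * (992 * T^2) ^ (2 * (k - 1)))"
    by (intro mult_left_mono grad_sq_integral k(2)) auto
  also have "\<dots> = ennreal (8 * real k ^ 2 * (37 * T^4 * (992 * T^2) ^ (2 * (k - 1))))"
    by (rule ennreal_mult'[symmetric]) simp
  also have "\<dots> \<le> ennreal (s^2)"
  proof (rule ennreal_leI)
    obtain m where m: "k = Suc m" using k by (cases k) auto
    have "real k \<le> 2 ^ k" using less_exp[of k] by (metis less_imp_le of_nat_le_iff of_nat_numeral of_nat_power)
    then have k2: "real k ^ 2 \<le> (2 ^ k)^2" by (intro power_mono) auto
    have "8 * real k ^ 2 * (37 * T^4 * (992 * T^2) ^ (2 * (k - 1))) = 296 * real k ^ 2 * (992 ^ (2 * m) * (T^4 * T ^ (4 * m)))"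
      by (simp add: m power_mult_distrib flip: power_mult)
    \<comment> \<open>The factors \<open>296 k\<^sup>2\<close> are absorbed by a larger base of the \<open>k\<close>-th power.\<close>
    also have "\<dots> \<le> 992^2 * (2 ^ k)^2 * (992 ^ (2 * m) * (T^4 * T ^ (4 * m)))"
      using k2 T by (intro mult_right_mono mult_mono) auto
    also have "\<dots> = (992 ^ k)^2 * (2^k)^2 * (T ^ (2 * k))^2"
    proof -
      have e1: "(992::real)^2 * 992 ^ (2 * m) = (992 ^ k)^2" unfolding m by (simp add: power_mult[symmetric] mult.commute flip: power_add)
      have "T^4 * T ^ (4 * m) = T ^ (4 + 4 * m)" by (simp only: power_add)
      also have "4 + 4 * m = (2 * k) * 2" by (simp add: m)
      also have "T ^ ((2 * k) * 2) = (T ^ (2 * k))^2" by (rule power_mult)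
      finally have e2: "T^4 * T ^ (4 * m) = (T ^ (2 * k))^2" .
      show ?thesis unfolding e2[symmetric] e1[symmetric] by (simp only: mult_ac)
    qed
    also have "\<dots> = ((992 * 2) ^ k * T ^ (2 * k))^2" by (simp only: power_mult_distrib)
    also have "\<dots> \<le> s^2" unfolding s_def using T by (intro power_mono mult_right_mono) auto
    finally show "8 * real k ^ 2 * (37 * T^4 * (992 * T^2) ^ (2 * (k - 1))) \<le> s^2" .
  qed
  finally have sq: "(\<integral>\<^sup>+w. ennreal (norm (F w) ^ 2) \<partial>W) \<le> ennreal (s^2)" .
  have "(\<integral>\<^sup>+w. ennreal (norm (F w)) \<partial>W) \<le> (\<integral>\<^sup>+w. ennreal (s / 2) + ennreal (1 / (2 * s)) * ennreal (norm (F w) ^ 2) \<partial>W)"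
  proof (rule nn_integral_mono)
    fix w
    have "2 * s * norm (F w) \<le> s^2 + norm (F w)^2" by (rule sum_squares_bound)
    then have "norm (F w) \<le> s / 2 + 1 / (2 * s) * norm (F w) ^ 2" using s by (simp add: field_simps power2_eq_square)
    then have "ennreal (norm (F w)) \<le> ennreal (s / 2 + 1 / (2 * s) * norm (F w) ^ 2)" by (rule ennreal_leI)
    then show "ennreal (norm (F w)) \<le> ennreal (s / 2) + ennreal (1 / (2 * s)) * ennreal (norm (F w) ^ 2)"
      using s by (simp add: ennreal_plus[symmetric] ennreal_mult'[symmetric] del: ennreal_plus)
  qed
  also have "\<dots> = ennreal (s / 2) * emeasure W (space W) + ennreal (1 / (2 * s)) * (\<integral>\<^sup>+w. ennreal (norm (F w) ^ 2) \<partial>W)"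
    using mF by (subst nn_integral_add) (auto simp: nn_integral_cmult)
  also have "emeasure W (space W) = 1"
    by (rule emeasure_W)
  also have "ennreal (s / 2) * 1 + ennreal (1 / (2 * s)) * (\<integral>\<^sup>+w. ennreal (norm (F w) ^ 2) \<partial>W) \<le> ennreal (s / 2) * 1 + ennreal (1 / (2 * s)) * ennreal (s^2)"
    by (intro add_left_mono mult_left_mono sq) auto
  also have "\<dots> = ennreal (s / 2 + 1 / (2 * s) * s^2)"
    using s by (simp add: ennreal_plus[symmetric] ennreal_mult'[symmetric] del: ennreal_plus)
  also have "s / 2 + 1 / (2 * s) * s^2 = s" using s by (simp add: power2_eq_square)
  finally show ?thesis unfolding F_def s_def .
qed

text \<open>
The statistic \<open>U\<^sub>k\<close> of the signal plus noise, as a function of the noise.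
\<close>

definition U_noisy :: "nat \<Rightarrow> (nat \<times> nat \<Rightarrow> real) \<Rightarrow> real" where
  "U_noisy k x = (\<Sum>i \<in> {..<k} \<rightarrow>\<^sub>E {..<p}. \<Sum>j \<in> {..<k} \<rightarrow>\<^sub>E {..<q}.
      \<Prod>r<p. \<Prod>s<q. hermite (pair_count k i j r s) (a r s + x (r, s)))"

text \<open>
Averaging over the imaginary parts of the noise turns powers into Hermite polynomials, entry by entry.
\<close>

lemma U_noisy_eq_integral: 
  "integrable (\<Pi>\<^sub>M i\<in>I. std_gauss) (\<lambda>y. cycle_poly k p q (Y (\<lambda>i\<in>I. Complex (x i) (y i))))"
  "complex_of_real (U_noisy k x) = (\<integral>y. cycle_poly k p q (Y (\<lambda>i\<in>I. Complex (x i) (y i))) \<partial>(\<Pi>\<^sub>M i\<in>I. std_gauss))"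
proof -
  define h where "h i j rs y = (complex_of_real (a (fst rs) (snd rs) + x rs) + \<i> * of_real y) ^ pair_count k i j (fst rs) (snd rs)" for i j rs y
  have ih: "integrable std_gauss (h i j rs)" for i j rs
  proof -
    have "h i j rs = (\<lambda>y. poly ([:complex_of_real (a (fst rs) (snd rs) + x rs), \<i>:] ^ pair_count k i j (fst rs) (snd rs)) (of_real y))"
      by (auto simp: h_def mult.commute)
    then show ?thesis by (simp only: integrable_std_gauss_poly)
  qed
  have prod: "(\<Prod>r<p. \<Prod>s<q. Y (\<lambda>i\<in>I. Complex (x i) (y i)) r s ^ pair_count k i j r s) = (\<Prod>rs\<in>I. h i j rs (y rs))" for i j y
    unfolding prod.cartesian_product
    by (intro prod.cong refl) (auto simp: h_def Y_def Complex_eq add_ac)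
  have int1: "integrable (\<Pi>\<^sub>M i\<in>I. std_gauss) (\<lambda>y. \<Prod>rs\<in>I. h i j rs (y rs))" for i j
    by (rule Psg.product_integrable_prod) (use ih in auto)
  have eq1: "(\<integral>y. (\<Prod>rs\<in>I. h i j rs (y rs)) \<partial>(\<Pi>\<^sub>M i\<in>I. std_gauss)) = of_real (\<Prod>r<p. \<Prod>s<q. hermite (pair_count k i j r s) (a r s + x (r, s)))" for i j
  proof -
    have "(\<integral>y. (\<Prod>rs\<in>I. h i j rs (y rs)) \<partial>(\<Pi>\<^sub>M i\<in>I. std_gauss)) = (\<Prod>rs\<in>I. \<integral>y. h i j rs y \<partial>std_gauss)"
      by (rule Psg.product_integral_prod) (use ih in auto)
    also have "\<dots> = (\<Prod>rs\<in>I. of_real (hermite (pair_count k i j (fst rs) (snd rs)) (a (fst rs) (snd rs) + x rs)))"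
      unfolding h_def hermite_integral ..
    finally show ?thesis by (simp add: prod.cartesian_product case_prod_beta')
  qed
  show "integrable (\<Pi>\<^sub>M i\<in>I. std_gauss) (\<lambda>y. cycle_poly k p q (Y (\<lambda>i\<in>I. Complex (x i) (y i))))"
    unfolding cycle_poly_def prod by (intro Bochner_Integration.integrable_sum int1)
  show "complex_of_real (U_noisy k x) = (\<integral>y. cycle_poly k p q (Y (\<lambda>i\<in>I. Complex (x i) (y i))) \<partial>(\<Pi>\<^sub>M i\<in>I. std_gauss))"
    unfolding cycle_poly_def prod 
    by (simp add: Bochner_Integration.integral_sum Bochner_Integration.integrable_sum int1 eq1 U_noisy_def)
qed

text \<open>
The absolute value of an average is at most the average of the absolute values, so the deviation of the
statistic is at most that of \<open>tr (Y\<^sup>T Y)\<^sup>k\<close> under complex noise.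
\<close>

lemma U_noisy_deviation:
  assumes k: "k > 0" "4 * (k - 1) \<le> 31 * q"
  shows "(\<integral>\<^sup>+x. ennreal \<bar>U_noisy k x - clean_cycle k\<bar> \<partial>std_gaussian p q) \<le> ennreal (2000 ^ k * T ^ (2 * k))"
proof -
  interpret X: prob_space "\<Pi>\<^sub>M i\<in>I. std_gauss" by (rule prob_space_PiM) (rule prob_space_std_gauss)
  have "(\<integral>\<^sup>+x. ennreal \<bar>U_noisy k x - clean_cycle k\<bar> \<partial>std_gaussian p q) \<le> 
    (\<integral>\<^sup>+x. \<integral>\<^sup>+y. ennreal (norm (cycle_poly k p q (Y (\<lambda>i\<in>I. Complex (x i) (y i))) - of_real (clean_cycle k))) \<partial>(\<Pi>\<^sub>M i\<in>I. std_gauss) \<partial>(\<Pi>\<^sub>M i\<in>I. std_gauss))"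
    unfolding std_gaussian_def
  proof (rule nn_integral_mono)
    fix x
    let ?f = "\<lambda>y. cycle_poly k p q (Y (\<lambda>i\<in>I. Complex (x i) (y i)))"
    have "complex_of_real (U_noisy k x - clean_cycle k) = (\<integral>y. ?f y - of_real (clean_cycle k) \<partial>(\<Pi>\<^sub>M i\<in>I. std_gauss))"
      using U_noisy_eq_integral[of k x] X.prob_space by simp
    then have "ennreal \<bar>U_noisy k x - clean_cycle k\<bar> = ennreal (norm (\<integral>y. ?f y - of_real (clean_cycle k) \<partial>(\<Pi>\<^sub>M i\<in>I. std_gauss)))"
      by (metis norm_of_real)
    also have "\<dots> \<le> (\<integral>\<^sup>+y. ennreal (norm (?f y - of_real (clean_cycle k))) \<partial>(\<Pi>\<^sub>M i\<in>I. std_gauss))"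
      using U_noisy_eq_integral(1)[of k x] by (intro integral_norm_bound_ennreal) auto
    finally show "ennreal \<bar>U_noisy k x - clean_cycle k\<bar> \<le> (\<integral>\<^sup>+y. ennreal (norm (?f y - of_real (clean_cycle k))) \<partial>(\<Pi>\<^sub>M i\<in>I. std_gauss))" .
  qed
  also have "\<dots> = (\<integral>\<^sup>+w. ennreal (norm (cycle_poly k p q (Y w) - of_real (clean_cycle k))) \<partial>W)"
    using measurable_cycle[OF k(1)] by (subst nn_integral_cgauss_PiM) auto
  also have "\<dots> \<le> ennreal (2000 ^ k * T ^ (2 * k))" by (rule cycle_deviation[OF k])
  finally show ?thesis .
qed

lemma measurable_U_noisy: "U_noisy k \<in> borel_measurable (std_gaussian p q)"
proof -
  have [measurable]: "(\<lambda>x. hermite n (a r s + x (r, s))) \<in> borel_measurable (std_gaussian p q)" if "r < p" "s < q" for n r s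
  proof -
    have "(\<lambda>x. a r s + x (r, s)) \<in> borel_measurable (std_gaussian p q)" using that unfolding std_gaussian_def by auto
    moreover have "hermite n \<in> borel_measurable borel"
      unfolding hermite_eq_poly by (intro borel_measurable_continuous_onI continuous_intros)
    ultimately show ?thesis by (rule measurable_compose)
  qed
  show ?thesis unfolding U_noisy_def[abs_def] by (intro borel_measurable_sum borel_measurable_prod) auto
qed

end


section \<open>The risk of the estimator\<close>

lemma bounded_signal_of_singular_values:
  assumes A: "A \<in> carrier_mat p q" and q: "q > 0" "q \<le> p" and T: "T > 0" "real p * real q \<le> T ^ 4"
    and s1: "singular_value 1 A \<le> T"
  shows "bounded_signal p q (\<lambda>r s. A $$ (r, s)) T"
proof
  let ?a = "\<lambda>r s. A $$ (r, s)"
  note S = singular_values_facts[OF A q(1)]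
  have traces: "fmat_trace q (fmat_pow q (gram p ?a) n) \<le> real q * (T^2) ^ n" for n
  proof -
    have "(singular_values A ! i) ^ (2 * n) \<le> (T^2) ^ n" if "i < q" for i
      unfolding power_mult[symmetric] using S(2,3)[OF that] s1 by (intro power_mono) auto
    then have "(\<Sum>i<q. (singular_values A ! i) ^ (2 * n)) \<le> (\<Sum>i<q. (T^2) ^ n)" by (intro sum_mono) auto
    then show ?thesis unfolding S(5) by simp
  qed
  show "(\<Sum>r<p. (\<Sum>s<q. A $$ (r, s) * x s)^2) \<le> 2 * T^2 * (\<Sum>s<q. (x s)^2)" for x
    by (rule gram_operator_bound[OF traces]) simp
  have "(\<Sum>r<p. \<Sum>s<q. (A $$ (r, s))^2) = (\<Sum>s<q. \<Sum>r<p. (A $$ (r, s))^2)" by (rule sum.swap)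
  also have "\<dots> = fmat_trace q (gram p ?a)" by (simp add: fmat_trace_def gram_def power2_eq_square)
  also have "\<dots> = fmat_trace q (fmat_pow q (gram p ?a) 1)" by (intro fmat_trace_cong) (simp only: fmat_pow_1 One_nat_def)
  also have "\<dots> \<le> real q * T^2" using traces[of 1] by simp
  finally show "(\<Sum>r<p. \<Sum>s<q. (A $$ (r, s))^2) \<le> real q * T^2" .
qed (use q T in auto)

text \<open>
The two summands of \<open>B\<close> are the fluctuation and the bias. The bias has the factor \<open>2 q\<close> since the
estimator contains the constant coefficient of \<open>P_star K\<close> once instead of \<open>q\<close> times: \<open>q\<close> approximation
errors come from the singular values and \<open>q - 1\<close> from the missing constants.
\<close>

lemma (in bounded_signal) estimator_error:
  assumes A: "A \<in> carrier_mat p q" and a: "a = (\<lambda>r s. A $$ (r, s))" and s1: "singular_value 1 A \<le> T"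
    and M: "M * real (p * q) powr (1 / 4) = T" and K: "4 * K \<le> 31 * q"
  defines "err \<equiv> (\<lambda>E. \<bar>G1 M (P_star K) (A + mat p q E) - nuclear_norm A\<bar>)"
  defines "B \<equiv> T * (3 * 18000 ^ K) + 2 * real q * T * (8 / pi / real (2 * K + 1))"
  shows "integrable (std_gaussian p q) err" "(\<integral>E. err E \<partial>std_gaussian p q) \<le> B"
proof -
  note S = singular_values_facts[OF A q]
  define c where "c = Polynomial.coeff (P_star K)"
  define \<sigma> where "\<sigma> i = singular_values A ! i" for i
  have \<sigma>: "0 \<le> \<sigma> i" "\<sigma> i \<le> T" if "i < q" for i
    using S(2,3)[OF that] s1 by (auto simp: \<sigma>_def)
  have tr_a: "fmat_trace q (fmat_pow q (gram p a) k) = (\<Sum>i<q. \<sigma> i ^ (2 * k))" for k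
    using S(5)[of k] by (simp only: a \<sigma>_def)
  have cyc: "clean_cycle k = (\<Sum>i<q. \<sigma> i ^ (2 * k))" if "k > 0" for k
    unfolding clean_cycle_def cycle_poly_eq_trace[OF that] by (rule tr_a)
  have G1: "G1 M (P_star K) (A + mat p q E) = T * (c 0 + (\<Sum>k=1..K. c k * (U_noisy k E / T ^ (2 * k))))" for E
  proof -
    have Us: "U_stat k (A + mat p q E) = U_noisy k E" for k
    proof -
      have d: "dim_row (A + mat p q E) = p" "dim_col (A + mat p q E) = q" using A by auto
      have "(A + mat p q E) $$ (r, s) = a r s + E (r, s)" if "r < p" "s < q" for r s
        using A that by (simp add: a)
      then show ?thesis unfolding U_stat_def U_noisy_def d by (intro sum.cong prod.cong refl) simp
    qed
    have "(\<Sum>k = 1..degree (P_star K). c k * (U_noisy k E / T ^ (2 * k))) = (\<Sum>k=1..K. c k * (U_noisy k E / T ^ (2 * k)))"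
      using degree_P_star[of K] by (intro sum.mono_neutral_left) (auto simp: c_def coeff_eq_0)
    then show ?thesis
      using A M by (simp add: G1_def Let_def Us c_def)
  qed
  define bias where "bias = T * (c 0 + (\<Sum>k=1..K. c k * (clean_cycle k / T ^ (2 * k)))) - (\<Sum>i<q. \<sigma> i)"
  have bias: "\<bar>bias\<bar> \<le> 2 * real q * T * (8 / pi / real (2 * K + 1))"
  proof -
    define e where "e = 8 / pi / real (2 * K + 1)"
    have e0: "e \<ge> 0" by (simp add: e_def)
    have Px: "poly (P_star K) ((\<sigma> i / T)^2) = c 0 + (\<Sum>k=1..K. c k * (\<sigma> i ^ (2 * k) / T ^ (2 * k)))" for i
    proof -
      have "poly (P_star K) ((\<sigma> i / T)^2) = (\<Sum>k\<le>degree (P_star K). c k * ((\<sigma> i / T)^2) ^ k)" by (simp add: poly_altdef c_def)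
      also have "\<dots> = (\<Sum>k\<le>K. c k * ((\<sigma> i / T)^2) ^ k)"
        using degree_P_star[of K] by (intro sum.mono_neutral_left) (auto simp: c_def coeff_eq_0)
      also have "\<dots> = c 0 + (\<Sum>k=1..K. c k * ((\<sigma> i / T)^2) ^ k)"
        by (simp add: atMost_atLeast0 sum.atLeast_Suc_atMost)
      finally show ?thesis by (simp add: power_divide flip: power_mult)
    qed
    have "T * (\<Sum>k=1..K. c k * (clean_cycle k / T ^ (2 * k))) = (\<Sum>i<q. T * (\<Sum>k=1..K. c k * (\<sigma> i ^ (2 * k) / T ^ (2 * k))))"
    proof -
      have "(\<Sum>k=1..K. c k * (clean_cycle k / T ^ (2 * k))) = (\<Sum>k=1..K. \<Sum>i<q. c k * (\<sigma> i ^ (2 * k) / T ^ (2 * k)))"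
        by (intro sum.cong refl) (auto simp: cyc sum_divide_distrib sum_distrib_left)
      also have "\<dots> = (\<Sum>i<q. \<Sum>k=1..K. c k * (\<sigma> i ^ (2 * k) / T ^ (2 * k)))" by (rule sum.swap)
      finally show ?thesis by (simp add: sum_distrib_left)
    qed
    then have "bias = (\<Sum>i<q. T * poly (P_star K) ((\<sigma> i / T)^2) - \<sigma> i) - (real q - 1) * T * c 0"
      unfolding bias_def Px sum_subtractf distrib_left[of T] sum.distrib by (simp add: algebra_simps)
    also have "\<bar>\<dots>\<bar> \<le> (\<Sum>i<q. \<bar>T * poly (P_star K) ((\<sigma> i / T)^2) - \<sigma> i\<bar>) + \<bar>(real q - 1) * T * c 0\<bar>"
      by (rule order.trans[OF abs_triangle_ineq4 add_right_mono[OF sum_abs]])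
    also have "\<dots> \<le> (\<Sum>i<q. T * e) + real q * T * e"
    proof (intro add_mono sum_mono)
      fix i assume "i \<in> {..<q}"
      then have "\<bar>poly (P_star K) ((\<sigma> i / T)^2) - \<sigma> i / T\<bar> \<le> e"
        unfolding e_def using \<sigma>[of i] T by (intro P_star_approx) auto
      then have "T * \<bar>poly (P_star K) ((\<sigma> i / T)^2) - \<sigma> i / T\<bar> \<le> T * e" using T by (intro mult_left_mono) auto
      moreover have "T * poly (P_star K) ((\<sigma> i / T)^2) - \<sigma> i = T * (poly (P_star K) ((\<sigma> i / T)^2) - \<sigma> i / T)"
        using T by (simp add: right_diff_distrib)
      ultimately show "\<bar>T * poly (P_star K) ((\<sigma> i / T)^2) - \<sigma> i\<bar> \<le> T * e"
        using T by (simp add: abs_mult)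
    next
      have "\<bar>c 0\<bar> \<le> e" using P_star_approx[of 0 K] by (simp add: c_def e_def poly_0_coeff_0)
      moreover have "\<bar>real q - 1\<bar> \<le> real q" using q by simp
      ultimately show "\<bar>(real q - 1) * T * c 0\<bar> \<le> real q * T * e"
        using T e0 unfolding abs_mult by (intro mult_mono) auto
    qed
    finally show ?thesis by (simp add: e_def mult_ac)
  qed
  define w where "w k = T * \<bar>c k\<bar> / T ^ (2 * k)" for k
  have w0: "w k \<ge> 0" for k using T by (simp add: w_def)
  have err_eq: "err E = \<bar>(\<Sum>k=1..K. T * (c k * ((U_noisy k E - clean_cycle k) / T ^ (2 * k)))) + bias\<bar>" for E
  proof -
    have "G1 M (P_star K) (A + mat p q E) - nuclear_norm A = (\<Sum>k=1..K. T * (c k * ((U_noisy k E - clean_cycle k) / T ^ (2 * k)))) + bias"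
      unfolding G1 bias_def S(4) \<sigma>_def[symmetric]
      by (simp add: diff_divide_distrib right_diff_distrib sum_subtractf sum_distrib_left distrib_left)
    then show ?thesis by (simp add: err_def)
  qed
  have err_le: "err E \<le> (\<Sum>k=1..K. w k * \<bar>U_noisy k E - clean_cycle k\<bar>) + \<bar>bias\<bar>" for E
  proof -
    have "err E \<le> (\<Sum>k=1..K. \<bar>T * (c k * ((U_noisy k E - clean_cycle k) / T ^ (2 * k)))\<bar>) + \<bar>bias\<bar>"
      unfolding err_eq by (rule order.trans[OF abs_triangle_ineq add_right_mono[OF sum_abs]])
    also have "(\<Sum>k=1..K. \<bar>T * (c k * ((U_noisy k E - clean_cycle k) / T ^ (2 * k)))\<bar>) = (\<Sum>k=1..K. w k * \<bar>U_noisy k E - clean_cycle k\<bar>)"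
      using T by (intro sum.cong refl) (simp add: w_def abs_mult)
    finally show ?thesis .
  qed
  have [measurable]: "err \<in> borel_measurable (std_gaussian p q)"
    unfolding err_eq[abs_def] using measurable_U_noisy by (intro borel_measurable_abs borel_measurable_add borel_measurable_sum) auto
  interpret X: prob_space "std_gaussian p q"
    unfolding std_gaussian_def by (rule prob_space_PiM) (rule prob_space_std_gauss)
  have mU: "(\<lambda>E. ennreal \<bar>U_noisy k E - clean_cycle k\<bar>) \<in> borel_measurable (std_gaussian p q)" for k
    using measurable_U_noisy[of k] by simp
  have "(\<integral>\<^sup>+E. ennreal (err E) \<partial>std_gaussian p q) \<le> (\<integral>\<^sup>+E. (\<Sum>k=1..K. ennreal (w k) * ennreal \<bar>U_noisy k E - clean_cycle k\<bar>) + ennreal \<bar>bias\<bar> \<partial>std_gaussian p q)"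
  proof (rule nn_integral_mono)
    fix E
    have "ennreal (err E) \<le> ennreal ((\<Sum>k=1..K. w k * \<bar>U_noisy k E - clean_cycle k\<bar>) + \<bar>bias\<bar>)" by (rule ennreal_leI[OF err_le])
    also have "\<dots> = (\<Sum>k=1..K. ennreal (w k) * ennreal \<bar>U_noisy k E - clean_cycle k\<bar>) + ennreal \<bar>bias\<bar>"
      using w0 by (simp add: sum_nonneg flip: sum_ennreal ennreal_mult')
    finally show "ennreal (err E) \<le> \<dots>" .
  qed
  also have "\<dots> = (\<Sum>k=1..K. ennreal (w k) * (\<integral>\<^sup>+E. ennreal \<bar>U_noisy k E - clean_cycle k\<bar> \<partial>std_gaussian p q)) + ennreal \<bar>bias\<bar>"
    using mU X.emeasure_space_1 by (simp add: nn_integral_add nn_integral_sum nn_integral_cmult)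
  also have "\<dots> \<le> (\<Sum>k=1..K. ennreal (w k) * ennreal (2000 ^ k * T ^ (2 * k))) + ennreal \<bar>bias\<bar>"
    using K by (intro add_right_mono sum_mono mult_left_mono U_noisy_deviation) auto
  also have "\<dots> = ennreal ((\<Sum>k=1..K. w k * (2000 ^ k * T ^ (2 * k))) + \<bar>bias\<bar>)"
    using w0 T by (simp add: sum_nonneg flip: sum_ennreal ennreal_mult')
  also have "\<dots> \<le> ennreal B"
  proof (rule ennreal_leI)
    have "(\<Sum>k=1..K. w k * (2000 ^ k * T ^ (2 * k))) = T * (\<Sum>k=1..K. \<bar>c k\<bar> * 2000 ^ k)"
      using T by (simp add: w_def sum_distrib_left field_simps)
    also have "\<dots> \<le> T * (\<Sum>k=1..K. \<bar>c k\<bar> * 2000 ^ K)"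
      using T by (intro mult_left_mono sum_mono power_increasing) auto
    also have "\<dots> = T * ((\<Sum>k=1..K. \<bar>c k\<bar>) * 2000 ^ K)" by (simp add: sum_distrib_right)
    also have "\<dots> \<le> T * ((3 * 9 ^ K) * 2000 ^ K)"
    proof (intro mult_left_mono mult_right_mono)
      have "(\<Sum>k=1..K. \<bar>c k\<bar>) \<le> (\<Sum>k\<le>K. \<bar>c k\<bar>)" by (rule sum_mono2) auto
      also have "\<dots> \<le> 3 * 9 ^ K" unfolding c_def by (rule P_star_coeff_sum)
      finally show "(\<Sum>k=1..K. \<bar>c k\<bar>) \<le> 3 * 9 ^ K" .
    qed (use T in auto)
    also have "\<dots> = T * (3 * 18000 ^ K)" by (simp flip: power_mult_distrib)
    finally show "(\<Sum>k=1..K. w k * (2000 ^ k * T ^ (2 * k))) + \<bar>bias\<bar> \<le> B"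
      unfolding B_def using bias by (intro add_mono)
  qed
  finally have le: "(\<integral>\<^sup>+E. ennreal (err E) \<partial>std_gaussian p q) \<le> ennreal B" .
  have nn: "err E \<ge> 0" for E by (simp add: err_def)
  show int: "integrable (std_gaussian p q) err"
    by (rule integrableI_nonneg) (use nn le in \<open>auto intro: le_less_trans\<close>)
  have "ennreal (\<integral>E. err E \<partial>std_gaussian p q) \<le> ennreal B"
    using le nn_integral_eq_integral[OF int] nn by simp
  moreover have "B \<ge> 0" using T by (simp add: B_def)
  ultimately show "(\<integral>E. err E \<partial>std_gaussian p q) \<le> B" by simp
qed

theorem proposition4p6:
  shows "\<exists>c C :: real. c > 0 \<and> C > 0 \<and>
    (\<forall>(M :: real) (p :: nat) (q :: nat) (A :: real mat).
       M > 1 \<longrightarrow> q \<ge> 2 \<longrightarrow> p \<ge> q \<longrightarrow> A \<in> carrier_mat p q \<longrightarrow>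
       singular_value 1 A \<le> M * real (p * q) powr (1 / 4) \<longrightarrow>
       (let K = nat \<lfloor>c * ln (real q)\<rfloor>;
            err = (\<lambda>E. \<bar>G1 M (P_star K) (A + mat p q E) - nuclear_norm A\<bar>)
        in integrable (std_gaussian p q) err \<and>
           (\<integral>E. err E \<partial>std_gaussian p q) \<le> C * M * (real q / ln (real q)) * real (p * q) powr (1 / 4)))"
proof -
  \<comment> \<open>With this choice \<open>18000\<^sup>K \<le> \<surd>q\<close>.\<close>
  define c where "c = 1 / (2 * ln (18000::real))"
  have ln1: "ln (18000::real) \<ge> 1"
  proof -
    have "exp 1 \<le> (18000::real)" using exp_le by simp
    then show ?thesis by (simp add: ln_ge_iff)
  qed
  have c: "c > 0" "c \<le> 1" using ln1 by (auto simp: c_def)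
  have main: "(let K = nat \<lfloor>c * ln (real q)\<rfloor>;
            err = (\<lambda>E. \<bar>G1 M (P_star K) (A + mat p q E) - nuclear_norm A\<bar>)
        in integrable (std_gaussian p q) err \<and>
           (\<integral>E. err E \<partial>std_gaussian p q) \<le> (6 + 6 / c) * M * (real q / ln (real q)) * real (p * q) powr (1 / 4))"
    if M: "M > 1" and dims: "q \<ge> 2" "p \<ge> q" and A: "A \<in> carrier_mat p q"
      and s1: "singular_value 1 A \<le> M * real (p * q) powr (1 / 4)" for M p q A
  proof -
    define T where "T = M * real (p * q) powr (1 / 4)"
    have T: "T > 0" using M dims by (simp add: T_def)
    have T4: "real p * real q \<le> T ^ 4"
    proof -
      have "(real (p * q) powr (1 / 4)) ^ 4 = real (p * q)"
        using dims by (subst powr_power) auto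
      then have "T ^ 4 = M ^ 4 * (real p * real q)" by (simp add: T_def power_mult_distrib)
      moreover have "1 \<le> M ^ 4" using M by (intro one_le_power) simp
      ultimately show ?thesis using mult_right_mono[of 1 "M ^ 4" "real p * real q"] by simp
    qed
    interpret bounded_signal p q "\<lambda>r s. A $$ (r, s)" T
      by (rule bounded_signal_of_singular_values) (use A dims T T4 s1 in \<open>auto simp: T_def\<close>)
    define K where "K = nat \<lfloor>c * ln (real q)\<rfloor>"
    have lnq: "ln (real q) > 0" using dims by simp
    have K_le: "real K \<le> c * ln (real q)" and K_ge: "c * ln (real q) \<le> real K + 1"
      using c lnq unfolding K_def by (simp_all add: less_imp_le mult_nonneg_nonneg)
    have K_q: "4 * K \<le> 31 * q"
    proof -
      have "c * ln (real q) \<le> 1 * real q" using c lnq ln_bound[of "real q"] dims by (intro mult_mono) auto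
      with K_le have "real K \<le> real q" by simp
      then show ?thesis by simp
    qed
    note E = estimator_error[OF A refl s1[folded T_def] T_def[symmetric] K_q]
    have "T * (3 * 18000 ^ K) + 2 * real q * T * (8 / pi / real (2 * K + 1)) \<le> (6 + 6 / c) * (real q / ln (real q)) * T"
    proof -
      have 1: "18000 ^ K \<le> 2 * (real q / ln (real q))"
      proof -
        have "(18000::real) ^ K = exp (real K * ln 18000)" by (simp add: exp_of_nat_mult)
        also have "\<dots> \<le> exp (c * ln (real q) * ln 18000)" using K_le ln1 by (simp add: mult_right_mono)
        also have "c * ln (real q) * ln 18000 = ln (sqrt (real q))" using ln1 dims by (simp add: c_def ln_sqrt)
        also have "exp (ln (sqrt (real q))) = sqrt (real q)" using dims by simp
        also have "sqrt (real q) \<le> 2 * (real q / ln (real q))"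
        proof -
          have "ln (real q) = 2 * ln (sqrt (real q))" using dims by (simp add: ln_sqrt)
          also have "\<dots> \<le> 2 * sqrt (real q)" using ln_bound[of "sqrt (real q)"] dims by simp
          finally have "sqrt (real q) * ln (real q) \<le> sqrt (real q) * (2 * sqrt (real q))" by (intro mult_left_mono) auto
          also have "\<dots> = 2 * real q" by simp
          finally show ?thesis using lnq by (simp add: field_simps)
        qed
        finally show ?thesis .
      qed
      have 2: "8 / pi / real (2 * K + 1) \<le> 3 / (c * ln (real q))"
      proof (rule frac_le)
        show "8 / pi \<le> 3" using pi_gt3 by (simp add: field_simps)
        show "c * ln (real q) \<le> real (2 * K + 1)" using K_ge by simp
      qed (use c lnq in auto)
      have "T * (3 * 18000 ^ K) + 2 * real q * T * (8 / pi / real (2 * K + 1)) \<le> 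
         T * (3 * (2 * (real q / ln (real q)))) + 2 * real q * T * (3 / (c * ln (real q)))"
        using T 1 2 by (intro add_mono mult_left_mono) auto
      also have "\<dots> = (6 + 6 / c) * (real q / ln (real q)) * T"
        using c lnq by (simp add: field_simps)
      finally show ?thesis .
    qed
    with E show ?thesis unfolding Let_def K_def[symmetric] by (simp add: T_def mult_ac)
  qed
  show ?thesis
    by (rule exI[of _ c], rule exI[of _ "6 + 6 / c"]) (use c main in \<open>auto intro: add_pos_pos\<close>)
qed

end
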